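(* Let $n\geq 0$ be fixed and let $\varphi,\psi\in\mathcal{H}^n$. Then $$\langle B^{n+1}_{\mathcal{C}}\varphi,\,B^{n+1}_{\mathcal{C}}\psi\rangle_{\mathcal{A}_{n+1}(\mathbb{H})}=8\,(n+1)!\,(2\pi)^n\,\langle\varphi,\psi\rangle_{\mathcal{H}^n}.$$ In particular, $$\|B^{n+1}_{\mathcal{C}}\varphi\|_{\mathcal{A}_{n+1}(\mathbb{H})}=2\sqrt2\,\sqrt{(n+1)!}\,(2\pi)^{\frac n2}\,\|\varphi\|_{\mathcal{H}^n}.$$
   Context: $\mathbb{H}$ is the algebra of real quaternions $q=x_0+x_1i+x_2j+x_3k$, $\mathbb{S}=\{q\in\mathbb{H}:q^2=-1\}$, $\Delta=\sum_{\ell=0}^3\partial_{x_\ell}^2$. A slice function on $\mathbb H$ is one of the form $f(x+Iy)=\alpha(x,y)+I\beta(x,y)$, $I\in\mathbb{S}$, with $\alpha$ even and $\beta$ odd in $y$; for such $f$, $\partial_sf(x+Iy)=\frac12(\partial_x-I\partial_y)f(x+Iy)$. It is slice polyanalytic of order $n+1$, $f\in\mathcal{SP}_{n+1}(\mathbb{H})$, if it is $\mathcal{C}^{n+1}$ and $\frac1{2^{n+1}}(\partial_x+I\partial_y)^{n+1}f(x+Iy)=0$ for all $I$ (order $1$: slice hyperholomorphic); then uniquely $f(q)=\sum_{k=0}^n\overline q^kf_k(q)$ with $f_k$ slice hyperholomorphic, and the polyanalytic Fueter map is $\mathcal{C}_{n+1}(f)(q)=\sum_{k=0}^nx_0^k\Delta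 f_k(q)$. For $s,k\ge0$: $Q_s(q,\overline q)=\sum_{j=0}^s\frac{2(s-j+1)}{(s+1)(s+2)}q^{s-j}\overline q^{\,j}$ and $\mathcal{M}_{k,s}(q,\overline q)=x_0^kQ_s(q,\overline q)$. The quaternionic true polyanalytic (QTP) Bargmann transform of $\varphi\in L^2(\mathbb{R},\mathbb{H})$ is $$(B^{n+1}\varphi)(q)=(-1)^n\sqrt{\tfrac{1}{(2\pi)^nn!}}\;e^{2\pi|q|^2}\partial_s^n\Big[e^{-2\pi|q|^2}\,2^{\frac34}\int_{\mathbb{R}}e^{-\pi(q^2+x^2)+2\pi\sqrt2\,qx}\varphi(x)\,dx\Big],$$ which lies in $\mathcal{SP}_{n+1}(\mathbb{H})$ and maps $L^2(\mathbb{R},\mathbb{H})$ onto the QTP Fock space $\mathcal{F}_n^T(\mathbb{H})$; the $\mathcal{C}$-polyanalytic Fueter–Bargmann transform is $B^{n+1}_{\mathcal{C}}=\mathcal{C}_{n+1}\circ B^{n+1}$, and $\mathcal{A}_{n+1}(\mathbb{H})=\mathcal{C}_{n+1}(\mathcal{F}_n^T(\mathbb{H}))$. For $f,g\in\mathcal{A}_{n+1}(\mathbb{H})$ with expansions $f=\sum_{h=0}^\infty\sum_{s=0}^n\mathcal{M}_{n-s,h+n-s}(q,\overline q)\alpha_{h,s}$ and $g=\sum_{h=0}^\infty\sum_{s=0}^n\mathcal{M}_{n-s,h+n-s}(q,\overline q)\beta_{h,s}$ ($\alpha_{h,s},\beta_{h,s}\in\mathbb{H}$), the inner product is $$\langle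 f,g\rangle_{\mathcal{A}_{n+1}(\mathbb{H})}=\sum_{h=0}^\infty\sum_{s=0}^n\frac{[(h+n-s)!]^2(s!)^2[(n-s)!]^2}{(2\pi)^{h+n+2-2s}(h+n+2)!}\,\overline{\beta_{h,s}}\,\alpha_{h,s},$$ with $\|f\|^2=\langle f,f\rangle$. $\psi_k^{2\pi}=h_k^{2\pi}/\|h_k^{2\pi}\|_{L^2(\mathbb{R},\mathbb{H})}$ are the normalized Hermite functions, $h_k^{2\pi}(x)=(-1)^ke^{\pi x^2}\frac{d^k}{dx^k}e^{-2\pi x^2}$; they form an orthonormal basis of $L^2(\mathbb{R},\mathbb{H})$, whose inner product is $\langle\varphi,\psi\rangle=\int_{\mathbb{R}}\overline{\psi(x)}\varphi(x)\,dx$. $\mathcal{H}^n=\bigoplus_{k=n+2}^\infty\{\psi_k^{2\pi}\alpha:\alpha\in\mathbb{H}\}$ (Hilbert direct sum in $L^2(\mathbb{R},\mathbb{H})$), with the inner product inherited from $L^2(\mathbb{R},\mathbb{H})$. *)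

theory Defs
  imports "HOL-Analysis.Analysis"
begin

section \<open>The real quaternions\<close>

datatype quat = Quat (qre: real) (qi: real) (qj: real) (qk: real)

lemma quat_eq_iff: "p = q \<longleftrightarrow> qre p = qre q \<and> qi p = qi q \<and> qj p = qj q \<and> qk p = qk q"
  by (cases p; cases q) simp

instantiation quat :: "{zero, one, plus, uminus, minus, times, scaleR}"
begin
definition "0 = Quat 0 0 0 0"
definition "1 = Quat 1 0 0 0"
definition "p + q = Quat (qre p + qre q) (qi p + qi q) (qj p + qj q) (qk p + qk q)"
definition "- q = Quat (- qre q) (- qi q) (- qj q) (- qk q)"
definition "p - q = Quat (qre p - qre q) (qi p - qi q) (qj p - qj q) (qk p - qk q)"
definition "p * q = Quat
   (qre p * qre q - qi p * qi q - qj p * qj q - qk p * qk q)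
   (qre p * qi q + qi p * qre q + qj p * qk q - qk p * qj q)
   (qre p * qj q - qi p * qk q + qj p * qre q + qk p * qi q)
   (qre p * qk q + qi p * qj q - qj p * qi q + qk p * qre q)"
definition "r *\<^sub>R q = Quat (r * qre q) (r * qi q) (r * qj q) (r * qk q)"
instance ..
end

lemmas quat_arith_defs = zero_quat_def one_quat_def plus_quat_def uminus_quat_def
  minus_quat_def times_quat_def scaleR_quat_def

instance quat :: real_algebra_1
  by standard (simp_all add: quat_arith_defs quat_eq_iff algebra_simps)

instantiation quat :: real_inner
begin
definition "inner p q = qre p * qre q + qi p * qi q + qj p * qj q + qk p * qk q"
definition "norm q = sqrt ((qre q)\<^sup>2 + (qi q)\<^sup>2 + (qj q)\<^sup>2 + (qk q)\<^sup>2)" for q :: quat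
definition "dist p q = norm (p - q)" for p q :: quat
definition "sgn q = q /\<^sub>R norm q" for q :: quat
definition "uniformity = (INF e\<in>{0<..}. principal {(p :: quat, q). dist p q < e})"
definition "open U \<longleftrightarrow> (\<forall>p\<in>U. eventually (\<lambda>(p', q). p' = p \<longrightarrow> q \<in> U) uniformity)"
  for U :: "quat set"
instance
proof
  fix p q r :: quat and c :: real and U :: "quat set"
  show "inner p q = inner q p" "inner (p + q) r = inner p r + inner q r"
    "inner (c *\<^sub>R p) q = c * inner p q" "0 \<le> inner p p"
    by (simp_all add: inner_quat_def quat_arith_defs algebra_simps)
  show "inner p p = 0 \<longleftrightarrow> p = 0"
  proof
    assume "inner p p = 0"
    moreover have "qre p * qre p \<ge> 0" "qi p * qi p \<ge> 0" "qj p * qj p \<ge> 0" "qk p * qk p \<ge> 0"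
      by simp_all
    ultimately have "qre p * qre p = 0 \<and> qi p * qi p = 0 \<and> qj p * qj p = 0 \<and> qk p * qk p = 0"
      unfolding inner_quat_def by linarith
    then show "p = 0" by (simp add: quat_eq_iff zero_quat_def)
  qed (simp add: inner_quat_def zero_quat_def)
  show "norm p = sqrt (inner p p)"
    by (simp add: inner_quat_def norm_quat_def power2_eq_square)
qed (rule dist_quat_def sgn_quat_def uniformity_quat_def open_quat_def)+
end

instantiation quat :: inverse
begin
definition "inverse q = Quat (qre q / (norm q)\<^sup>2) (- qi q / (norm q)\<^sup>2)
    (- qj q / (norm q)\<^sup>2) (- qk q / (norm q)\<^sup>2)" for q :: quat
definition "p div q = p * inverse q" for p q :: quat
instance ..
end

instance quat :: real_normed_div_algebra
proof
  fix p q :: quat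
  have n2: "(norm q)\<^sup>2 = (qre q)\<^sup>2 + (qi q)\<^sup>2 + (qj q)\<^sup>2 + (qk q)\<^sup>2" for q :: quat
    by (simp add: norm_quat_def)
  have inv: "inverse p = inverse ((norm p)\<^sup>2) *\<^sub>R Quat (qre p) (- qi p) (- qj p) (- qk p)"
    by (simp add: inverse_quat_def scaleR_quat_def divide_inverse mult.commute)
  have conj: "Quat (qre p) (- qi p) (- qj p) (- qk p) * p = (norm p)\<^sup>2 *\<^sub>R 1"
    "p * Quat (qre p) (- qi p) (- qj p) (- qk p) = (norm p)\<^sup>2 *\<^sub>R 1"
    by (simp_all add: n2 quat_arith_defs) (simp_all add: power2_eq_square)
  show "inverse p * p = 1" "p * inverse p = 1" if "p \<noteq> 0"
    using that by (simp_all add: inv conj)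
  show "p / q = p * inverse q" by (rule divide_quat_def)
  show "inverse (0 :: quat) = 0" by (simp add: inverse_quat_def zero_quat_def)
  have "(norm (p * q))\<^sup>2 = (norm p * norm q)\<^sup>2"
    unfolding power_mult_distrib n2 times_quat_def quat.sel by algebra
  then show "norm (p * q) = norm p * norm q"
    by (rule power2_eq_imp_eq) (simp_all add: norm_quat_def)
qed

instantiation quat :: euclidean_space
begin
definition "Basis = {Quat 1 0 0 0, Quat 0 1 0 0, Quat 0 0 1 0, Quat 0 0 0 1}"
instance
proof
  fix u v x :: quat
  show "(Basis :: quat set) \<noteq> {}" "finite (Basis :: quat set)"
    by (simp_all add: Basis_quat_def)
  show "inner u v = (if u = v then 1 else 0)" if "u \<in> Basis" "v \<in> Basis"
    using that unfolding Basis_quat_def insert_iff empty_iff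
    by (elim disjE FalseE; hypsubst; simp add: inner_quat_def)
  show "(\<forall>u\<in>Basis. inner x u = 0) \<longleftrightarrow> x = 0"
    by (cases x) (simp add: Basis_quat_def inner_quat_def zero_quat_def)
qed
end

definition qcnj :: "quat \<Rightarrow> quat" where
  "qcnj q = Quat (qre q) (- qi q) (- qj q) (- qk q)"

definition imag_units :: "quat set"  ("\<bbbS>") where
  "\<bbbS> = {q. q\<^sup>2 = - 1}"


section \<open>Slice functions and slice polyanalytic functions\<close>

definition slice_function :: "(quat \<Rightarrow> quat) \<Rightarrow> bool" where
  "slice_function f \<longleftrightarrow> (\<exists>\<alpha> \<beta> :: real \<Rightarrow> real \<Rightarrow> quat.
     (\<forall>x y. \<alpha> x (- y) = \<alpha> x y \<and> \<beta> x (- y) = - \<beta> x y) \<and>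
     (\<forall>I\<in>\<bbbS>. \<forall>x y. f (of_real x + I * of_real y) = \<alpha> x y + I * \<beta> x y))"

text \<open>Partial derivative in direction \<open>e\<close>, the Laplacian of $\mathbb{R}^4$, and the class
  $\mathcal{C}^m$, all for functions on $\mathbb{H}\cong\mathbb{R}^4$.\<close>

definition partial :: "quat \<Rightarrow> (quat \<Rightarrow> quat) \<Rightarrow> quat \<Rightarrow> quat" where
  "partial e f q = vector_derivative (\<lambda>t. f (q + t *\<^sub>R e)) (at 0)"

definition laplacian :: "(quat \<Rightarrow> quat) \<Rightarrow> quat \<Rightarrow> quat" where
  "laplacian f q = (\<Sum>e\<in>Basis. partial e (partial e f) q)"

primrec Ck :: "nat \<Rightarrow> (quat \<Rightarrow> quat) \<Rightarrow> bool" where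
  "Ck 0 f \<longleftrightarrow> continuous_on UNIV f"
| "Ck (Suc m) f \<longleftrightarrow> (\<forall>e\<in>Basis.
     (\<forall>q. (\<lambda>t. f (q + t *\<^sub>R e)) differentiable (at 0)) \<and> Ck m (partial e f))"

text \<open>The operators $\frac12(\partial_x - I\partial_y)$ and $\frac12(\partial_x + I\partial_y)$
  acting on functions of the two real variables $x, y$.\<close>

definition d_slice :: "quat \<Rightarrow> (real \<Rightarrow> real \<Rightarrow> quat) \<Rightarrow> real \<Rightarrow> real \<Rightarrow> quat" where
  "d_slice I F x y = (1/2) *\<^sub>R (vector_derivative (\<lambda>t. F t y) (at x)
     - I * vector_derivative (\<lambda>t. F x t) (at y))"

definition dbar_slice :: "quat \<Rightarrow> (real \<Rightarrow> real \<Rightarrow> quat) \<Rightarrow> real \<Rightarrow> real \<Rightarrow> quat" where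
  "dbar_slice I F x y = (1/2) *\<^sub>R (vector_derivative (\<lambda>t. F t y) (at x)
     + I * vector_derivative (\<lambda>t. F x t) (at y))"

text \<open>\<open>slice_poly m\<close> is the class $\mathcal{SP}_m(\mathbb{H})$ of slice polyanalytic functions
  of order \<open>m\<close>.\<close>

definition slice_poly :: "nat \<Rightarrow> (quat \<Rightarrow> quat) set" where
  "slice_poly m = {f. slice_function f \<and> Ck m f \<and>
     (\<forall>I\<in>\<bbbS>. \<forall>x y. (dbar_slice I ^^ m) (\<lambda>x y. f (of_real x + I * of_real y)) x y = 0)}"

abbreviation slice_hyperholomorphic :: "(quat \<Rightarrow> quat) \<Rightarrow> bool" where
  "slice_hyperholomorphic f \<equiv> f \<in> slice_poly 1"

text \<open>Every \<open>q\<close> is \<open>x + Iy\<close> with \<open>x = qre q\<close>, \<open>y = norm (q - x) \<ge> 0\<close> and \<open>I = slice_unit q\<close>.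
  For real \<open>q\<close> every \<open>I\<close> is possible; since \<open>\<partial>\<^sub>s f\<close> is only used for slice functions \<open>f\<close>
  (\<open>\<alpha>\<close> even and \<open>\<beta>\<close> odd in \<open>y\<close>), its value does not depend on this choice.\<close>

definition slice_unit :: "quat \<Rightarrow> quat" where
  "slice_unit q = (if q = of_real (qre q) then Quat 0 1 0 0 else sgn (q - of_real (qre q)))"

definition slice_deriv :: "(quat \<Rightarrow> quat) \<Rightarrow> quat \<Rightarrow> quat"  ("\<partial>\<^sub>s") where
  "\<partial>\<^sub>s f q = (let I = slice_unit q in
     d_slice I (\<lambda>x y. f (of_real x + I * of_real y)) (qre q) (norm (q - of_real (qre q))))"

lemma of_real_quat: "of_real r = Quat r 0 0 0"
  by (simp add: of_real_def one_quat_def scaleR_quat_def)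

lemma slice_unit_in_imag_units: "slice_unit q \<in> \<bbbS>"
proof (cases "q = of_real (qre q)")
  case True
  then have "slice_unit q = Quat 0 1 0 0"
    unfolding slice_unit_def by (rule if_P)
  then show ?thesis
    by (simp add: imag_units_def power2_eq_square quat_arith_defs)
next
  case False
  define p where "p = q - of_real (qre q)"
  have p0: "qre p = 0" by (simp add: p_def of_real_quat minus_quat_def)
  have "p \<noteq> 0" using False by (simp add: p_def)
  have "p * p = - of_real ((norm p)\<^sup>2)"
    by (simp add: p0 norm_quat_def of_real_quat times_quat_def uminus_quat_def power2_eq_square)
  then have "sgn p * sgn p = (inverse (norm p) * inverse (norm p)) *\<^sub>R (- of_real ((norm p)\<^sup>2))"
    by (simp add: sgn_quat_def)
  also have "\<dots> = - ((inverse (norm p) * inverse (norm p) * (norm p)\<^sup>2) *\<^sub>R 1)"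
    by (simp add: of_real_def)
  also have "inverse (norm p) * inverse (norm p) * (norm p)\<^sup>2 = 1"
    using \<open>p \<noteq> 0\<close> by (simp add: power2_eq_square field_simps)
  also have "- (1 *\<^sub>R 1) = (- 1 :: quat)" by simp
  finally show ?thesis
    using False by (simp add: slice_unit_def imag_units_def power2_eq_square p_def)
qed

lemma slice_decomposition:
  "q = of_real (qre q) + slice_unit q * of_real (norm (q - of_real (qre q)))"
proof -
  define p where "p = q - of_real (qre q)"
  have "slice_unit q * of_real (norm p) = p"
  proof (cases "p = 0")
    case False
    then have "slice_unit q = sgn p"
      by (simp add: slice_unit_def p_def)
    then show ?thesis using False by (simp add: sgn_quat_def of_real_def)
  qed simp
  then show ?thesis by (simp add: p_def)
qed


section \<open>The polyanalytic Fueter map\<close>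

text \<open>The slice hyperholomorphic components \<open>f\<^sub>k\<close>, \<open>k \<le> n\<close>, of
  $f = \sum_{k=0}^n \overline q^k f_k \in \mathcal{SP}_{n+1}(\mathbb{H})$; they are set to
  zero beyond \<open>n\<close> so that the whole sequence is unique.\<close>

definition poly_components :: "nat \<Rightarrow> (quat \<Rightarrow> quat) \<Rightarrow> nat \<Rightarrow> quat \<Rightarrow> quat" where
  "poly_components n f = (THE F.
     (\<forall>k\<le>n. slice_hyperholomorphic (F k)) \<and> (\<forall>k>n. F k = (\<lambda>_. 0)) \<and>
     (\<forall>q. f q = (\<Sum>k\<le>n. qcnj q ^ k * F k q)))"

text \<open>Here and below, the natural number argument \<open>n\<close> of an operator or space
  stands for the order \<open>n + 1\<close>.\<close>

definition fueter_map :: "nat \<Rightarrow> (quat \<Rightarrow> quat) \<Rightarrow> quat \<Rightarrow> quat" where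
  "fueter_map n f q = (\<Sum>k\<le>n. of_real (qre q ^ k) * laplacian (poly_components n f k) q)"

definition Q_poly :: "nat \<Rightarrow> quat \<Rightarrow> quat" where
  "Q_poly s q = (\<Sum>j\<le>s. of_real (2 * real (s - j + 1) / (real (s + 1) * real (s + 2)))
     * q ^ (s - j) * qcnj q ^ j)"

definition M_poly :: "nat \<Rightarrow> nat \<Rightarrow> quat \<Rightarrow> quat" where
  "M_poly k s q = of_real (qre q ^ k) * Q_poly s q"


section \<open>The space $L^2(\mathbb{R},\mathbb{H})$ and Hermite functions\<close>

definition L2 :: "(real \<Rightarrow> quat) set" where
  "L2 = {\<phi>. \<phi> \<in> borel_measurable lborel \<and> integrable lborel (\<lambda>x. (norm (\<phi> x))\<^sup>2)}"

definition L2_inner :: "(real \<Rightarrow> quat) \<Rightarrow> (real \<Rightarrow> quat) \<Rightarrow> quat" where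
  "L2_inner \<phi> \<psi> = (LINT x|lborel. qcnj (\<psi> x) * \<phi> x)"

definition L2_norm :: "(real \<Rightarrow> quat) \<Rightarrow> real" where
  "L2_norm \<phi> = sqrt (LINT x|lborel. (norm (\<phi> x))\<^sup>2)"

definition hermite_fun :: "nat \<Rightarrow> real \<Rightarrow> real" where
  "hermite_fun k x = (-1) ^ k * exp (pi * x\<^sup>2) * (deriv ^^ k) (\<lambda>x. exp (- 2 * pi * x\<^sup>2)) x"

definition normalized_hermite :: "nat \<Rightarrow> real \<Rightarrow> quat" where
  "normalized_hermite k x = of_real (hermite_fun k x / L2_norm (\<lambda>x. of_real (hermite_fun k x)))"

text \<open>The Hilbert direct sum of the lines \<open>{\<psi>\<^sub>k \<alpha> | \<alpha>}\<close>, \<open>k \<ge> n + 2\<close>: all $L^2$-limits of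
  series \<open>\<Sum> \<psi>\<^sub>k a\<^sub>k\<close>.\<close>

definition hermite_space :: "nat \<Rightarrow> (real \<Rightarrow> quat) set" where
  "hermite_space n = {\<phi>\<in>L2. \<exists>a :: nat \<Rightarrow> quat.
     (\<lambda>N. L2_norm (\<lambda>x. \<phi> x - (\<Sum>k\<in>{n+2..<N}. normalized_hermite k x * a k))) \<longlonglongrightarrow> 0}"


section \<open>Bargmann and Fueter--Bargmann transforms\<close>

definition bargmann :: "(real \<Rightarrow> quat) \<Rightarrow> quat \<Rightarrow> quat" where
  "bargmann \<phi> q = of_real (2 powr (3/4)) * (LINT x|lborel.
     exp (- (of_real pi * (q\<^sup>2 + of_real (x\<^sup>2))) + of_real (2 * pi * sqrt 2) * q * of_real x) * \<phi> x)"

definition QTP_bargmann :: "nat \<Rightarrow> (real \<Rightarrow> quat) \<Rightarrow> quat \<Rightarrow> quat" where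
  "QTP_bargmann n \<phi> q =
     of_real ((-1) ^ n * sqrt (1 / ((2 * pi) ^ n * fact n)) * exp (2 * pi * (norm q)\<^sup>2)) *
     (\<partial>\<^sub>s ^^ n) (\<lambda>q. of_real (exp (- 2 * pi * (norm q)\<^sup>2)) * bargmann \<phi> q) q"

definition fueter_bargmann :: "nat \<Rightarrow> (real \<Rightarrow> quat) \<Rightarrow> quat \<Rightarrow> quat" where
  "fueter_bargmann n \<phi> = fueter_map n (QTP_bargmann n \<phi>)"


section \<open>The inner product of $\mathcal{A}_{n+1}(\mathbb{H})$\<close>

text \<open>The coefficients \<open>\<alpha>\<^sub>h\<^sub>,\<^sub>s\<close>, \<open>s \<le> n\<close>, of the expansion of \<open>f\<close>, set to zero for \<open>s > n\<close> so that
  the family is unique.\<close>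

definition A_coeffs :: "nat \<Rightarrow> (quat \<Rightarrow> quat) \<Rightarrow> nat \<Rightarrow> nat \<Rightarrow> quat" where
  "A_coeffs n f = (THE \<alpha>. (\<forall>h. \<forall>s>n. \<alpha> h s = 0) \<and>
     (\<forall>q. (\<lambda>h. \<Sum>s\<le>n. M_poly (n - s) (h + n - s) q * \<alpha> h s) sums f q))"

text \<open>The exponent \<open>h + n + 2 - 2s\<close> may be negative, hence the integer power.\<close>

definition A_weight :: "nat \<Rightarrow> nat \<Rightarrow> nat \<Rightarrow> real" where
  "A_weight n h s = (fact (h + n - s))\<^sup>2 * (fact s)\<^sup>2 * (fact (n - s))\<^sup>2 /
     ((2 * pi) powi (int h + int n + 2 - 2 * int s) * fact (h + n + 2))"

definition A_inner :: "nat \<Rightarrow> (quat \<Rightarrow> quat) \<Rightarrow> (quat \<Rightarrow> quat) \<Rightarrow> quat" where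
  "A_inner n f g = (\<Sum>h. \<Sum>s\<le>n.
     of_real (A_weight n h s) * (qcnj (A_coeffs n g h s) * A_coeffs n f h s))"

text \<open>\<open>A_inner n f f\<close> is real and non-negative.\<close>

definition A_norm :: "nat \<Rightarrow> (quat \<Rightarrow> quat) \<Rightarrow> real" where
  "A_norm n f = sqrt (qre (A_inner n f f))"

end

theory Submission
  imports Defs "HOL-Probability.Distributions" "HOL-Real_Asymp.Real_Asymp"
begin

text \<open>For $\varphi = \sum_k \psi_k a_k$ the Bargmann transform is the power series
  $g(q) = \sum_k q^k \sqrt2 (2\pi)^{k/2} (k!)^{-1/2} a_k$, and since
  $\partial_s (e^{-2\pi|q|^2} F) = e^{-2\pi|q|^2}(\partial_s - 2\pi\overline q) F$, the slice
  hyperholomorphic components of $B^{n+1}\varphi$ are multiples of the derivatives $g^{(n-j)}$.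
  As $\Delta q^m = -2m(m-1) Q_{m-2}$, applying $\mathcal{C}_{n+1}$ produces an expansion in the
  $\mathcal{M}_{n-s,h+n-s}$ whose coefficient $\alpha_{h,s}$ is a real multiple of $a_{h+n+2}$;
  the square of this multiple times the weight of the inner product is $8\, n!\, (2\pi)^n$
  for every $s \le n$ and $h$, and Parseval's identity gives the claim.

  The components and the coefficients $\alpha_{h,s}$ are defined by unique description, so their
  uniqueness has to be shown as well: for the former by applying $\partial_x + I\partial_y$, for the
  latter by comparing homogeneous parts along the lines through the origin.\<close>

section \<open>Quaternions\<close>

text \<open>The cut-off \<open>n + 2\<close> of the Hermite space is what makes the expansion fit:
  \<open>s\<close> derivatives followed by the Laplacian lower an index \<open>k\<close> to
  \<open>k - s - 2\<close>, and \<open>M_poly (n - s) m\<close> occurs in the expansion only for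
  \<open>m \<ge> n - s\<close>, that is for \<open>k \<ge> n + 2\<close>. The factor
  \<open>(n + 1)!\<close> arises because the \<open>n + 1\<close> values of \<open>s\<close>
  contribute equally, each with \<open>n!\<close>.

  Two obstacles shape the rest. Quaternions do not commute, so the derivative of
  \<open>q ^ m\<close> along \<open>e\<close> is a sum of words in \<open>q\<close> and
  \<open>e\<close>; it collapses to the usual formula only for directions inside a slice, and
  summing second derivatives over the four coordinate directions is what produces conjugates.
  Moreover, an expansion in \<open>M_poly\<close> is known to converge only after the summation over
  \<open>s\<close> for each \<open>h\<close>, while terms with different \<open>s\<close> have
  different degrees; before terms can be regrouped by degree, each of the \<open>n + 1\<close>
  subseries has to be shown to converge by itself.\<close>

lemma quat_sel_simps [simp]:
  "qre 0 = 0" "qi 0 = 0" "qj 0 = 0" "qk 0 = 0"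
  "qre 1 = 1" "qi 1 = 0" "qj 1 = 0" "qk 1 = 0"
  "qre (p + q) = qre p + qre q" "qi (p + q) = qi p + qi q"
  "qj (p + q) = qj p + qj q" "qk (p + q) = qk p + qk q"
  "qre (p - q) = qre p - qre q" "qi (p - q) = qi p - qi q"
  "qj (p - q) = qj p - qj q" "qk (p - q) = qk p - qk q"
  "qre (- q) = - qre q" "qi (- q) = - qi q" "qj (- q) = - qj q" "qk (- q) = - qk q"
  "qre (r *\<^sub>R q) = r * qre q" "qi (r *\<^sub>R q) = r * qi q"
  "qj (r *\<^sub>R q) = r * qj q" "qk (r *\<^sub>R q) = r * qk q"
  "qre (of_real r) = r" "qi (of_real r) = 0" "qj (of_real r) = 0" "qk (of_real r) = 0"
  by (simp_all add: quat_arith_defs of_real_quat)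

lemma quat_numeral_sel [simp]:
  "qre (numeral n) = numeral n" "qi (numeral n) = 0" "qj (numeral n) = 0" "qk (numeral n) = 0"
  by (simp_all only: of_real_numeral[symmetric, where 'a = quat] quat_sel_simps)

lemma qcnj_sel [simp]:
  "qre (qcnj q) = qre q" "qi (qcnj q) = - qi q" "qj (qcnj q) = - qj q" "qk (qcnj q) = - qk q"
  by (simp_all add: qcnj_def)

lemma qcnj_simps [simp]:
  "qcnj 0 = 0" "qcnj 1 = 1" "qcnj (p + q) = qcnj p + qcnj q" "qcnj (p - q) = qcnj p - qcnj q"
  "qcnj (- q) = - qcnj q" "qcnj (r *\<^sub>R q) = r *\<^sub>R qcnj q" "qcnj (of_real r) = of_real r"
  "qcnj (qcnj q) = q"
  by (simp_all add: quat_eq_iff)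

lemma qcnj_mult: "qcnj (p * q) = qcnj q * qcnj p"
  by (simp add: quat_eq_iff times_quat_def)

lemma norm_qcnj [simp]: "norm (qcnj q) = norm q"
  by (simp add: norm_quat_def)

lemma qcnj_mult_self: "qcnj q * q = of_real ((norm q)\<^sup>2)" "q * qcnj q = of_real ((norm q)\<^sup>2)"
  by (simp_all add: quat_eq_iff times_quat_def norm_quat_def power2_eq_square)

lemma bounded_linear_qcnj: "bounded_linear qcnj"
  by (intro bounded_linear_intro[where K = 1]) simp_all

text \<open>Taking norms in \<open>I * I = - 1\<close> gives norm one, so
  \<open>qcnj I * I = 1\<close>; multiplying by \<open>I\<close> yields \<open>qcnj I = - I\<close>,
  and real parts then cancel.\<close>

lemma imag_unitD:
  assumes "I \<in> \<bbbS>"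
  shows "I * I = - 1" and "qcnj I = - I" and "qre I = 0" and "norm I = 1"
proof -
  show sq: "I * I = - 1" using assms by (simp add: imag_units_def power2_eq_square)
  then have "norm I * norm I = 1" by (metis norm_minus_cancel norm_mult norm_one)
  then show n: "norm I = 1" by (metis norm_ge_zero mult_cancel_left2 power2_eq_square power2_eq_1_iff
        abs_of_nonneg abs_minus_cancel abs_one)
  have "qcnj I = qcnj I * (I * I) * (- 1)" by (simp add: sq)
  also have "\<dots> = - ((qcnj I * I) * I)" by (simp add: mult.assoc)
  also have "\<dots> = - I" by (simp add: qcnj_mult_self n)
  finally show c: "qcnj I = - I" .
  then have "qre (qcnj I) = qre (- I)" by (rule arg_cong)
  then show "qre I = 0" by simp
qed

lemma qi_unit: "Quat 0 1 0 0 \<in> \<bbbS>"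
  by (simp add: imag_units_def power2_eq_square quat_arith_defs)

section \<open>Quaternionic power series\<close>

text \<open>Directional derivative of \<open>q ^ m\<close> along \<open>e\<close>. As
  \<open>e\<close> need not commute with \<open>q\<close>, it is generated by the product rule,
  peeling off the leftmost factor.\<close>

primrec pow_d :: "quat \<Rightarrow> nat \<Rightarrow> quat \<Rightarrow> quat" where
  "pow_d e 0 q = 0"
| "pow_d e (Suc m) q = e * q ^ m + q * pow_d e m q"

text \<open>Second derivative along the same direction. Both summands of \<open>pow_d\<close>
  contribute a term \<open>e * pow_d e m q\<close>, hence the factor \<open>2\<close>.\<close>

primrec pow_dd :: "quat \<Rightarrow> nat \<Rightarrow> quat \<Rightarrow> quat" where
  "pow_dd e 0 q = 0"
| "pow_dd e (Suc m) q = 2 * (e * pow_d e m q) + q * pow_dd e m q"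

lemma line_deriv:
  "((\<lambda>t. q + t *\<^sub>R e) has_vector_derivative e) (at t)" for q e :: quat
  by (auto intro!: derivative_eq_intros)

lemma pow_has_deriv:
  "((\<lambda>t. (q + t *\<^sub>R e) ^ m) has_vector_derivative pow_d e m (q + t *\<^sub>R e)) (at t)"
proof (induction m)
  case (Suc m)
  show ?case
    using has_vector_derivative_mult[OF line_deriv[of q e t] Suc] by (simp add: add.commute)
qed simp

lemma pow_d_has_deriv:
  "((\<lambda>t. pow_d e m (q + t *\<^sub>R e)) has_vector_derivative pow_dd e m (q + t *\<^sub>R e)) (at t)"
proof (induction m)
  case (Suc m)
  have "((\<lambda>t. e * (q + t *\<^sub>R e) ^ m + (q + t *\<^sub>R e) * pow_d e m (q + t *\<^sub>R e)) has_vector_derivative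
     e * pow_d e m (q + t *\<^sub>R e) +
     ((q + t *\<^sub>R e) * pow_dd e m (q + t *\<^sub>R e) + e * pow_d e m (q + t *\<^sub>R e))) (at t)"
    by (intro has_vector_derivative_add has_vector_derivative_mult line_deriv Suc
         has_vector_derivative_mult_right pow_has_deriv)
  then show ?case by (simp only: pow_d.simps pow_dd.simps) (simp add: mult_2 algebra_simps)
qed simp

text \<open>The natural exponent is \<open>m - 1\<close>; with \<open>1 \<le> R\<close> it may be
  rounded up to \<open>m\<close>, which keeps the induction free of truncated subtraction and gives
  a majorant valid on the whole ball of radius \<open>R\<close>.\<close>

lemma norm_pow_d:
  assumes "norm q \<le> R" "1 \<le> R"
  shows "norm (pow_d e m q) \<le> real m * norm e * R ^ m"
proof (induction m)
  case (Suc m)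
  have R: "R ^ m \<le> R ^ Suc m" using assms by (intro power_increasing) auto
  have "norm (pow_d e (Suc m) q) \<le> norm e * norm q ^ m + norm q * norm (pow_d e m q)"
    by (simp add: norm_triangle_le norm_mult norm_power)
  also have "\<dots> \<le> norm e * R ^ Suc m + R * (real m * norm e * R ^ m)"
    using assms Suc R by (intro add_mono mult_mono order_trans[OF power_mono R]) auto
  also have "\<dots> = real (Suc m) * norm e * R ^ Suc m" by (simp add: algebra_simps)
  finally show ?case .
qed simp

lemma norm_pow_dd:
  assumes "norm q \<le> R" "1 \<le> R"
  shows "norm (pow_dd e m q) \<le> (real m)\<^sup>2 * (norm e)\<^sup>2 * R ^ m"
proof (induction m)
  case (Suc m)
  have R: "R ^ m \<le> R ^ Suc m" using assms by (intro power_increasing) auto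
  have "norm (pow_dd e (Suc m) q) \<le> 2 * (norm e * norm (pow_d e m q)) + norm q * norm (pow_dd e m q)"
    by (simp add: norm_triangle_le norm_mult norm_power)
  also have "\<dots> \<le> 2 * (norm e * (real m * norm e * R ^ Suc m)) + R * ((real m)\<^sup>2 * (norm e)\<^sup>2 * R ^ m)"
  proof (intro add_mono mult_mono order_refl Suc)
    show "norm (pow_d e m q) \<le> real m * norm e * R ^ Suc m"
      using norm_pow_d[OF assms, of e m] mult_left_mono[OF R, of "real m * norm e"] by simp
  qed (use assms in auto)
  also have "\<dots> = (2 * real m + (real m)\<^sup>2) * ((norm e)\<^sup>2 * R ^ Suc m)"
    by (simp add: algebra_simps power2_eq_square)
  also have "\<dots> \<le> (real (Suc m))\<^sup>2 * ((norm e)\<^sup>2 * R ^ Suc m)"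
    using assms by (intro mult_right_mono) (auto simp: power2_eq_square algebra_simps)
  finally show ?case by (simp only: mult.assoc)
qed simp

text \<open>The classical formula survives where direction and point commute, as for the directions
  \<open>1\<close> and \<open>I\<close> at the points \<open>x + I y\<close> of one slice.\<close>

lemma pow_d_commute:
  assumes "e * q = q * e"
  shows "pow_d e m q = of_nat m * q ^ (m - 1) * e"
proof (induction m)
  case (Suc m)
  have "e * q ^ m = q ^ m * e" using assms by (metis power_commuting_commutes)
  moreover have "q * pow_d e m q = of_nat m * q ^ m * e"
  proof (cases m)
    case (Suc k)
    have "q * pow_d e m q = q * of_nat m * q ^ k * e" using Suc.IH by (simp add: Suc mult.assoc)
    also have "q * of_nat m = of_nat m * q" by (rule mult_of_nat_commute[symmetric])
    finally show ?thesis by (simp only: Suc mult.assoc power_Suc)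
  qed simp
  ultimately show ?case by (simp add: algebra_simps)
qed simp

section \<open>Coefficient sequences of everywhere convergent series, and termwise
  differentiation\<close>

definition entire :: "(nat \<Rightarrow> 'a::real_normed_vector) \<Rightarrow> bool" where
  "entire a \<longleftrightarrow> (\<forall>R. summable (\<lambda>m. norm (a m) * R ^ m))"

definition qseries :: "(nat \<Rightarrow> quat) \<Rightarrow> quat \<Rightarrow> quat" where
  "qseries a q = (\<Sum>m. q ^ m * a m)"

definition dcoef :: "(nat \<Rightarrow> quat) \<Rightarrow> nat \<Rightarrow> quat" where
  "dcoef a m = real (Suc m) *\<^sub>R a (Suc m)"

text \<open>Since \<open>m \<le> 2 ^ m\<close> and \<open>m\<^sup>2 \<le> 4 ^ m\<close>, the factors
  produced by differentiation are absorbed by passing to the radius \<open>2 * \<bar>R\<bar>\<close>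
  or \<open>4 * \<bar>R\<bar>\<close>.\<close>

lemma entire_bound:
  assumes "entire a"
  shows "summable (\<lambda>m. real m * norm (a m) * R ^ m)" "summable (\<lambda>m. (real m)\<^sup>2 * norm (a m) * R ^ m)"
proof -
  have le: "real m \<le> 2 ^ m" for m
    using of_nat_less_two_power[of m, where 'a = real] by linarith
  have le2: "(real m)\<^sup>2 \<le> 4 ^ m" for m
  proof -
    have "(real m)\<^sup>2 \<le> (2 ^ m)\<^sup>2" by (intro power_mono le) simp
    also have "\<dots> = 4 ^ m" by (simp add: power2_eq_square flip: power_mult_distrib)
    finally show ?thesis .
  qed
  have *: "summable (\<lambda>m. norm (a m) * (c * \<bar>R\<bar>) ^ m)" for c using assms by (simp add: entire_def)
  show "summable (\<lambda>m. real m * norm (a m) * R ^ m)"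
  proof (rule summable_comparison_test'[OF *[of 2]])
    fix m :: nat
    show "norm (real m * norm (a m) * R ^ m) \<le> norm (a m) * (2 * \<bar>R\<bar>) ^ m"
      using mult_right_mono[OF le[of m], of "norm (a m) * \<bar>R\<bar> ^ m"]
      by (simp add: abs_mult power_abs power_mult_distrib mult_ac)
  qed
  show "summable (\<lambda>m. (real m)\<^sup>2 * norm (a m) * R ^ m)"
  proof (rule summable_comparison_test'[OF *[of 4]])
    fix m :: nat
    show "norm ((real m)\<^sup>2 * norm (a m) * R ^ m) \<le> norm (a m) * (4 * \<bar>R\<bar>) ^ m"
      using mult_right_mono[OF le2[of m], of "norm (a m) * \<bar>R\<bar> ^ m"]
      by (simp add: abs_mult power_abs power_mult_distrib mult_ac)
  qed
qed

lemma entire_summable: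
  fixes a :: "nat \<Rightarrow> quat"
  assumes "entire a"
  shows "summable (\<lambda>m. q ^ m * a m)"
proof (rule summable_norm_cancel)
  show "summable (\<lambda>m. norm (q ^ m * a m))"
    using assms by (simp add: entire_def norm_mult norm_power mult.commute[of "norm q ^ _"])
qed

lemma entire_scaleR [intro]: "entire a \<Longrightarrow> entire (\<lambda>m. c *\<^sub>R a m)"
  unfolding entire_def by (auto simp: mult.assoc intro!: summable_mult)

lemma qseries_scaleR: "entire a \<Longrightarrow> qseries (\<lambda>m. c *\<^sub>R a m) q = c *\<^sub>R qseries a q"
  unfolding qseries_def mult_scaleR_right by (intro suminf_scaleR_right[symmetric] entire_summable)

lemma entire_dcoef [intro]:
  assumes "entire a"
  shows "entire (dcoef a)"
proof -
  have "summable (\<lambda>m. norm (dcoef a m) * R ^ m)" for R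
  proof (cases "R = 0")
    case False
    have "summable (\<lambda>m. real (Suc m) * norm (a (Suc m)) * R ^ Suc m)"
      using entire_bound(1)[OF assms, of R] by (subst summable_Suc_iff)
    then have "summable (\<lambda>m. real (Suc m) * norm (a (Suc m)) * R ^ Suc m * inverse R)"
      by (rule summable_mult2)
    then show ?thesis using False by (simp add: dcoef_def mult_ac)
  qed (simp add: summable_0_powser)
  then show ?thesis by (simp add: entire_def)
qed

lemma entire_dcoef_pow [intro]: "entire a \<Longrightarrow> entire ((dcoef ^^ k) a)"
  by (induction k) auto

lemma dcoef_pow: "(dcoef ^^ k) a m = (fact (m + k) / fact m) *\<^sub>R a (m + k)"
proof (induction k arbitrary: m)
  case (Suc k)
  have "(dcoef ^^ Suc k) a m = real (Suc m) *\<^sub>R (dcoef ^^ k) a (Suc m)"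
    by (simp add: dcoef_def)
  also have "\<dots> = (real (Suc m) * (fact (Suc m + k) / fact (Suc m))) *\<^sub>R a (Suc m + k)"
    unfolding Suc by simp
  also have "real (Suc m) * (fact (Suc m + k) / fact (Suc m)) = fact (m + Suc k) / fact m"
    by (simp add: divide_simps)
  finally show ?case by simp
qed simp

text \<open>The M-test makes the differentiated series converge uniformly on a bounded piece of the
  line, which permits termwise differentiation. The statement is kept abstract so that it serves for
  first and second derivatives alike.\<close>

lemma series_line_deriv:
  fixes f g :: "nat \<Rightarrow> quat \<Rightarrow> quat"
  assumes d: "\<And>m q t. ((\<lambda>t. f m (q + t *\<^sub>R e)) has_vector_derivative g m (q + t *\<^sub>R e)) (at t)"
    and M: "\<And>R. summable (M R)" "\<And>m q R. norm q \<le> R \<Longrightarrow> 1 \<le> R \<Longrightarrow> norm (g m q) \<le> M R m"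
    and s: "\<And>q. summable (\<lambda>m. f m q)"
  shows "((\<lambda>t. \<Sum>m. f m (q + t *\<^sub>R e)) has_vector_derivative (\<Sum>m. g m (q + t *\<^sub>R e))) (at t)"
proof -
  define S where "S = {t - 1<..<t + 1}"
  \<comment> \<open>The ball of radius \<open>R\<close> contains the whole segment parametrized by
    \<open>S\<close>; the maximum with \<open>1\<close> meets the side condition of the
    majorant.\<close>
  define R where "R = max 1 (norm q + (\<bar>t\<bar> + 1) * norm e)"
  have nR: "norm (q + x *\<^sub>R e) \<le> R" if "x \<in> S" for x
  proof -
    have "norm (q + x *\<^sub>R e) \<le> norm q + \<bar>x\<bar> * norm e" using norm_triangle_ineq[of q "x *\<^sub>R e"] by simp
    also have "\<bar>x\<bar> * norm e \<le> (\<bar>t\<bar> + 1) * norm e" using that by (intro mult_right_mono) (auto simp: S_def)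
    finally show ?thesis by (simp add: R_def)
  qed
  have u: "uniform_limit S (\<lambda>n x. \<Sum>m<n. g m (q + x *\<^sub>R e)) (\<lambda>x. \<Sum>m. g m (q + x *\<^sub>R e)) sequentially"
    using nR by (intro Weierstrass_m_test[where M = "M R"] M) (auto simp: R_def)
  have "\<exists>G. \<forall>x\<in>S. (\<lambda>m. f m (q + x *\<^sub>R e)) sums G x \<and>
     (G has_derivative (\<lambda>h. h *\<^sub>R (\<Sum>m. g m (q + x *\<^sub>R e)))) (at x within S)"
  proof (rule has_derivative_series[where f' = "\<lambda>n x h. h *\<^sub>R g n (q + x *\<^sub>R e)"])
    show "convex S" "t \<in> S" by (simp_all add: S_def)
    show "((\<lambda>x. f n (q + x *\<^sub>R e)) has_derivative (\<lambda>h. h *\<^sub>R g n (q + x *\<^sub>R e))) (at x within S)" for n x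
      using d[of n q x] unfolding has_vector_derivative_def by (rule has_derivative_at_withinI)
    show "(\<lambda>n. f n (q + t *\<^sub>R e)) sums (\<Sum>n. f n (q + t *\<^sub>R e))" by (intro summable_sums s)
    show "\<forall>\<^sub>F n in sequentially. \<forall>x\<in>S. \<forall>h. norm ((\<Sum>i<n. h *\<^sub>R g i (q + x *\<^sub>R e)) - h *\<^sub>R (\<Sum>m. g m (q + x *\<^sub>R e))) \<le> \<epsilon> * norm h"
      if "\<epsilon> > 0" for \<epsilon>
      using uniform_limitD[OF u that]
    proof eventually_elim
      case (elim n)
      show ?case
      proof (intro ballI allI)
        fix x h assume "x \<in> S"
        have "norm ((\<Sum>i<n. h *\<^sub>R g i (q + x *\<^sub>R e)) - h *\<^sub>R (\<Sum>m. g m (q + x *\<^sub>R e)))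
          = \<bar>h\<bar> * norm ((\<Sum>i<n. g i (q + x *\<^sub>R e)) - (\<Sum>m. g m (q + x *\<^sub>R e)))"
          by (metis norm_scaleR scaleR_right.sum scaleR_right_diff_distrib)
        also have "\<dots> \<le> \<bar>h\<bar> * \<epsilon>"
          using elim \<open>x \<in> S\<close> by (intro mult_left_mono) (auto simp: dist_norm less_imp_le)
        finally show "norm ((\<Sum>i<n. h *\<^sub>R g i (q + x *\<^sub>R e)) - h *\<^sub>R (\<Sum>m. g m (q + x *\<^sub>R e))) \<le> \<epsilon> * norm h"
          by (simp add: mult.commute)
      qed
    qed
  qed
  then obtain G where G: "\<And>x. x \<in> S \<Longrightarrow> (\<lambda>m. f m (q + x *\<^sub>R e)) sums G x"
     "\<And>x. x \<in> S \<Longrightarrow> (G has_vector_derivative (\<Sum>m. g m (q + x *\<^sub>R e))) (at x within S)"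
    unfolding has_vector_derivative_def by blast
  have S: "open S" "t \<in> S" by (simp_all add: S_def)
  have "(G has_vector_derivative (\<Sum>m. g m (q + t *\<^sub>R e))) (at t)"
    using G(2)[OF S(2)] unfolding at_within_open[OF S(2) S(1)] .
  then show ?thesis
    by (rule has_vector_derivative_transform_within_open[OF _ S]) (rule sums_unique[OF G(1)])
qed

lemma series_continuous:
  fixes f :: "nat \<Rightarrow> quat \<Rightarrow> quat"
  assumes c: "\<And>m. continuous_on UNIV (f m)"
    and M: "\<And>R. summable (M R)" "\<And>m q R. norm q \<le> R \<Longrightarrow> 1 \<le> R \<Longrightarrow> norm (f m q) \<le> M R m"
  shows "continuous_on UNIV (\<lambda>q. \<Sum>m. f m q)"
proof -
  have "isCont (\<lambda>q. \<Sum>m. f m q) p" for p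
  proof -
    define R where "R = norm p + 1"
    have u: "uniform_limit (ball 0 R) (\<lambda>n q. \<Sum>m<n. f m q) (\<lambda>q. \<Sum>m. f m q) sequentially"
      by (intro Weierstrass_m_test[where M = "M R"] M) (auto simp: R_def)
    have "continuous_on (ball 0 R) (\<lambda>q. \<Sum>m<n. f m q)" for n
      by (intro continuous_on_sum continuous_on_subset[OF c] subset_UNIV)
    then have "continuous_on (ball 0 R) (\<lambda>q. \<Sum>m. f m q)"
      by (intro uniform_limit_theorem[OF _ u] always_eventually allI) simp_all
    then show ?thesis by (simp add: continuous_on_eq_continuous_at R_def)
  qed
  then show ?thesis by (simp add: continuous_on_eq_continuous_at)
qed

context
  fixes a :: "nat \<Rightarrow> quat" assumes a: "entire a"
begin

lemma pow_d_summable: "summable (\<lambda>m. norm e * (real m * norm (a m) * R ^ m))"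
  by (intro summable_mult entire_bound a)

lemma pow_dd_summable: "summable (\<lambda>m. (norm e)\<^sup>2 * ((real m)\<^sup>2 * norm (a m) * R ^ m))"
  by (intro summable_mult entire_bound a)

lemma pow_d_term_le:
  "norm q \<le> R \<Longrightarrow> 1 \<le> R \<Longrightarrow> norm (pow_d e m q * a m) \<le> norm e * (real m * norm (a m) * R ^ m)"
  using mult_right_mono[OF norm_pow_d[of q R e m], of "norm (a m)"] by (simp add: norm_mult mult_ac)

lemma pow_dd_term_le:
  "norm q \<le> R \<Longrightarrow> 1 \<le> R \<Longrightarrow> norm (pow_dd e m q * a m) \<le> (norm e)\<^sup>2 * ((real m)\<^sup>2 * norm (a m) * R ^ m)"
  using mult_right_mono[OF norm_pow_dd[of q R e m], of "norm (a m)"] by (simp add: norm_mult mult_ac)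

lemma pow_d_terms_summable: "summable (\<lambda>m. pow_d e m q * a m)"
  by (rule summable_comparison_test'[OF pow_d_summable[of e "max 1 (norm q)"]])
    (auto intro!: pow_d_term_le)

lemma pow_dd_terms_summable: "summable (\<lambda>m. pow_dd e m q * a m)"
  by (rule summable_comparison_test'[OF pow_dd_summable[of e "max 1 (norm q)"]])
    (auto intro!: pow_dd_term_le)

lemma qseries_line_deriv:
  "((\<lambda>t. qseries a (q + t *\<^sub>R e)) has_vector_derivative (\<Sum>m. pow_d e m (q + t *\<^sub>R e) * a m)) (at t)"
  unfolding qseries_def
  by (rule series_line_deriv[where M = "\<lambda>R m. norm e * (real m * norm (a m) * R ^ m)"])
    (intro has_vector_derivative_mult_left pow_has_deriv pow_d_summable pow_d_term_le entire_summable a; assumption)+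

lemma qseries_line_deriv2:
  "((\<lambda>t. \<Sum>m. pow_d e m (q + t *\<^sub>R e) * a m) has_vector_derivative
     (\<Sum>m. pow_dd e m (q + t *\<^sub>R e) * a m)) (at t)"
  by (rule series_line_deriv[where M = "\<lambda>R m. (norm e)\<^sup>2 * ((real m)\<^sup>2 * norm (a m) * R ^ m)"])
    (intro has_vector_derivative_mult_left pow_d_has_deriv pow_dd_summable pow_dd_term_le pow_d_terms_summable; assumption)+

lemma partial_qseries: "partial e (qseries a) = (\<lambda>q. \<Sum>m. pow_d e m q * a m)"
  using qseries_line_deriv[where t = 0 and e = e]
  by (auto simp: fun_eq_iff partial_def intro!: vector_derivative_at)

lemma partial2_qseries: "partial e (partial e (qseries a)) = (\<lambda>q. \<Sum>m. pow_dd e m q * a m)"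
  using qseries_line_deriv2[where t = 0 and e = e]
  unfolding partial_qseries by (auto simp: fun_eq_iff partial_def intro!: vector_derivative_at)

lemma continuous_pow_d: "continuous_on UNIV (pow_d e m)"
proof (induction m)
  case (Suc m)
  then show ?case
    unfolding pow_d.simps
    by (intro continuous_on_add continuous_on_mult continuous_on_const continuous_on_power continuous_on_id)
qed simp

lemma Ck_1_qseries: "Ck 1 (qseries a)"
proof -
  have "continuous_on UNIV (\<lambda>q. \<Sum>m. pow_d e m q * a m)" for e
    by (rule series_continuous[where M = "\<lambda>R m. norm e * (real m * norm (a m) * R ^ m)"])
      (intro continuous_on_mult continuous_on_const continuous_pow_d pow_d_summable pow_d_term_le; assumption)+
  moreover have "(\<lambda>t. qseries a (q + t *\<^sub>R e)) differentiable at 0" for q e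
    using qseries_line_deriv[of q e 0] by (rule differentiableI_vector)
  ultimately show ?thesis by (simp add: partial_qseries)
qed

text \<open>A direction that commutes with the base point commutes with every point of the line, so
  it can be moved to the far left of each term and out of the series. The coefficients
  \<open>a m\<close> remain on the right and are never moved.\<close>

lemma qseries_line_deriv_commute:
  assumes "e * q = q * e"
  shows "((\<lambda>t. qseries a (q + t *\<^sub>R e)) has_vector_derivative e * qseries (dcoef a) (q + t *\<^sub>R e)) (at t)"
proof -
  let ?p = "q + t *\<^sub>R e"
  have c: "e * ?p = ?p * e" by (simp add: algebra_simps assms)
  have c': "e * ?p ^ m = ?p ^ m * e" for m by (metis c power_commuting_commutes)
  have "(\<Sum>m. pow_d e m ?p * a m) = (\<Sum>m. pow_d e (Suc m) ?p * a (Suc m))"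
    using suminf_split_head[OF pow_d_terms_summable, of e ?p] by (simp del: pow_d.simps(2))
  also have "\<dots> = (\<Sum>m. e * (?p ^ m * dcoef a m))"
  proof (intro suminf_cong)
    fix m
    have "pow_d e (Suc m) ?p * a (Suc m) = of_nat (Suc m) * (?p ^ m * e) * a (Suc m)"
      by (subst pow_d_commute[OF c]) (simp add: mult.assoc)
    also have "\<dots> = real (Suc m) *\<^sub>R (?p ^ m * e) * a (Suc m)"
      by (simp only: scaleR_conv_of_real of_real_of_nat_eq)
    also have "\<dots> = e * (?p ^ m * dcoef a m)"
      by (simp only: c'[symmetric] dcoef_def mult_scaleR_left mult_scaleR_right mult.assoc)
    finally show "pow_d e (Suc m) ?p * a (Suc m) = e * (?p ^ m * dcoef a m)" .
  qed
  also have "\<dots> = e * qseries (dcoef a) ?p"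
    unfolding qseries_def by (intro suminf_mult entire_summable entire_dcoef a)
  finally show ?thesis using qseries_line_deriv[of q e t] by simp
qed

end

section \<open>Power series are slice hyperholomorphic\<close>

text \<open>Each slice is a copy of the complex plane, and the power computed there has real and
  imaginary parts that do not depend on \<open>I\<close>. This is why a power series is a slice
  function.\<close>

lemma slice_pow:
  assumes "I \<in> \<bbbS>"
  shows "(of_real x + I * of_real y) ^ m = of_real (Re (Complex x y ^ m)) + I * of_real (Im (Complex x y ^ m))"
proof (induction m)
  case (Suc m)
  define u v where "u = Re (Complex x y ^ m)" and "v = Im (Complex x y ^ m)"
  have "(of_real x + I * of_real y) ^ Suc m = (x *\<^sub>R 1 + y *\<^sub>R I) * (u *\<^sub>R 1 + v *\<^sub>R I)"
    unfolding power_Suc Suc u_def[symmetric] v_def[symmetric] by (simp add: of_real_def)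
  also have "\<dots> = (x * u) *\<^sub>R 1 + (y * v) *\<^sub>R (I * I) + (x * v + y * u) *\<^sub>R I"
    by (simp add: algebra_simps)
  also have "\<dots> = of_real (x * u - y * v) + I * of_real (x * v + y * u)"
    unfolding imag_unitD(1)[OF assms] by (simp add: of_real_def algebra_simps)
  finally show ?case by (simp add: u_def v_def)
qed simp

lemma slice_function_qseries:
  assumes "entire a"
  shows "slice_function (qseries a)"
proof -
  define \<alpha> where "\<alpha> x y = (\<Sum>m. Re (Complex x y ^ m) *\<^sub>R a m)" for x y
  define \<beta> where "\<beta> x y = (\<Sum>m. Im (Complex x y ^ m) *\<^sub>R a m)" for x y
  have s: "summable (\<lambda>m. norm (a m) * cmod z ^ m)" for z
    using assms by (simp add: entire_def)
  have sa: "summable (\<lambda>m. Re (z ^ m) *\<^sub>R a m)" and sb: "summable (\<lambda>m. Im (z ^ m) *\<^sub>R a m)" for z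
  proof -
    have *: "norm (Re (z ^ m) *\<^sub>R a m) \<le> norm (a m) * cmod z ^ m" for m
      using abs_Re_le_cmod[of "z ^ m"] by (simp add: norm_power mult.commute mult_left_mono)
    have **: "norm (Im (z ^ m) *\<^sub>R a m) \<le> norm (a m) * cmod z ^ m" for m
      using abs_Im_le_cmod[of "z ^ m"] by (simp add: norm_power mult.commute mult_left_mono)
    show "summable (\<lambda>m. Re (z ^ m) *\<^sub>R a m)" "summable (\<lambda>m. Im (z ^ m) *\<^sub>R a m)"
      by (rule summable_comparison_test'[OF s[of z]], rule * **)+
  qed
  \<comment> \<open>Complex conjugation commutes with powers; this is the source of the parity of
    \<alpha> and \<beta> in \<open>y\<close>.\<close>
  have "Complex x (- y) ^ m = cnj (Complex x y ^ m)" for x y m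
    by (simp add: complex_cnj)
  then have cnj: "Re (Complex x (- y) ^ m) = Re (Complex x y ^ m)"
     "Im (Complex x (- y) ^ m) = - Im (Complex x y ^ m)" for x y m
    by (simp_all only: cnj.sel)
  have "\<alpha> x (- y) = \<alpha> x y \<and> \<beta> x (- y) = - \<beta> x y" for x y
    using suminf_minus[OF sb[of "Complex x y"]] by (simp add: \<alpha>_def \<beta>_def cnj)
  moreover have "qseries a (of_real x + I * of_real y) = \<alpha> x y + I * \<beta> x y" if "I \<in> \<bbbS>" for I x y
  proof -
    have "I * \<beta> x y = (\<Sum>m. I * (Im (Complex x y ^ m) *\<^sub>R a m))"
      unfolding \<beta>_def by (rule suminf_mult[OF sb, symmetric])
    then have "\<alpha> x y + I * \<beta> x y = (\<Sum>m. Re (Complex x y ^ m) *\<^sub>R a m + I * (Im (Complex x y ^ m) *\<^sub>R a m))"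
      using suminf_add[OF sa[of "Complex x y"] summable_mult[OF sb[of "Complex x y"], of I]] by (simp add: \<alpha>_def)
    also have "\<dots> = qseries a (of_real x + I * of_real y)"
      unfolding qseries_def slice_pow[OF that] by (simp add: of_real_def distrib_right)
    finally show ?thesis by simp
  qed
  ultimately show ?thesis unfolding slice_function_def by blast
qed

lemma slice_line:
  "of_real t + I * of_real y = I * of_real y + t *\<^sub>R (1 :: quat)"
  "of_real x + I * of_real t = of_real x + t *\<^sub>R (I :: quat)"
  by (simp_all add: of_real_def)

lemma qseries_slice_deriv:
  assumes "entire a"
  shows "((\<lambda>t. qseries a (of_real t + I * of_real y)) has_vector_derivative
           qseries (dcoef a) (of_real x + I * of_real y)) (at x)"
    and "((\<lambda>t. qseries a (of_real x + I * of_real t)) has_vector_derivative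
           I * qseries (dcoef a) (of_real x + I * of_real y)) (at y)"
proof -
  have "1 * (I * of_real y) = (I * of_real y) * 1" "I * of_real x = of_real x * I"
    by (simp_all add: of_real_def)
  note d = qseries_line_deriv_commute[OF assms this(1), of x] qseries_line_deriv_commute[OF assms this(2), of y]
  show "((\<lambda>t. qseries a (of_real t + I * of_real y)) has_vector_derivative
      qseries (dcoef a) (of_real x + I * of_real y)) (at x)"
    using d(1) unfolding slice_line(1) by simp
  show "((\<lambda>t. qseries a (of_real x + I * of_real t)) has_vector_derivative
      I * qseries (dcoef a) (of_real x + I * of_real y)) (at y)"
    using d(2) unfolding slice_line(2) by simp
qed

lemma slice_hyperholomorphic_qseries:
  assumes "entire a"
  shows "slice_hyperholomorphic (qseries a)"
proof -
  have "dbar_slice I (\<lambda>x y. qseries a (of_real x + I * of_real y)) x y = 0" if "I \<in> \<bbbS>" for I x y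
    unfolding dbar_slice_def qseries_slice_deriv[OF assms, THEN vector_derivative_at]
    by (simp add: imag_unitD(1)[OF that] flip: mult.assoc)
  then show ?thesis
    using slice_function_qseries[OF assms] Ck_1_qseries[OF assms] by (simp add: slice_poly_def)
qed

section \<open>Uniqueness of the slice hyperholomorphic components\<close>

text \<open>Adding the equations at \<open>y\<close> and \<open>- y\<close> isolates \<alpha> by
  parity, and cancelling \<open>I\<close> then gives \<beta>. So a single slice determines both
  parts, and with them the function on every slice.\<close>

lemma slice_function_eqI:
  assumes "slice_function f" "slice_function g" "I \<in> \<bbbS>"
    and eq: "\<And>x y. f (of_real x + I * of_real y) = g (of_real x + I * of_real y)"
  shows "f = g"
proof
  fix q
  obtain \<alpha> \<beta> \<alpha>' \<beta>' where
    f: "\<And>x y. \<alpha> x (- y) = \<alpha> x y" "\<And>x y. \<beta> x (- y) = - \<beta> x y"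
       "\<And>I x y. I \<in> \<bbbS> \<Longrightarrow> f (of_real x + I * of_real y) = \<alpha> x y + I * \<beta> x y" and
    g: "\<And>x y. \<alpha>' x (- y) = \<alpha>' x y" "\<And>x y. \<beta>' x (- y) = - \<beta>' x y"
       "\<And>I x y. I \<in> \<bbbS> \<Longrightarrow> g (of_real x + I * of_real y) = \<alpha>' x y + I * \<beta>' x y"
    using assms(1,2) unfolding slice_function_def by metis
  have e1: "\<alpha> x y + I * \<beta> x y = \<alpha>' x y + I * \<beta>' x y" for x y
    using eq[of x y] f(3)[OF assms(3)] g(3)[OF assms(3)] by simp
  have e2: "\<alpha> x y - I * \<beta> x y = \<alpha>' x y - I * \<beta>' x y" for x y
    using e1[of x "- y"] by (simp add: f g)
  have a: "\<alpha> x y = \<alpha>' x y" for x y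
  proof -
    have "2 *\<^sub>R \<alpha> x y = (\<alpha> x y + I * \<beta> x y) + (\<alpha> x y - I * \<beta> x y)" by (simp add: scaleR_2)
    also have "\<dots> = 2 *\<^sub>R \<alpha>' x y" unfolding e1 e2 by (simp add: scaleR_2)
    finally show ?thesis by simp
  qed
  have b: "\<beta> x y = \<beta>' x y" for x y
  proof -
    have "I * \<beta> x y = I * \<beta>' x y" using e1[of x y] a by simp
    moreover have "I \<noteq> 0" using imag_unitD(4)[OF assms(3)] by auto
    ultimately show ?thesis by simp
  qed
  show "f q = g q"
    by (subst (1 2) slice_decomposition) (simp add: f(3) g(3) slice_unit_in_imag_units a b)
qed

text \<open>Varying \<open>x\<close> or \<open>y\<close> moves the point \<open>x - I y\<close> in
  direction \<open>1\<close> or \<open>- I\<close>, and both commute with it.\<close>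

lemma conj_slice_pow_deriv:
  fixes I :: quat
  shows "((\<lambda>t. (of_real t - I * of_real y) ^ k) has_vector_derivative
      of_nat k * (of_real x - I * of_real y) ^ (k - 1)) (at x)"
    and "((\<lambda>t. (of_real x - I * of_real t) ^ k) has_vector_derivative
      - (of_nat k * (of_real x - I * of_real y) ^ (k - 1) * I)) (at y)"
proof -
  have l: "of_real t - I * of_real y = - (I * of_real y) + t *\<^sub>R 1"
     "of_real x - I * of_real t = of_real x + t *\<^sub>R (- I)" for t x y :: real
    by (simp_all add: of_real_def)
  have c: "1 * (- (I * of_real y) + x *\<^sub>R 1) = (- (I * of_real y) + x *\<^sub>R 1) * 1"
     "- I * (of_real x + y *\<^sub>R - I) = (of_real x + y *\<^sub>R - I) * - I"
    by (simp_all add: of_real_def algebra_simps)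
  show "((\<lambda>t. (of_real t - I * of_real y) ^ k) has_vector_derivative
      of_nat k * (of_real x - I * of_real y) ^ (k - 1)) (at x)"
    using pow_has_deriv[of "- (I * of_real y)" 1 k x] unfolding l(1) pow_d_commute[OF c(1)] by simp
  show "((\<lambda>t. (of_real x - I * of_real t) ^ k) has_vector_derivative
      - (of_nat k * (of_real x - I * of_real y) ^ (k - 1) * I)) (at y)"
    using pow_has_deriv[of "of_real x" "- I" k y] unfolding l(2) pow_d_commute[OF c(2)] by simp
qed

text \<open>Applying \<open>\<partial>\<^sub>x + I \<partial>\<^sub>y\<close> to \<open>\<Sum> w\<^sup>k G\<^sub>k\<close>, where \<open>w = x - I y\<close>, lowers the degree in \<open>w\<close>.\<close>

lemma conj_slice_powers_independent:
  fixes G A B :: "nat \<Rightarrow> real \<Rightarrow> real \<Rightarrow> quat"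
  assumes "I \<in> \<bbbS>"
    and "\<And>k x y. k \<le> n \<Longrightarrow> ((\<lambda>t. G k t y) has_vector_derivative A k x y) (at x)"
    and "\<And>k x y. k \<le> n \<Longrightarrow> ((\<lambda>t. G k x t) has_vector_derivative B k x y) (at y)"
    and "\<And>k x y. k \<le> n \<Longrightarrow> A k x y + I * B k x y = 0"
    and "\<And>x y. (\<Sum>k\<le>n. (of_real x - I * of_real y) ^ k * G k x y) = 0"
    and "k \<le> n"
  shows "G k x y = 0"
  using assms(2-)
proof (induction n arbitrary: G A B k x y)
  case (Suc n)
  note II = imag_unitD(1)[OF assms(1)]
  define w where "w x y = of_real x - I * of_real y" for x y :: real
  \<comment> \<open>The operator turns \<open>w ^ k\<close> into \<open>2 * k * w ^ (k - 1)\<close>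
    and annihilates each \<open>G k\<close>; after the index shift these are the coefficients of a
    vanishing combination of degree \<open>n\<close>.\<close>
  define G' where "G' k x y = (2 * real (Suc k)) *\<^sub>R G (Suc k) x y" for k x y
  have z: "G' k x y = 0" if k: "k \<le> n" for k x y
  proof (rule Suc.IH[where A = "\<lambda>k x y. (2 * real (Suc k)) *\<^sub>R A (Suc k) x y"
        and B = "\<lambda>k x y. (2 * real (Suc k)) *\<^sub>R B (Suc k) x y", OF _ _ _ _ k])
    fix j x y assume "j \<le> n"
    show "((\<lambda>t. G' j t y) has_vector_derivative (2 * real (Suc j)) *\<^sub>R A (Suc j) x y) (at x)"
      "((\<lambda>t. G' j x t) has_vector_derivative (2 * real (Suc j)) *\<^sub>R B (Suc j) x y) (at y)"
      unfolding G'_def using Suc.prems(1,2)[of "Suc j"] \<open>j \<le> n\<close>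
      by (auto intro!: bounded_linear.has_vector_derivative[OF bounded_linear_scaleR_right])
    show "(2 * real (Suc j)) *\<^sub>R A (Suc j) x y + I * ((2 * real (Suc j)) *\<^sub>R B (Suc j) x y) = 0"
      using Suc.prems(3)[of "Suc j" x y] \<open>j \<le> n\<close> by (metis Suc_le_mono mult_scaleR_right scaleR_right_distrib scaleR_zero_right)
  next
    fix x y
    have cI: "w x y ^ j * I = I * w x y ^ j" for j
    proof -
      have "I * w x y = w x y * I" by (simp add: w_def of_real_def algebra_simps)
      then show ?thesis by (metis power_commuting_commutes)
    qed
    have 1: "((\<lambda>t. \<Sum>k\<le>Suc n. w t y ^ k * G k t y) has_vector_derivative
       (\<Sum>k\<le>Suc n. w x y ^ k * A k x y + of_nat k * w x y ^ (k - 1) * G k x y)) (at x)"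
      unfolding w_def
      by (intro has_vector_derivative_sum has_vector_derivative_mult conj_slice_pow_deriv Suc.prems(1)) simp
    have 2: "((\<lambda>t. \<Sum>k\<le>Suc n. w x t ^ k * G k x t) has_vector_derivative
       (\<Sum>k\<le>Suc n. w x y ^ k * B k x y + - (of_nat k * w x y ^ (k - 1) * I) * G k x y)) (at y)"
      unfolding w_def
      by (intro has_vector_derivative_sum has_vector_derivative_mult conj_slice_pow_deriv Suc.prems(2)) simp
    have "(\<Sum>k\<le>Suc n. w x y ^ k * A k x y + of_nat k * w x y ^ (k - 1) * G k x y) = 0"
      "(\<Sum>k\<le>Suc n. w x y ^ k * B k x y + - (of_nat k * w x y ^ (k - 1) * I) * G k x y) = 0"
      using 1 2 unfolding Suc.prems(4)[folded w_def]
      by (auto intro: vector_derivative_unique_at[OF _ has_vector_derivative_const])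
    then have "0 = (\<Sum>k\<le>Suc n. w x y ^ k * A k x y + of_nat k * w x y ^ (k - 1) * G k x y)
       + I * (\<Sum>k\<le>Suc n. w x y ^ k * B k x y + - (of_nat k * w x y ^ (k - 1) * I) * G k x y)"
      by simp
    also have "\<dots> = (\<Sum>k\<le>Suc n. (2 * real k) *\<^sub>R (w x y ^ (k - 1) * G k x y))"
      unfolding sum_distrib_left sum.distrib[symmetric]
    proof (intro sum.cong refl)
      fix k assume k: "k \<in> {..Suc n}"
      have "I * (w x y ^ k * B k x y) = w x y ^ k * (I * B k x y)"
        by (metis cI mult.assoc)
      then have 1: "w x y ^ k * A k x y + I * (w x y ^ k * B k x y) = 0"
        using Suc.prems(3)[of k x y] k by (simp flip: distrib_left)
      have "I * (of_nat k * w x y ^ (k - 1) * I * G k x y) = of_nat k * w x y ^ (k - 1) * (I * I) * G k x y"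
        by (metis cI mult.assoc mult_of_nat_commute)
      then have 2: "I * (of_nat k * w x y ^ (k - 1) * I * G k x y) = - (of_nat k * w x y ^ (k - 1) * G k x y)"
        by (simp add: II)
      have 3: "of_nat k * w x y ^ (k - 1) * G k x y = real k *\<^sub>R (w x y ^ (k - 1) * G k x y)"
        by (simp add: scaleR_conv_of_real mult.assoc)
      have "w x y ^ k * A k x y + of_nat k * w x y ^ (k - 1) * G k x y +
         I * (w x y ^ k * B k x y + - (of_nat k * w x y ^ (k - 1) * I) * G k x y) =
         (w x y ^ k * A k x y + I * (w x y ^ k * B k x y)) + (of_nat k * w x y ^ (k - 1) * G k x y
          - I * (of_nat k * w x y ^ (k - 1) * I * G k x y))"
        by (simp only: distrib_left mult_minus_left mult_minus_right) simp
      also have "\<dots> = (2 * real k) *\<^sub>R (w x y ^ (k - 1) * G k x y)"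
        unfolding 1 2 unfolding 3 by (simp add: scaleR_add_left[symmetric])
      finally show "w x y ^ k * A k x y + of_nat k * w x y ^ (k - 1) * G k x y +
         I * (w x y ^ k * B k x y + - (of_nat k * w x y ^ (k - 1) * I) * G k x y) =
         (2 * real k) *\<^sub>R (w x y ^ (k - 1) * G k x y)" .
    qed
    also have "\<dots> = (\<Sum>k\<le>n. w x y ^ k * G' k x y)"
      by (subst sum.atMost_Suc_shift) (simp add: G'_def)
    finally show "(\<Sum>k\<le>n. (of_real x - I * of_real y) ^ k * G' k x y) = 0" by (simp add: w_def)
  qed
  have s: "G (Suc k) x y = 0" if "k \<le> n" for k x y
    using z[OF that, of x y] by (simp add: G'_def)
  show ?case
  proof (cases k)
    case 0
    show ?thesis using Suc.prems(4)[of x y] unfolding sum.atMost_Suc_shift by (simp add: s 0)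
  qed (use s Suc.prems(5) in auto)
qed (simp)

text \<open>This slice is chosen because \<open>1\<close> and \<open>Quat 0 1 0 0\<close> belong to
  \<open>Basis\<close>, the directions in which \<open>Ck\<close> provides differentiability. One
  slice is enough by \<open>slice_function_eqI\<close>.\<close>

lemma slice_hyperholomorphic_derivs:
  assumes "slice_hyperholomorphic F"
  defines "I \<equiv> Quat 0 1 0 0"
  shows "((\<lambda>t. F (of_real t + I * of_real y)) has_vector_derivative
        vector_derivative (\<lambda>t. F (of_real t + I * of_real y)) (at x)) (at x)" (is ?A)
    and "((\<lambda>t. F (of_real x + I * of_real t)) has_vector_derivative
        vector_derivative (\<lambda>t. F (of_real x + I * of_real t)) (at y)) (at y)" (is ?B)
    and "vector_derivative (\<lambda>t. F (of_real t + I * of_real y)) (at x) +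
        I * vector_derivative (\<lambda>t. F (of_real x + I * of_real t)) (at y) = 0" (is ?C)
proof -
  have d: "(\<lambda>t. F (q + t *\<^sub>R e)) differentiable (at 0)" if "e \<in> Basis" for q e
    using assms(1) that by (simp add: slice_poly_def)
  \<comment> \<open>\<open>Ck\<close> speaks about the parameter value \<open>0\<close>; translating
    the base point along \<open>e\<close> reaches every \<open>s\<close>.\<close>
  have d': "(\<lambda>t. F (q + t *\<^sub>R e)) differentiable (at s)" if "e \<in> Basis" for q e s
  proof -
    have "((\<lambda>t. F ((q + s *\<^sub>R e) + t *\<^sub>R e)) \<circ> (\<lambda>t. t - s)) differentiable (at s)"
      by (intro differentiable_chain_at) (auto simp: d[OF that])
    then show ?thesis by (simp add: o_def algebra_simps)
  qed
  have b: "1 \<in> (Basis :: quat set)" "I \<in> Basis" by (auto simp: Basis_quat_def one_quat_def I_def)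
  show ?A unfolding vector_derivative_works[symmetric] slice_line(1) by (rule d'[OF b(1)])
  show ?B unfolding vector_derivative_works[symmetric] slice_line(2) by (rule d'[OF b(2)])
  have "dbar_slice I (\<lambda>x y. F (of_real x + I * of_real y)) x y = 0"
    using assms(1) qi_unit by (simp add: slice_poly_def I_def)
  then show ?C by (simp add: dbar_slice_def)
qed

lemma qcnj_slice: "I \<in> \<bbbS> \<Longrightarrow> qcnj (of_real x + I * of_real y) = of_real x - I * of_real y"
  by (simp add: of_real_def imag_unitD(2))

lemma poly_components_eqI:
  assumes F: "\<And>k. k \<le> n \<Longrightarrow> slice_hyperholomorphic (F k)" "\<And>k. k > n \<Longrightarrow> F k = (\<lambda>_. 0)"
    and f: "\<And>q. f q = (\<Sum>k\<le>n. qcnj q ^ k * F k q)"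
  shows "poly_components n f = F"
  unfolding poly_components_def
proof (rule the_equality)
  fix H assume H: "(\<forall>k\<le>n. slice_hyperholomorphic (H k)) \<and> (\<forall>k>n. H k = (\<lambda>_. 0)) \<and>
     (\<forall>q. f q = (\<Sum>k\<le>n. qcnj q ^ k * H k q))"
  define I where "I = Quat 0 1 0 0"
  have I: "I \<in> \<bbbS>" using qi_unit by (simp add: I_def)
  have "H k = F k" for k
  proof (cases "k \<le> n")
    case True
    have HH: "slice_hyperholomorphic (H k)" if "k \<le> n" for k using H that by blast
    define dx where "dx F x y = vector_derivative (\<lambda>t. F (of_real t + I * of_real y)) (at x)"
      for F :: "quat \<Rightarrow> quat" and x y
    define dy where "dy F x y = vector_derivative (\<lambda>t. F (of_real x + I * of_real t)) (at y)"
      for F :: "quat \<Rightarrow> quat" and x y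
    note AB = slice_hyperholomorphic_derivs[OF F(1), folded I_def, folded dx_def dy_def]
    note AB' = slice_hyperholomorphic_derivs[OF HH, folded I_def, folded dx_def dy_def]
    have "H k (of_real x + I * of_real y) - F k (of_real x + I * of_real y) = 0" for x y
    proof (rule conj_slice_powers_independent[OF I _ _ _ _ True,
          where G = "\<lambda>k x y. H k (of_real x + I * of_real y) - F k (of_real x + I * of_real y)"
          and A = "\<lambda>k x y. dx (H k) x y - dx (F k) x y" and B = "\<lambda>k x y. dy (H k) x y - dy (F k) x y"])
      fix x y
      have "f (of_real x + I * of_real y) =
          (\<Sum>k\<le>n. qcnj (of_real x + I * of_real y) ^ k * H k (of_real x + I * of_real y))"
        using H by blast
      then show "(\<Sum>k\<le>n. (of_real x - I * of_real y) ^ k *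
         (H k (of_real x + I * of_real y) - F k (of_real x + I * of_real y))) = 0"
        using f[of "of_real x + I * of_real y"] unfolding qcnj_slice[OF I]
        by (simp add: right_diff_distrib sum_subtractf)
    next
      fix k x y assume k: "k \<le> n"
      have "dx (H k) x y - dx (F k) x y + I * (dy (H k) x y - dy (F k) x y)
          = (dx (H k) x y + I * dy (H k) x y) - (dx (F k) x y + I * dy (F k) x y)"
        by (simp add: algebra_simps)
      then show "dx (H k) x y - dx (F k) x y + I * (dy (H k) x y - dy (F k) x y) = 0"
        by (simp add: AB(3) AB'(3) k)
    qed (intro has_vector_derivative_diff AB AB'; assumption)+
    then show ?thesis
      using H F(1)[OF True] True by (intro slice_function_eqI[OF _ _ I]) (auto simp: slice_poly_def)
  qed (use H F(2) in auto)
  then show "H = F" by blast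
qed (use F f in auto)

section \<open>Slice derivative and Laplacian of power series\<close>

text \<open>On a slice, \<open>\<partial>\<^sub>s\<close> annihilates the powers of
  \<open>qcnj q\<close>, acts on a power series through \<open>dcoef\<close>, and multiplies the
  Gaussian by \<open>- (2 * pi) * qcnj q\<close>, because \<open>- 4 * pi * (x - I * y) / 2\<close>
  is what remains of its two partial derivatives.\<close>

lemma slice_deriv_gauss:
  fixes b :: "nat \<Rightarrow> nat \<Rightarrow> quat" and c :: "nat \<Rightarrow> real"
  assumes b: "\<And>j. j \<le> n \<Longrightarrow> entire (b j)"
  shows "\<partial>\<^sub>s (\<lambda>q. exp (- 2 * pi * (norm q)\<^sup>2) *\<^sub>R (\<Sum>j\<le>n. c j *\<^sub>R (qcnj q ^ j * qseries (b j) q))) q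
    = exp (- 2 * pi * (norm q)\<^sup>2) *\<^sub>R
        (\<Sum>j\<le>n. c j *\<^sub>R (qcnj q ^ j * qseries (dcoef (b j)) q - (2 * pi) *\<^sub>R (qcnj q ^ Suc j * qseries (b j) q)))"
proof -
  define I where "I = slice_unit q"
  define x y where "x = qre q" and "y = norm (q - of_real (qre q))"
  have I: "I \<in> \<bbbS>" by (simp add: I_def slice_unit_in_imag_units)
  have q: "q = of_real x + I * of_real y" using slice_decomposition[of q] by (simp add: I_def x_def y_def)
  have nrm: "(norm (of_real x + I * of_real y))\<^sup>2 = x\<^sup>2 + y\<^sup>2" for x y
  proof -
    have "of_real ((norm (of_real x + I * of_real y))\<^sup>2)
        = (of_real x - I * of_real y) * (of_real x + I * of_real y)"
      unfolding qcnj_slice[OF I, symmetric] by (rule qcnj_mult_self(1)[symmetric])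
    also have "\<dots> = (x *\<^sub>R 1 - y *\<^sub>R I) * (x *\<^sub>R 1 + y *\<^sub>R I)" by (simp add: of_real_def)
    also have "\<dots> = (x * x) *\<^sub>R 1 - (y * y) *\<^sub>R (I * I)" by (simp add: algebra_simps)
    also have "\<dots> = of_real (x\<^sup>2 + y\<^sup>2)"
      by (simp add: imag_unitD(1)[OF I] of_real_def power2_eq_square scaleR_add_left)
    finally show ?thesis using of_real_eq_iff by blast
  qed
  define E where "E x y = exp (- 2 * pi * (x\<^sup>2 + y\<^sup>2))" for x y :: real
  define w where "w x y = of_real x - I * of_real y" for x y
  define G where "G j x y = qseries (b j) (of_real x + I * of_real y)" for j x y
  define G' where "G' j x y = qseries (dcoef (b j)) (of_real x + I * of_real y)" for j x y
  have cI: "w x y ^ j * I = I * w x y ^ j" for j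
  proof -
    have "I * w x y = w x y * I" by (simp add: w_def of_real_def algebra_simps)
    then show ?thesis by (metis power_commuting_commutes)
  qed
  define A where "A = (\<Sum>j\<le>n. c j *\<^sub>R (w x y ^ j * G' j x y + of_nat j * w x y ^ (j - 1) * G j x y))"
  define B where "B = (\<Sum>j\<le>n. c j *\<^sub>R (w x y ^ j * (I * G' j x y) + - (of_nat j * w x y ^ (j - 1) * I) * G j x y))"
  define S where "S = (\<Sum>j\<le>n. c j *\<^sub>R (w x y ^ j * G j x y))"
  have E1: "((\<lambda>t. E t y) has_real_derivative E x y * (- 4 * pi * x)) (at x)"
   and E2: "((\<lambda>t. E x t) has_real_derivative E x y * (- 4 * pi * y)) (at y)"
    unfolding E_def by (auto intro!: derivative_eq_intros)
  have d1: "((\<lambda>t. E t y *\<^sub>R (\<Sum>j\<le>n. c j *\<^sub>R (w t y ^ j * G j t y))) has_vector_derivative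
     E x y *\<^sub>R A + (E x y * (- 4 * pi * x)) *\<^sub>R S) (at x)"
    unfolding A_def S_def w_def G_def G'_def
    by (intro has_vector_derivative_scaleR has_vector_derivative_sum has_vector_derivative_mult
        bounded_linear.has_vector_derivative[OF bounded_linear_scaleR_right]
        conj_slice_pow_deriv qseries_slice_deriv b E1) simp
  have d2: "((\<lambda>t. E x t *\<^sub>R (\<Sum>j\<le>n. c j *\<^sub>R (w x t ^ j * G j x t))) has_vector_derivative
     E x y *\<^sub>R B + (E x y * (- 4 * pi * y)) *\<^sub>R S) (at y)"
    unfolding B_def S_def w_def G_def G'_def
    by (intro has_vector_derivative_scaleR has_vector_derivative_sum has_vector_derivative_mult
        bounded_linear.has_vector_derivative[OF bounded_linear_scaleR_right]
        conj_slice_pow_deriv qseries_slice_deriv b E2) simp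
  \<comment> \<open>Since \<open>I\<close> passes the powers of \<open>w\<close> and squares to
    \<open>- 1\<close>, in \<open>A - I * B\<close> the terms with a derivative of the series double
    and those with a derivative of \<open>w ^ j\<close> cancel.\<close>
  have K: "I * (w x y ^ k * (I * p)) = - (w x y ^ k * p)" for k p
  proof -
    have "I * (w x y ^ k * (I * p)) = w x y ^ k * ((I * I) * p)"
      using arg_cong[OF cI[of k], of "\<lambda>z. z * (I * p)"] by (simp only: mult.assoc)
    then show ?thesis by (simp add: imag_unitD(1)[OF I])
  qed
  have of_nat: "of_nat k * p = real k *\<^sub>R p" for k and p :: quat
    by (simp add: scaleR_conv_of_real)
  have AB: "A - I * B = 2 *\<^sub>R (\<Sum>j\<le>n. c j *\<^sub>R (w x y ^ j * G' j x y))"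
    unfolding A_def B_def sum_distrib_left sum_subtractf[symmetric] scaleR_right.sum
  proof (intro sum.cong refl)
    fix j
    have "c j *\<^sub>R (w x y ^ j * G' j x y + of_nat j * w x y ^ (j - 1) * G j x y)
      - I * c j *\<^sub>R (w x y ^ j * (I * G' j x y) + - (of_nat j * w x y ^ (j - 1) * I) * G j x y)
     = c j *\<^sub>R ((w x y ^ j * G' j x y - I * (w x y ^ j * (I * G' j x y))) +
        real j *\<^sub>R (w x y ^ (j - 1) * G j x y + I * (w x y ^ (j - 1) * (I * G j x y))))"
      unfolding of_nat by (simp add: algebra_simps)
    also have "\<dots> = 2 *\<^sub>R c j *\<^sub>R (w x y ^ j * G' j x y)"
      unfolding K by (simp flip: scaleR_2 add: mult.commute)
    finally show "c j *\<^sub>R (w x y ^ j * G' j x y + of_nat j * w x y ^ (j - 1) * G j x y)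
      - I * c j *\<^sub>R (w x y ^ j * (I * G' j x y) + - (of_nat j * w x y ^ (j - 1) * I) * G j x y)
      = 2 *\<^sub>R c j *\<^sub>R (w x y ^ j * G' j x y)" .
  qed
  define f where "f q = exp (- 2 * pi * (norm q)\<^sup>2) *\<^sub>R (\<Sum>j\<le>n. c j *\<^sub>R (qcnj q ^ j * qseries (b j) q))" for q
  have f: "f (of_real u + I * of_real v) = E u v *\<^sub>R (\<Sum>j\<le>n. c j *\<^sub>R (w u v ^ j * G j u v))" for u v
    unfolding f_def E_def w_def G_def nrm qcnj_slice[OF I] by (rule refl)
  have "\<partial>\<^sub>s f q = d_slice I (\<lambda>u v. f (of_real u + I * of_real v)) x y"
    unfolding slice_deriv_def Let_def I_def x_def y_def by (rule refl)
  also have "\<dots> = d_slice I (\<lambda>u v. E u v *\<^sub>R (\<Sum>j\<le>n. c j *\<^sub>R (w u v ^ j * G j u v))) x y"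
    unfolding f by (rule refl)
  also have "\<dots> = (1/2) *\<^sub>R ((E x y *\<^sub>R A + (E x y * (- 4 * pi * x)) *\<^sub>R S)
      - I * (E x y *\<^sub>R B + (E x y * (- 4 * pi * y)) *\<^sub>R S))"
    unfolding d_slice_def d1[THEN vector_derivative_at] d2[THEN vector_derivative_at] ..
  also have "\<dots> = (E x y / 2) *\<^sub>R (A - I * B) - (E x y * 2 * pi) *\<^sub>R (w x y * S)"
  proof -
    have "(E x y * 2 * pi) *\<^sub>R (w x y * S) = (E x y * 2 * pi * x) *\<^sub>R S - (E x y * 2 * pi * y) *\<^sub>R (I * S)"
      by (simp add: w_def of_real_def left_diff_distrib scaleR_right_diff_distrib mult_ac)
    moreover have "(E x y / 2) *\<^sub>R (A - I * B) = (E x y / 2) *\<^sub>R A - (E x y / 2) *\<^sub>R (I * B)"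
      by (rule scaleR_right_diff_distrib)
    ultimately show ?thesis
      by (simp add: distrib_left right_diff_distrib scaleR_right_diff_distrib scaleR_right_distrib mult_ac)
  qed
  also have "\<dots> = E x y *\<^sub>R (\<Sum>j\<le>n. c j *\<^sub>R (w x y ^ j * G' j x y - (2 * pi) *\<^sub>R (w x y ^ Suc j * G j x y)))"
  proof -
    have "(E x y / 2) *\<^sub>R (A - I * B) = E x y *\<^sub>R (\<Sum>j\<le>n. c j *\<^sub>R (w x y ^ j * G' j x y))"
      unfolding AB by simp
    moreover have "(E x y * 2 * pi) *\<^sub>R (w x y * S)
        = E x y *\<^sub>R (\<Sum>j\<le>n. c j *\<^sub>R (2 * pi) *\<^sub>R (w x y ^ Suc j * G j x y))"
      unfolding S_def sum_distrib_left scaleR_right.sum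
      by (intro sum.cong refl) (simp add: mult.assoc)
    ultimately show ?thesis
      by (simp only: scaleR_right_diff_distrib sum_subtractf)
  qed
  also have "\<dots> = exp (- 2 * pi * (norm q)\<^sup>2) *\<^sub>R
        (\<Sum>j\<le>n. c j *\<^sub>R (qcnj q ^ j * qseries (dcoef (b j)) q - (2 * pi) *\<^sub>R (qcnj q ^ Suc j * qseries (b j) q)))"
    unfolding w_def G_def G'_def E_def qcnj_slice[OF I, symmetric] nrm[symmetric] q[symmetric] by (rule refl)
  finally show ?thesis unfolding f_def .
qed

text \<open>Differentiating the series and multiplying by \<open>qcnj q\<close> do not interact, so
  iterating their combination gives a binomial expansion; the induction step is Pascal's
  rule.\<close>

lemma slice_deriv_gauss_pow:
  assumes g: "entire g"
  shows "(\<partial>\<^sub>s ^^ n) (\<lambda>q. exp (- 2 * pi * (norm q)\<^sup>2) *\<^sub>R qseries g q) =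
    (\<lambda>q. exp (- 2 * pi * (norm q)\<^sup>2) *\<^sub>R (\<Sum>j\<le>n. (real (n choose j) * (- 2 * pi) ^ j) *\<^sub>R
       (qcnj q ^ j * qseries ((dcoef ^^ (n - j)) g) q)))"
proof (induction n)
  case (Suc n)
  show ?case
  proof
    fix q
    define X where "X j = (- 2 * pi) ^ j *\<^sub>R (qcnj q ^ j * qseries ((dcoef ^^ (Suc n - j)) g) q)" for j
    have "(\<Sum>j\<le>n. (real (n choose j) * (- 2 * pi) ^ j) *\<^sub>R
        (qcnj q ^ j * qseries (dcoef ((dcoef ^^ (n - j)) g)) q
          - (2 * pi) *\<^sub>R (qcnj q ^ Suc j * qseries ((dcoef ^^ (n - j)) g) q)))
       = (\<Sum>j\<le>n. real (n choose j) *\<^sub>R X j + real (n choose j) *\<^sub>R X (Suc j))"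
    proof (intro sum.cong refl)
      fix j assume "j \<in> {..n}"
      then have "dcoef ((dcoef ^^ (n - j)) g) = (dcoef ^^ (Suc n - j)) g"
        by (simp add: Suc_diff_le)
      then show "(real (n choose j) * (- 2 * pi) ^ j) *\<^sub>R
        (qcnj q ^ j * qseries (dcoef ((dcoef ^^ (n - j)) g)) q
          - (2 * pi) *\<^sub>R (qcnj q ^ Suc j * qseries ((dcoef ^^ (n - j)) g) q))
       = real (n choose j) *\<^sub>R X j + real (n choose j) *\<^sub>R X (Suc j)"
        by (simp add: X_def scaleR_right_diff_distrib mult_ac)
    qed
    also have "\<dots> = (\<Sum>j\<le>Suc n. real (Suc n choose j) *\<^sub>R X j)"
    proof -
      have 1: "(\<Sum>j\<le>Suc n. real (Suc n choose j) *\<^sub>R X j)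
         = X 0 + (\<Sum>j\<le>n. real (n choose j) *\<^sub>R X (Suc j)) + (\<Sum>j\<le>n. real (n choose Suc j) *\<^sub>R X (Suc j))"
        by (subst sum.atMost_Suc_shift) (simp add: scaleR_add_left sum.distrib add_ac)
      have 2: "X 0 + (\<Sum>j\<le>n. real (n choose Suc j) *\<^sub>R X (Suc j)) = (\<Sum>j\<le>Suc n. real (n choose j) *\<^sub>R X j)"
        using sum.atMost_Suc_shift[of "\<lambda>j. real (n choose j) *\<^sub>R X j" n] by simp
      have 3: "(\<Sum>j\<le>Suc n. real (n choose j) *\<^sub>R X j) = (\<Sum>j\<le>n. real (n choose j) *\<^sub>R X j)"
        by simp
      show ?thesis using 1 2 3 by (simp add: sum.distrib algebra_simps)
    qed
    finally show "(\<partial>\<^sub>s ^^ Suc n) (\<lambda>q. exp (- 2 * pi * (norm q)\<^sup>2) *\<^sub>R qseries g q) q =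
        exp (- 2 * pi * (norm q)\<^sup>2) *\<^sub>R (\<Sum>j\<le>Suc n. (real (Suc n choose j) * (- 2 * pi) ^ j) *\<^sub>R
       (qcnj q ^ j * qseries ((dcoef ^^ (Suc n - j)) g) q))"
      unfolding funpow.simps o_apply Suc
      by (subst slice_deriv_gauss) (auto simp: X_def g simp del: sum.atMost_Suc)
  qed
qed simp

section \<open>The Laplacian of a power of q\<close>

lemma sum_Basis_quat: "(\<Sum>e\<in>Basis. f e) = f 1 + f (Quat 0 1 0 0) + f (Quat 0 0 1 0) + f (Quat 0 0 0 1)"
  by (simp add: Basis_quat_def one_quat_def add_ac)

text \<open>The identity p + ipi + jpj + kpk = -2 times the conjugate of p, checked in coordinates,
  is the source of all conjugates in the Laplacian.\<close>

lemma sum_Basis_conj: "(\<Sum>e\<in>Basis. e * p * e) = - (2 *\<^sub>R qcnj p)" for p :: quat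
  by (simp add: sum_Basis_quat quat_eq_iff times_quat_def)

text \<open>The noncommutative Leibniz rule: the factor at position \<open>j\<close> is replaced by
  \<open>e\<close>. In this form a further \<open>e\<close> on the left encloses
  \<open>q ^ j\<close>, so that \<open>sum_Basis_conj\<close> applies.\<close>

lemma pow_d_explicit: "pow_d e m q = (\<Sum>j<m. q ^ j * e * q ^ (m - 1 - j))"
proof (induction m)
  case (Suc m)
  have "(\<Sum>j<Suc m. q ^ j * e * q ^ (Suc m - 1 - j)) = e * q ^ m + q * (\<Sum>j<m. q ^ j * e * q ^ (m - 1 - j))"
    unfolding sum.lessThan_Suc_shift sum_distrib_left by (auto intro!: sum.cong simp: mult.assoc)
  then show ?case by (simp add: Suc)
qed simp

lemma sum_Basis_pow_d: "(\<Sum>e\<in>Basis. e * pow_d e m q) = - (2 *\<^sub>R (\<Sum>j<m. qcnj q ^ j * q ^ (m - 1 - j)))"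
proof -
  have cp: "qcnj (q ^ j) = qcnj q ^ j" for j
    by (induction j) (simp_all add: qcnj_mult power_commutes)
  have "(\<Sum>e\<in>Basis. e * pow_d e m q) = (\<Sum>e\<in>Basis. \<Sum>j<m. (e * q ^ j * e) * q ^ (m - 1 - j))"
    by (simp add: pow_d_explicit sum_distrib_left mult.assoc)
  also have "\<dots> = (\<Sum>j<m. (\<Sum>e\<in>Basis. e * q ^ j * e) * q ^ (m - 1 - j))"
    by (subst sum.swap) (simp add: sum_distrib_right)
  finally show ?thesis by (simp add: sum_Basis_conj cp scaleR_right.sum sum_negf)
qed

lemma conj_pow_commute: "qcnj q ^ j * q ^ k = q ^ k * qcnj q ^ j"
proof -
  have "qcnj q * q = q * qcnj q" by (simp add: qcnj_mult_self)
  then have "qcnj q ^ j * q = q * qcnj q ^ j" by (rule power_commuting_commutes)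
  then show ?thesis by (metis power_commuting_commutes)
qed

text \<open>In the recursion, left multiplication by \<open>q\<close> preserves the weights, and
  \<open>sum_Basis_pow_d\<close> adds one copy of every monomial of the new degree. Hence a monomial
  carries its exponent of \<open>q\<close> plus one as weight.\<close>

lemma sum_Basis_pow_dd:
  "(\<Sum>e\<in>Basis. pow_dd e (Suc (Suc m)) q) = - (4 *\<^sub>R (\<Sum>j\<le>m. real (Suc m - j) *\<^sub>R (q ^ (m - j) * qcnj q ^ j)))"
proof (induction m)
  case 0
  show ?case by (simp add: sum_Basis_quat quat_eq_iff times_quat_def)
next
  case (Suc m)
  have "(\<Sum>e\<in>Basis. pow_dd e (Suc (Suc (Suc m))) q)
     = 2 *\<^sub>R (\<Sum>e\<in>Basis. e * pow_d e (Suc (Suc m)) q) + q * (\<Sum>e\<in>Basis. pow_dd e (Suc (Suc m)) q)"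
    unfolding pow_dd.simps(2)[of _ "Suc (Suc m)"] scaleR_right.sum sum_distrib_left sum.distrib[symmetric]
    by (intro sum.cong refl) (simp only: mult_2 scaleR_2)
  also have "\<dots> = - (4 *\<^sub>R ((\<Sum>j\<le>Suc m. q ^ (Suc m - j) * qcnj q ^ j)
      + q * (\<Sum>j\<le>m. real (Suc m - j) *\<^sub>R (q ^ (m - j) * qcnj q ^ j))))"
    unfolding Suc sum_Basis_pow_d lessThan_Suc_atMost conj_pow_commute
    by (simp add: scaleR_right_distrib algebra_simps)
  also have "q * (\<Sum>j\<le>m. real (Suc m - j) *\<^sub>R (q ^ (m - j) * qcnj q ^ j))
     = (\<Sum>j\<le>Suc m. real (Suc m - j) *\<^sub>R (q ^ (Suc m - j) * qcnj q ^ j))"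
    unfolding sum.atMost_Suc sum_distrib_left
    by (auto intro!: sum.cong simp: Suc_diff_le mult.assoc)
  also have "(\<Sum>j\<le>Suc m. q ^ (Suc m - j) * qcnj q ^ j) + \<dots>
     = (\<Sum>j\<le>Suc m. real (Suc (Suc m) - j) *\<^sub>R (q ^ (Suc m - j) * qcnj q ^ j))"
    unfolding sum.distrib[symmetric]
  proof (intro sum.cong refl)
    fix j assume "j \<in> {..Suc m}"
    then have "real (Suc (Suc m) - j) = 1 + real (Suc m - j)" by simp
    then show "q ^ (Suc m - j) * qcnj q ^ j + real (Suc m - j) *\<^sub>R (q ^ (Suc m - j) * qcnj q ^ j)
       = real (Suc (Suc m) - j) *\<^sub>R (q ^ (Suc m - j) * qcnj q ^ j)"
      by (simp only: scaleR_add_left scaleR_one)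
  qed
  finally show ?case .
qed

lemma Q_poly_alt:
  "Q_poly m q = (2 / (real (Suc m) * real (Suc (Suc m)))) *\<^sub>R
     (\<Sum>j\<le>m. real (Suc m - j) *\<^sub>R (q ^ (m - j) * qcnj q ^ j))"
  unfolding Q_poly_def scaleR_right.sum
proof (intro sum.cong refl)
  fix j assume "j \<in> {..m}"
  then have "2 * real (m - j + 1) / (real (m + 1) * real (m + 2))
      = 2 / (real (Suc m) * real (Suc (Suc m))) * real (Suc m - j)"
    by (simp add: Suc_diff_le)
  then show "of_real (2 * real (m - j + 1) / (real (m + 1) * real (m + 2))) * q ^ (m - j) * qcnj q ^ j
    = (2 / (real (Suc m) * real (Suc (Suc m)))) *\<^sub>R real (Suc m - j) *\<^sub>R (q ^ (m - j) * qcnj q ^ j)"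
    by (simp only: scaleR_scaleR) (simp only: scaleR_conv_of_real mult.assoc)
qed

lemma sum_Basis_pow_dd_Q_poly:
  "(\<Sum>e\<in>Basis. pow_dd e (Suc (Suc m)) q) = - (2 * real (Suc m) * real (Suc (Suc m))) *\<^sub>R Q_poly m q"
  unfolding sum_Basis_pow_dd Q_poly_alt by (simp del: of_nat_Suc)

lemma laplacian_qseries:
  assumes "entire a"
  shows "(\<lambda>m. - (2 * real (Suc m) * real (Suc (Suc m))) *\<^sub>R (Q_poly m q * a (Suc (Suc m)))) sums
    laplacian (qseries a) q"
proof -
  have "(\<lambda>m. \<Sum>e\<in>Basis. pow_dd e m q * a m) sums (\<Sum>e\<in>Basis. \<Sum>m. pow_dd e m q * a m)"
    by (intro sums_sum summable_sums pow_dd_terms_summable assms)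
  then have "(\<lambda>m. \<Sum>e\<in>Basis. pow_dd e m q * a m) sums laplacian (qseries a) q"
    by (simp add: laplacian_def partial2_qseries[OF assms])
  \<comment> \<open>The powers of degree \<open>0\<close> and \<open>1\<close> have vanishing second
    derivatives; dropping them shifts the index by two.\<close>
  from sums_split_initial_segment[OF this, of 2]
  have "(\<lambda>m. \<Sum>e\<in>Basis. pow_dd e (Suc (Suc m)) q * a (Suc (Suc m))) sums laplacian (qseries a) q"
    by (simp add: numeral_2_eq_2 del: pow_dd.simps(2)) (simp add: pow_dd.simps(2)[of _ 0])
  then show ?thesis
    unfolding sum_distrib_right[symmetric] sum_Basis_pow_dd_Q_poly by simp
qed

section \<open>Uniqueness of the expansion in the polynomials \<open>M\<close>\<close>

text \<open>The combination \<open>S h (2 r) - 4 ^ n S h r\<close> eliminates the top coefficient \<open>p h n\<close>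
  from \<open>S h r = (\<Sum>k\<le>n. r ^ (2 k) p h k)\<close>.\<close>

lemma homogeneous_decay:
  fixes p :: "nat \<Rightarrow> nat \<Rightarrow> 'a::real_normed_vector"
  assumes "\<And>r. r > 0 \<Longrightarrow> (\<lambda>h. r ^ h *\<^sub>R (\<Sum>k\<le>n. (r\<^sup>2) ^ k *\<^sub>R p h k)) \<longlonglongrightarrow> 0"
    and "k \<le> n" "r > 0"
  shows "(\<lambda>h. r ^ h *\<^sub>R p h k) \<longlonglongrightarrow> 0"
  using assms
proof (induction n arbitrary: p k r)
  case 0
  then show ?case using "0.prems"(1)[of r] by simp
next
  case (Suc n)
  define S where "S h r = (\<Sum>k\<le>Suc n. (r\<^sup>2) ^ k *\<^sub>R p h k)" for h r
  have S: "(\<lambda>h. r ^ h *\<^sub>R S h r) \<longlonglongrightarrow> 0" if "r > 0" for r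
    using Suc.prems(1)[OF that] by (simp add: S_def)
  have le: "(\<lambda>h. r ^ h *\<^sub>R p h k) \<longlonglongrightarrow> 0" if k: "k \<le> n" and r: "r > 0" for k r
  proof -
    define p' where "p' h k = (4 ^ k - 4 ^ Suc n :: real) *\<^sub>R p h k" for h k
    have "(\<lambda>h. r ^ h *\<^sub>R p' h k) \<longlonglongrightarrow> 0"
    proof (rule Suc.IH[OF _ k r])
      fix r :: real assume r: "r > 0"
      \<comment> \<open>The hypothesis controls \<open>S h (2 * r)\<close> with the weight
        \<open>(2 * r) ^ h\<close>; the null sequence \<open>(1/2) ^ h\<close> converts this to the
        weight \<open>r ^ h\<close>.\<close>
      have "(\<lambda>h. (1/2) ^ h *\<^sub>R ((2 * r) ^ h *\<^sub>R S h (2 * r)) - 4 ^ Suc n *\<^sub>R (r ^ h *\<^sub>R S h r))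
          \<longlonglongrightarrow> 0 *\<^sub>R 0 - 4 ^ Suc n *\<^sub>R 0"
        using r by (intro tendsto_intros S LIMSEQ_realpow_zero) auto
      moreover have "(1/2) ^ h *\<^sub>R ((2 * r) ^ h *\<^sub>R S h (2 * r)) - 4 ^ Suc n *\<^sub>R (r ^ h *\<^sub>R S h r)
          = r ^ h *\<^sub>R (\<Sum>k\<le>n. (r\<^sup>2) ^ k *\<^sub>R p' h k)" for h
      proof -
        have "(1/2) ^ h * (2 * r) ^ h = r ^ h" by (simp add: power_mult_distrib power_one_over)
        then have "(1/2) ^ h *\<^sub>R ((2 * r) ^ h *\<^sub>R S h (2 * r)) - 4 ^ Suc n *\<^sub>R (r ^ h *\<^sub>R S h r)
          = r ^ h *\<^sub>R (S h (2 * r) - 4 ^ Suc n *\<^sub>R S h r)"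
          by (simp add: scaleR_right_diff_distrib mult_ac)
        also have "S h (2 * r) - 4 ^ Suc n *\<^sub>R S h r
            = (\<Sum>k\<le>Suc n. (r\<^sup>2) ^ k *\<^sub>R ((4 ^ k - 4 ^ Suc n) *\<^sub>R p h k))"
          unfolding S_def scaleR_right.sum sum_subtractf[symmetric]
        proof (intro sum.cong refl)
          fix k
          have "((2 * r)\<^sup>2) ^ k = 4 ^ k * (r\<^sup>2) ^ k" by (simp add: power_mult_distrib)
          then show "((2 * r)\<^sup>2) ^ k *\<^sub>R p h k - 4 ^ Suc n *\<^sub>R (r\<^sup>2) ^ k *\<^sub>R p h k =
              (r\<^sup>2) ^ k *\<^sub>R (4 ^ k - 4 ^ Suc n) *\<^sub>R p h k"
            by (simp only: scaleR_scaleR scaleR_left_diff_distrib[symmetric]) (simp only: algebra_simps)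
        qed
        also have "\<dots> = (\<Sum>k\<le>n. (r\<^sup>2) ^ k *\<^sub>R p' h k)" by (simp add: p'_def)
        finally show ?thesis .
      qed
      ultimately show "(\<lambda>h. r ^ h *\<^sub>R (\<Sum>k\<le>n. (r\<^sup>2) ^ k *\<^sub>R p' h k)) \<longlonglongrightarrow> 0" by simp
    qed
    then have "(\<lambda>h. inverse (4 ^ k - 4 ^ Suc n) *\<^sub>R (r ^ h *\<^sub>R p' h k)) \<longlonglongrightarrow> inverse (4 ^ k - 4 ^ Suc n) *\<^sub>R 0"
      by (intro tendsto_intros)
    moreover have "(4 :: real) ^ k \<noteq> 4 ^ Suc n" using k by (subst power_inject_exp) auto
    ultimately show ?thesis by (simp add: p'_def mult_ac del: power_Suc)
  qed
  show ?case
  proof (cases "k \<le> n")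
    case False
    then have k: "k = Suc n" using Suc.prems(2) by simp
    \<comment> \<open>The top coefficient is what is left of \<open>S h r\<close> after subtracting
      the lower terms, whose decay is already known.\<close>
    have "(\<lambda>h. inverse ((r\<^sup>2) ^ Suc n) *\<^sub>R (r ^ h *\<^sub>R S h r - (\<Sum>k\<le>n. (r\<^sup>2) ^ k *\<^sub>R (r ^ h *\<^sub>R p h k))))
        \<longlonglongrightarrow> inverse ((r\<^sup>2) ^ Suc n) *\<^sub>R (0 - (\<Sum>k\<le>n. (r\<^sup>2) ^ k *\<^sub>R 0))"
      using Suc.prems(3) by (intro tendsto_intros S le) auto
    moreover have "inverse ((r\<^sup>2) ^ Suc n) *\<^sub>R (r ^ h *\<^sub>R S h r - (\<Sum>k\<le>n. (r\<^sup>2) ^ k *\<^sub>R (r ^ h *\<^sub>R p h k))) = r ^ h *\<^sub>R p h k" for h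
    proof -
      have "r ^ h *\<^sub>R S h r - (\<Sum>k\<le>n. (r\<^sup>2) ^ k *\<^sub>R (r ^ h *\<^sub>R p h k)) = (r\<^sup>2) ^ Suc n *\<^sub>R (r ^ h *\<^sub>R p h k)"
        by (simp add: S_def k scaleR_right_distrib scaleR_right.sum mult_ac)
      then show ?thesis using Suc.prems(3) by (simp del: power_Suc)
    qed
    ultimately show ?thesis by simp
  qed (use le Suc.prems(3) in blast)
qed

text \<open>A convergent sequence is bounded; boundedness at the radius
  \<open>2 * \<bar>R\<bar> + 1\<close> yields a geometric majorant of ratio \<open>1/2\<close> at
  \<open>R\<close>.\<close>

lemma entire_if_decay:
  assumes "\<And>r :: real. r > 0 \<Longrightarrow> (\<lambda>h. r ^ h *\<^sub>R a h) \<longlonglongrightarrow> 0"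
  shows "entire a"
  unfolding entire_def
proof
  fix R :: real
  define r where "r = 2 * \<bar>R\<bar> + 1"
  have r: "r > 0" "\<bar>R\<bar> \<le> r / 2" by (auto simp: r_def)
  obtain C where C: "\<And>h. norm (r ^ h *\<^sub>R a h) \<le> C"
    using convergent_imp_Bseq[OF convergentI[OF assms[OF r(1)]]] unfolding Bseq_def by blast
  show "summable (\<lambda>m. norm (a m) * R ^ m)"
  proof (rule summable_comparison_test')
    show "summable (\<lambda>m. C * (1/2) ^ m)" by (intro summable_mult summable_geometric) simp
    fix m :: nat
    have "norm (norm (a m) * R ^ m) = norm (a m) * \<bar>R\<bar> ^ m" by (simp add: abs_mult power_abs)
    also have "\<dots> \<le> norm (a m) * (r / 2) ^ m" by (intro mult_left_mono power_mono r) auto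
    also have "\<dots> = norm (r ^ m *\<^sub>R a m) * (1/2) ^ m" using r(1) by (simp add: power_divide)
    also have "\<dots> \<le> C * (1/2) ^ m" by (intro mult_right_mono C) auto
    finally show "norm (norm (a m) * R ^ m) \<le> C * (1/2) ^ m" .
  qed
qed

text \<open>Inner products with basis vectors reduce this to real series. Once the lower
  coefficients vanish, dividing by \<open>r ^ d\<close> and letting \<open>r\<close> tend to
  \<open>0\<close> isolates the one of index \<open>d\<close>.\<close>

lemma real_power_series_zero:
  fixes c :: "nat \<Rightarrow> 'a::euclidean_space"
  assumes "\<And>r :: real. (\<lambda>d. r ^ d *\<^sub>R c d) sums 0"
  shows "c d = 0"
proof (rule euclidean_eqI)
  fix e :: 'a assume "e \<in> Basis"
  have s: "(\<lambda>d. (c d \<bullet> e) * r ^ d) sums 0" for r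
    using bounded_linear.sums[OF bounded_linear_inner_left[of e] assms[of r]] by (simp add: mult.commute)
  have "c d \<bullet> e = 0"
  proof (induction d rule: less_induct)
    case (less d)
    have "(\<lambda>i. (c (i + d) \<bullet> e) * r ^ i) sums 0" if "r \<noteq> 0" for r :: real
    proof -
      have "(\<lambda>i. (c (i + d) \<bullet> e) * r ^ (i + d)) sums 0"
        using s[of r] less by (subst sums_zero_iff_shift) auto
      then have "(\<lambda>i. (c (i + d) \<bullet> e) * r ^ (i + d) / r ^ d) sums (0 / r ^ d)" by (rule sums_divide)
      then show ?thesis using that by (simp add: power_add)
    qed
    then have "((\<lambda>_. 0) \<longlongrightarrow> c (0 + d) \<bullet> e) (at (0 :: real))"
      by (intro powser_limit_0_strong[where s = 1 and a = "\<lambda>i. c (i + d) \<bullet> e"]) auto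
    then show ?case by (simp add: tendsto_const_iff)
  qed
  then show "c d \<bullet> e = 0 \<bullet> e" by simp
qed

text \<open>The term with indices \<open>h\<close> and \<open>k\<close> has degree
  \<open>h + 2 * k\<close> in \<open>r\<close>. Regrouping by degree requires the series over
  \<open>h\<close> to converge for each fixed \<open>k\<close>; \<open>homogeneous_decay\<close> and
  \<open>entire_if_decay\<close> extract this from the convergence of the grouped sum.\<close>

lemma homogeneous_series_zero:
  fixes p :: "nat \<Rightarrow> nat \<Rightarrow> 'a::euclidean_space"
  assumes s: "\<And>r :: real. (\<lambda>h. r ^ h *\<^sub>R (\<Sum>k\<le>n. (r\<^sup>2) ^ k *\<^sub>R p h k)) sums 0"
  shows "(\<Sum>k\<le>n. if 2 * k \<le> d then p (d - 2 * k) k else 0) = 0"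
proof (rule real_power_series_zero[where c = "\<lambda>d. \<Sum>k\<le>n. if 2 * k \<le> d then p (d - 2 * k) k else 0"])
  fix r :: real
  have sm: "summable (\<lambda>h. r ^ h *\<^sub>R p h k)" if "k \<le> n" for k
  proof -
    have "entire (\<lambda>h. p h k)"
      using homogeneous_decay[OF _ that] summable_LIMSEQ_zero[OF sums_summable[OF s]]
      by (intro entire_if_decay) blast
    then have "summable (\<lambda>h. norm (r ^ h *\<^sub>R p h k))"
      by (simp add: entire_def power_abs mult.commute[of "\<bar>r\<bar> ^ _"])
    then show ?thesis by (rule summable_norm_cancel)
  qed
  have k: "(\<lambda>d. r ^ d *\<^sub>R (if 2 * k \<le> d then p (d - 2 * k) k else 0)) sums ((r\<^sup>2) ^ k *\<^sub>R (\<Sum>h. r ^ h *\<^sub>R p h k))"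
    if "k \<le> n" for k
  proof -
    have "(\<lambda>h. (r\<^sup>2) ^ k *\<^sub>R (r ^ h *\<^sub>R p h k)) sums ((r\<^sup>2) ^ k *\<^sub>R (\<Sum>h. r ^ h *\<^sub>R p h k))"
      by (intro sums_scaleR_right summable_sums sm that)
    then have "(\<lambda>h. r ^ (h + 2 * k) *\<^sub>R (if 2 * k \<le> h + 2 * k then p (h + 2 * k - 2 * k) k else 0))
        sums ((r\<^sup>2) ^ k *\<^sub>R (\<Sum>h. r ^ h *\<^sub>R p h k))"
      by (simp add: power_add power_mult mult.commute[of "r ^ _"])
    then show ?thesis
      by (subst (asm) sums_zero_iff_shift) auto
  qed
  have "(\<lambda>d. \<Sum>k\<le>n. r ^ d *\<^sub>R (if 2 * k \<le> d then p (d - 2 * k) k else 0)) sums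
      (\<Sum>k\<le>n. (r\<^sup>2) ^ k *\<^sub>R (\<Sum>h. r ^ h *\<^sub>R p h k))"
    by (intro sums_sum k) simp
  moreover have "(\<Sum>k\<le>n. (r\<^sup>2) ^ k *\<^sub>R (\<Sum>h. r ^ h *\<^sub>R p h k)) = 0"
  proof -
    have "(\<lambda>h. \<Sum>k\<le>n. (r\<^sup>2) ^ k *\<^sub>R (r ^ h *\<^sub>R p h k)) sums
        (\<Sum>k\<le>n. (r\<^sup>2) ^ k *\<^sub>R (\<Sum>h. r ^ h *\<^sub>R p h k))"
      by (intro sums_sum sums_scaleR_right summable_sums sm) simp
    then have "(\<lambda>h. r ^ h *\<^sub>R (\<Sum>k\<le>n. (r\<^sup>2) ^ k *\<^sub>R p h k)) sums
        (\<Sum>k\<le>n. (r\<^sup>2) ^ k *\<^sub>R (\<Sum>h. r ^ h *\<^sub>R p h k))"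
      by (simp add: scaleR_right.sum mult.commute)
    then show ?thesis using s[of r] sums_unique2 by blast
  qed
  ultimately show "(\<lambda>d. r ^ d *\<^sub>R (\<Sum>k\<le>n. if 2 * k \<le> d then p (d - 2 * k) k else 0)) sums 0"
    by (simp only: scaleR_right.sum)
qed

text \<open>As \<open>t\<close> tends to \<open>0\<close> only the term with \<open>k = 0\<close>
  survives, and its factor \<open>f 0 0\<close> is nonzero, so \<open>c 0 = 0\<close>. Dividing by
  \<open>t\<close> passes to the other terms; this is why the relation is asked for at
  \<open>t \<noteq> 0\<close>.\<close>

lemma nonvanishing_powers_independent:
  fixes f :: "nat \<Rightarrow> real \<Rightarrow> 'a::real_normed_div_algebra"
  assumes "\<And>k. isCont (f k) 0" "\<And>k. f k 0 \<noteq> 0"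
    and "\<And>t. t \<noteq> 0 \<Longrightarrow> (\<Sum>k\<le>n. t ^ k *\<^sub>R (f k t * c k)) = 0"
    and "k \<le> n"
  shows "c k = 0"
  using assms
proof (induction n arbitrary: f c k)
  case 0
  then show ?case
  proof -
    have "((\<lambda>t. f 0 t * c 0) \<longlongrightarrow> f 0 0 * c 0) (at 0)"
      using "0.prems"(1)[of 0] by (intro tendsto_intros) (simp add: isCont_def)
    moreover have "((\<lambda>t. f 0 t * c 0) \<longlongrightarrow> 0) (at 0)"
      using "0.prems"(3) by (intro tendsto_eventually) (auto simp: eventually_at intro!: exI[of _ 1])
    ultimately have "f 0 0 * c 0 = 0" by (rule tendsto_unique[rotated]) simp
    then show ?thesis using "0.prems"(2,4) by auto
  qed
next
  case (Suc n)
  have sh: "(\<Sum>k\<le>Suc n. t ^ k *\<^sub>R (f k t * c k)) = f 0 t * c 0 + t *\<^sub>R (\<Sum>k\<le>n. t ^ k *\<^sub>R (f (Suc k) t * c (Suc k)))" for t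
    by (simp add: sum.atMost_Suc_shift scaleR_right.sum del: sum.atMost_Suc)
  have c: "(f k \<longlongrightarrow> f k 0) (at 0)" for k
    using Suc.prems(1)[of k] by (simp add: isCont_def)
  have "((\<lambda>t. f 0 t * c 0 + t *\<^sub>R (\<Sum>k\<le>n. t ^ k *\<^sub>R (f (Suc k) t * c (Suc k)))) \<longlongrightarrow>
     f 0 0 * c 0 + 0 *\<^sub>R (\<Sum>k\<le>n. 0 ^ k *\<^sub>R (f (Suc k) 0 * c (Suc k)))) (at 0)"
    by (intro tendsto_intros c)
  moreover have "((\<lambda>t. f 0 t * c 0 + t *\<^sub>R (\<Sum>k\<le>n. t ^ k *\<^sub>R (f (Suc k) t * c (Suc k)))) \<longlongrightarrow> 0) (at 0)"
    using Suc.prems(3) unfolding sh by (intro tendsto_eventually) (auto simp: eventually_at intro!: exI[of _ 1])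
  ultimately have "f 0 0 * c 0 = 0" using tendsto_unique[OF trivial_limit_at] by fastforce
  then have c0: "c 0 = 0" using Suc.prems(2) by auto
  have cS: "c (Suc k) = 0" if "k \<le> n" for k
  proof (rule Suc.IH[OF _ _ _ that, where f = "\<lambda>k. f (Suc k)"])
    show "(\<Sum>k\<le>n. t ^ k *\<^sub>R (f (Suc k) t * c (Suc k))) = 0" if "t \<noteq> 0" for t
      using Suc.prems(3)[OF that] that unfolding sh by (simp add: c0)
  qed (use Suc.prems in auto)
  show ?case using c0 cS Suc.prems(4) by (cases k) auto
qed

lemma Q_poly_scaleR: "Q_poly s (r *\<^sub>R u) = r ^ s *\<^sub>R Q_poly s u"
proof -
  have "(r *\<^sub>R u) ^ (s - j) * (r *\<^sub>R qcnj u) ^ j = r ^ s *\<^sub>R (u ^ (s - j) * qcnj u ^ j)" if "j \<in> {..s}" for j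
  proof -
    have "r ^ (s - j) * r ^ j = r ^ s" using that by (simp flip: power_add)
    then show ?thesis by (simp add: scaleR_power mult.commute)
  qed
  then have "(\<Sum>j\<le>s. real (Suc s - j) *\<^sub>R ((r *\<^sub>R u) ^ (s - j) * (r *\<^sub>R qcnj u) ^ j))
      = r ^ s *\<^sub>R (\<Sum>j\<le>s. real (Suc s - j) *\<^sub>R (u ^ (s - j) * qcnj u ^ j))"
    unfolding scaleR_right.sum by (intro sum.cong refl) (simp only: scaleR_left_commute)
  then show ?thesis
    unfolding Q_poly_alt qcnj_simps by (simp add: mult.commute)
qed

text \<open>The total degree is \<open>h + 2 * k\<close>; it is split into \<open>r ^ h\<close> and
  a power of \<open>r\<^sup>2\<close> to match \<open>homogeneous_series_zero\<close>.\<close>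

lemma M_poly_scaleR: "M_poly k (h + k) (r *\<^sub>R u) = r ^ h *\<^sub>R ((r\<^sup>2) ^ k *\<^sub>R (qre u ^ k *\<^sub>R Q_poly (h + k) u))"
proof -
  have "(r * qre u) ^ k * r ^ (h + k) = r ^ h * ((r\<^sup>2) ^ k * qre u ^ k)"
    by (simp add: power_add power_mult_distrib power2_eq_square mult_ac)
  then show ?thesis
    unfolding M_poly_def scaleR_conv_of_real[symmetric] Q_poly_scaleR scaleR_scaleR by simp
qed

text \<open>The upper bound is carried along for the induction: the next sum is \<open>m + 2\<close>
  minus the current one, so each of the two bounds yields the other.\<close>

lemma alternating_sum_pos: "0 < (\<Sum>j\<le>m. (-1) ^ j * real (Suc m - j)) \<and> (\<Sum>j\<le>m. (-1) ^ j * real (Suc m - j)) < real m + 2"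
proof (induction m)
  case (Suc m)
  have "(\<Sum>j\<le>Suc m. (-1) ^ j * real (Suc (Suc m) - j)) = real m + 2 - (\<Sum>j\<le>m. (-1) ^ j * real (Suc m - j))"
    by (simp add: sum.atMost_Suc_shift sum_negf del: sum.atMost_Suc of_nat_diff)
  then show ?case using Suc by simp
qed simp

text \<open>As \<open>qcnj I = - I\<close>, every monomial collapses to \<open>I ^ m\<close> up to
  sign, leaving a positive alternating sum of the weights.\<close>

lemma Q_poly_imag_unit_nonzero:
  assumes "I \<in> \<bbbS>"
  shows "Q_poly m I \<noteq> 0"
proof -
  have "I ^ (m - j) * (- I) ^ j = (-1) ^ j *\<^sub>R I ^ m" if "j \<le> m" for j
    using that by (simp add: power_minus[of I] power_add[symmetric])
      (simp add: minus_one_power_iff power_add[symmetric])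
  then have "(\<Sum>j\<le>m. real (Suc m - j) *\<^sub>R (I ^ (m - j) * (- I) ^ j))
      = (\<Sum>j\<le>m. (-1) ^ j * real (Suc m - j)) *\<^sub>R I ^ m"
    unfolding scaleR_left.sum by (intro sum.cong refl) (simp add: mult.commute del: of_nat_diff)
  then have Q: "Q_poly m I = (2 / (real (Suc m) * real (Suc (Suc m)))) *\<^sub>R (\<Sum>j\<le>m. (-1) ^ j * real (Suc m - j)) *\<^sub>R I ^ m"
    unfolding Q_poly_alt imag_unitD(2)[OF assms] by simp
  have "I \<noteq> 0" using imag_unitD(4)[OF assms] by auto
  moreover have "(\<Sum>j\<le>m. (-1) ^ j * real (Suc m - j)) \<noteq> 0" using alternating_sum_pos[of m] by linarith
  ultimately show ?thesis unfolding Q by (simp del: of_nat_Suc of_nat_diff)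
qed

lemma continuous_Q_poly: "continuous_on UNIV (Q_poly m)"
  unfolding Q_poly_def
  by (intro continuous_intros linear_continuous_on bounded_linear_qcnj)

text \<open>Each homogeneous part is a finite relation between terms
  \<open>qre u ^ k * Q_poly (d - k) u\<close>. Points near an imaginary unit separate them: the real
  part there is a small parameter, while the values of \<open>Q_poly\<close> at the unit itself are
  nonzero.\<close>

lemma A_expansion_zero:
  assumes s: "\<And>q. (\<lambda>h. \<Sum>s\<le>n. M_poly (n - s) (h + n - s) q * \<alpha> h s) sums 0" and "s \<le> n"
  shows "\<alpha> h s = 0"
proof -
  define k where "k = n - s"
  \<comment> \<open>The total degree of the term in which \<open>\<alpha> h s\<close>
    occurs.\<close>
  define d where "d = h + 2 * k"
  define c where "c k = (if 2 * k \<le> d then \<alpha> (d - 2 * k) (n - k) else 0)" for k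
  have z: "(\<Sum>k\<le>n. qre u ^ k *\<^sub>R (Q_poly (d - k) u * c k)) = 0" for u
  proof -
    define p where "p h k = qre u ^ k *\<^sub>R (Q_poly (h + k) u * \<alpha> h (n - k))" for h k
    have "(\<Sum>k\<le>n. if 2 * k \<le> d then p (d - 2 * k) k else 0) = 0"
    proof (rule homogeneous_series_zero)
      fix r :: real
      have "r ^ h *\<^sub>R (\<Sum>k\<le>n. (r\<^sup>2) ^ k *\<^sub>R p h k)
          = (\<Sum>s\<le>n. M_poly (n - s) (h + n - s) (r *\<^sub>R u) * \<alpha> h s)" for h
        unfolding scaleR_right.sum
        by (rule sum.reindex_bij_witness[of _ "\<lambda>s. n - s" "\<lambda>k. n - k"])
          (auto simp: p_def M_poly_scaleR)
      then show "(\<lambda>h. r ^ h *\<^sub>R (\<Sum>k\<le>n. (r\<^sup>2) ^ k *\<^sub>R p h k)) sums 0"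
        using s[of "r *\<^sub>R u"] by simp
    qed
    moreover have "(if 2 * k \<le> d then p (d - 2 * k) k else 0) = qre u ^ k *\<^sub>R (Q_poly (d - k) u * c k)" for k
      by (auto simp: p_def c_def)
    ultimately show ?thesis by simp
  qed
  \<comment> \<open>At \<open>u = I + t\<close> with real \<open>t\<close> the real part is
    \<open>t\<close>, so the relation becomes one between powers of \<open>t\<close> with factors
    nonvanishing at \<open>t = 0\<close>.\<close>
  define I where "I = Quat 0 1 0 0"
  have "c k = 0"
  proof (rule nonvanishing_powers_independent[where f = "\<lambda>k t. Q_poly (d - k) (I + of_real t)" and n = n])
    show "Q_poly (d - k) (I + of_real 0) \<noteq> 0" for k
      using Q_poly_imag_unit_nonzero[OF qi_unit] by (simp add: I_def)
    show "isCont (\<lambda>t. Q_poly (d - k) (I + of_real t)) 0" for k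
      by (rule continuous_on_interior[of UNIV])
        (auto intro!: continuous_on_compose2[OF continuous_Q_poly] continuous_intros)
    show "(\<Sum>k\<le>n. t ^ k *\<^sub>R (Q_poly (d - k) (I + of_real t) * c k)) = 0" for t
      using z[of "I + of_real t"] by (simp add: I_def)
    show "k \<le> n" by (simp add: k_def)
  qed
  then show ?thesis using assms(2) by (simp add: c_def d_def k_def)
qed

lemma A_coeffs_eqI:
  assumes "\<And>h s. s > n \<Longrightarrow> \<alpha> h s = 0"
    and "\<And>q. (\<lambda>h. \<Sum>s\<le>n. M_poly (n - s) (h + n - s) q * \<alpha> h s) sums f q"
  shows "A_coeffs n f = \<alpha>"
  unfolding A_coeffs_def
proof (rule the_equality)
  fix \<beta> assume \<beta>: "(\<forall>h. \<forall>s>n. \<beta> h s = 0) \<and>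
     (\<forall>q. (\<lambda>h. \<Sum>s\<le>n. M_poly (n - s) (h + n - s) q * \<beta> h s) sums f q)"
  have "\<beta> h s = \<alpha> h s" for h s
  proof (cases "s \<le> n")
    case True
    have "(\<lambda>h. \<Sum>s\<le>n. M_poly (n - s) (h + n - s) q * (\<beta> h s - \<alpha> h s)) sums 0" for q
      using sums_diff[of _ "f q" _ "f q"] \<beta> assms(2)[of q] by (simp add: right_diff_distrib sum_subtractf)
    from A_expansion_zero[OF this True, of h] show ?thesis by simp
  qed (use \<beta> assms(1) in auto)
  then show "\<beta> = \<alpha>" by blast
qed (use assms in auto)

section \<open>Hermite functions\<close>

text \<open>Hermite polynomials for the weight \<open>exp (- 2 * pi * x\<^sup>2)\<close>: up to
  sign, the operator describes how differentiating a polynomial times this Gaussian changes the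
  polynomial.\<close>

definition hermite_poly :: "nat \<Rightarrow> real poly" where
  "hermite_poly k = ((\<lambda>p. [:0, 4 * pi:] * p - pderiv p) ^^ k) 1"

lemma hermite_poly_simps [simp]:
  "hermite_poly 0 = 1"
  "hermite_poly (Suc k) = [:0, 4 * pi:] * hermite_poly k - pderiv (hermite_poly k)"
  by (simp_all add: hermite_poly_def)

lemma deriv_gauss:
  "(deriv ^^ k) (\<lambda>x. exp (- 2 * pi * x\<^sup>2)) = (\<lambda>x. (-1) ^ k * poly (hermite_poly k) x * exp (- 2 * pi * x\<^sup>2))"
proof (induction k)
  case (Suc k)
  have "((\<lambda>x. (-1) ^ k * poly (hermite_poly k) x * exp (- 2 * pi * x\<^sup>2)) has_real_derivative
     (-1) ^ Suc k * poly (hermite_poly (Suc k)) x * exp (- 2 * pi * x\<^sup>2)) (at x)" for x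
    by (auto intro!: derivative_eq_intros poly_DERIV simp: algebra_simps)
  then show ?case unfolding funpow.simps o_apply Suc by (intro ext DERIV_imp_deriv)
qed simp

lemma hermite_fun_eq: "hermite_fun k x = poly (hermite_poly k) x * exp (- (pi * x\<^sup>2))"
proof -
  have "exp (pi * x\<^sup>2) * exp (- 2 * pi * x\<^sup>2) = exp (- (pi * x\<^sup>2))"
    unfolding exp_add[symmetric] by (simp add: algebra_simps)
  moreover have "(-1 :: real) ^ k * (-1) ^ k = 1" by (simp flip: power_mult_distrib)
  ultimately show ?thesis unfolding hermite_fun_def deriv_gauss by (simp add: algebra_simps)
qed

text \<open>The commutator of \<open>pderiv\<close> with the raising operator is the constant
  \<open>4 * pi\<close>, so every raising step adds another \<open>4 * pi\<close> to the
  factor.\<close>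

lemma pderiv_hermite_poly: "pderiv (hermite_poly (Suc k)) = smult (4 * pi * real (Suc k)) (hermite_poly k)"
proof (induction k)
  case 0
  show ?case by (simp add: pderiv_pCons)
next
  case (Suc k)
  define H where "H = hermite_poly (Suc k)"
  have H: "H = [:0, 4 * pi:] * hermite_poly k - pderiv (hermite_poly k)"
    "hermite_poly (Suc (Suc k)) = [:0, 4 * pi:] * H - pderiv H" by (simp_all add: H_def)
  note IH = Suc[folded H_def]
  have "pderiv (hermite_poly (Suc (Suc k))) = smult (4 * pi) H + [:0, 4 * pi:] * pderiv H - pderiv (pderiv H)"
    unfolding H(2) by (simp add: pderiv_diff pderiv_mult pderiv_pCons pderiv_smult)
  also have "\<dots> = smult (4 * pi) H + smult (4 * pi * real (Suc k)) H"
    unfolding IH pderiv_smult by (subst (3) H(1)) (simp add: smult_diff_right)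
  also have "\<dots> = smult (4 * pi * real (Suc (Suc k))) H"
    by (simp add: smult_add_left[symmetric] algebra_simps)
  finally show ?case by (simp only: H_def)
qed

section \<open>Gaussian integrals and orthogonality\<close>

definition gauss_int :: "real poly \<Rightarrow> real" where
  "gauss_int p = (LINT x|lborel. poly p x * exp (- 2 * pi * x\<^sup>2))"

text \<open>Variance \<open>1 / (4 * pi)\<close> matches the Gaussian weight; total mass and
  integrability of moments then come from the normal distribution.\<close>

lemma gauss_density: "normal_density 0 (1 / (2 * sqrt pi)) x = sqrt 2 * exp (- 2 * pi * x\<^sup>2)"
proof -
  have "(1 / (2 * sqrt pi))\<^sup>2 = 1 / (4 * pi)" by (simp add: power_divide power_mult_distrib)
  then show ?thesis unfolding normal_density_def by (simp add: real_sqrt_divide field_simps)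
qed

lemma gauss_integrable: "integrable lborel (\<lambda>x. poly p x * exp (- 2 * pi * x\<^sup>2))"
proof -
  have "integrable lborel (\<lambda>x. exp (- 2 * pi * x\<^sup>2) * x ^ k)" for k
    using integrable_normal_moment[of "1 / (2 * sqrt pi)" 0 k] by (simp add: gauss_density mult.assoc)
  then have "integrable lborel (\<lambda>x. \<Sum>i\<le>degree p. coeff p i * (exp (- 2 * pi * x\<^sup>2) * x ^ i))"
    by (intro Bochner_Integration.integrable_sum integrable_mult_right) simp
  then show ?thesis by (simp add: poly_altdef sum_distrib_right mult_ac)
qed

lemma gauss_int_1: "gauss_int 1 = 1 / sqrt 2"
proof -
  have "sqrt 2 * gauss_int 1 = 1"
    using integral_normal_density[of "1 / (2 * sqrt pi)" 0] by (simp add: gauss_int_def gauss_density)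
  then show ?thesis by (simp add: field_simps)
qed

lemma gauss_int_diff: "gauss_int (p - q) = gauss_int p - gauss_int q"
  unfolding gauss_int_def poly_diff left_diff_distrib
  by (rule Bochner_Integration.integral_diff[OF gauss_integrable gauss_integrable])

lemma gauss_int_smult: "gauss_int (smult c p) = c * gauss_int p"
  unfolding gauss_int_def by (simp add: mult.assoc)

lemma gauss_tendsto:
  "((\<lambda>x. poly p x * exp (- 2 * pi * x\<^sup>2)) \<longlongrightarrow> 0) at_top"
  "((\<lambda>x. poly p x * exp (- 2 * pi * x\<^sup>2)) \<longlongrightarrow> 0) at_bot"
proof -
  have 1: "((\<lambda>x :: real. x ^ k * exp (- 2 * pi * x\<^sup>2)) \<longlongrightarrow> 0) at_top" for k :: nat
    using pi_gt_zero by real_asymp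
  have top: "((\<lambda>x. poly p x * exp (- 2 * pi * x\<^sup>2)) \<longlongrightarrow> 0) at_top" for p
  proof -
    have "((\<lambda>x. \<Sum>i\<le>degree p. coeff p i * (x ^ i * exp (- 2 * pi * x\<^sup>2))) \<longlongrightarrow> (\<Sum>i\<le>degree p. coeff p i * 0)) at_top"
      by (intro tendsto_intros 1)
    then show ?thesis by (simp add: poly_altdef sum_distrib_right mult_ac)
  qed
  show "((\<lambda>x. poly p x * exp (- 2 * pi * x\<^sup>2)) \<longlongrightarrow> 0) at_top" by (rule top)
  show "((\<lambda>x. poly p x * exp (- 2 * pi * x\<^sup>2)) \<longlongrightarrow> 0) at_bot"
    unfolding filterlim_at_bot_mirror using top[of "pcompose p [:0, -1:]"] by (simp add: poly_pcompose)
qed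

text \<open>The polynomial times the Gaussian vanishes at both infinities, so the integral of its
  derivative is zero; \<open>r\<close> is the polynomial factor of that derivative.\<close>

lemma gauss_int_by_parts: "gauss_int ([:0, 4 * pi:] * p) = gauss_int (pderiv p)"
proof -
  let ?F = "\<lambda>x. poly p x * exp (- 2 * pi * x\<^sup>2)"
  define r where "r = pderiv p - [:0, 4 * pi:] * p"
  have d: "(?F has_real_derivative poly r x * exp (- 2 * pi * x\<^sup>2)) (at x)" for x
    unfolding r_def by (auto intro!: derivative_eq_intros poly_DERIV simp: algebra_simps)
  have "(LBINT x=-\<infinity>..\<infinity>. poly r x * exp (- 2 * pi * x\<^sup>2)) = 0 - 0"
  proof (rule interval_integral_FTC_integrable)
    show "(?F has_vector_derivative poly r x * exp (- 2 * pi * x\<^sup>2)) (at x)" for x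
      using d[of x] by (simp add: has_real_derivative_iff_has_vector_derivative)
    show "isCont (\<lambda>x. poly r x * exp (- 2 * pi * x\<^sup>2)) x" for x
      by (intro continuous_intros poly_isCont)
    show "set_integrable lborel (einterval (- \<infinity>) \<infinity>) (\<lambda>x. poly r x * exp (- 2 * pi * x\<^sup>2))"
      using gauss_integrable[of r] by (simp add: set_integrable_def)
    show "((?F \<circ> real_of_ereal) \<longlongrightarrow> 0) (at_right (- \<infinity>))" "((?F \<circ> real_of_ereal) \<longlongrightarrow> 0) (at_left \<infinity>)"
      unfolding ereal_tendsto_simps by (rule gauss_tendsto)+
  qed simp
  then have "gauss_int r = 0"
    by (simp add: interval_lebesgue_integral_def set_lebesgue_integral_def gauss_int_def)
  then show ?thesis by (simp add: r_def gauss_int_diff)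
qed

text \<open>Integration by parts makes the raising operator adjoint to \<open>pderiv\<close>. Each
  application lowers both indices by one and contributes \<open>4 * pi\<close> times the index,
  until one index is \<open>0\<close>; if the other is still positive, the derivative of the
  constant \<open>1\<close> gives zero.\<close>

lemma gauss_int_hermite:
  "gauss_int (hermite_poly j * hermite_poly k) = (if j = k then (4 * pi) ^ k * fact k / sqrt 2 else 0)"
proof (induction j arbitrary: k)
  have step: "gauss_int (hermite_poly (Suc j) * p) = gauss_int (hermite_poly j * pderiv p)" for j p
  proof -
    have "gauss_int (hermite_poly (Suc j) * p)
        = gauss_int ([:0, 4 * pi:] * (hermite_poly j * p)) - gauss_int (pderiv (hermite_poly j) * p)"
      by (simp add: gauss_int_diff[symmetric] algebra_simps)
    also have "\<dots> = gauss_int (hermite_poly j * pderiv p)"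
      unfolding gauss_int_by_parts by (simp add: gauss_int_diff[symmetric] pderiv_mult algebra_simps)
    finally show ?thesis .
  qed
  have z: "gauss_int 0 = 0" by (simp add: gauss_int_def)
  {
    case 0
    show ?case
    proof (cases k)
      case (Suc k')
      then show ?thesis using step[of k' 1] by (simp add: z)
    qed (simp add: gauss_int_1)
  next
    case (Suc j)
    show ?case
    proof (cases k)
      case 0
      then show ?thesis using step[of j 1] by (simp add: z)
    next
      case (Suc k')
      have "gauss_int (hermite_poly (Suc j) * hermite_poly k)
          = 4 * pi * real (Suc k') * gauss_int (hermite_poly j * hermite_poly k')"
        unfolding Suc step pderiv_hermite_poly by (simp add: gauss_int_smult)
      also have "\<dots> = (if Suc j = k then (4 * pi) ^ k * fact k / sqrt 2 else 0)"
        unfolding Suc.IH Suc by simp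
      finally show ?thesis .
    qed
  }
qed

lemma hermite_fun_mult: "hermite_fun j x * hermite_fun k x = poly (hermite_poly j * hermite_poly k) x * exp (- 2 * pi * x\<^sup>2)"
proof -
  have "exp (- (pi * x\<^sup>2)) * exp (- (pi * x\<^sup>2)) = exp (- 2 * pi * x\<^sup>2)"
    unfolding exp_add[symmetric] by simp
  then show ?thesis by (simp add: hermite_fun_eq mult_ac)
qed

lemma hermite_fun_mult_integrable: "integrable lborel (\<lambda>x. hermite_fun j x * hermite_fun k x)"
  unfolding hermite_fun_mult by (rule gauss_integrable)

lemma hermite_fun_orthogonal:
  "(LINT x|lborel. hermite_fun j x * hermite_fun k x) = (if j = k then (4 * pi) ^ k * fact k / sqrt 2 else 0)"
  unfolding hermite_fun_mult gauss_int_hermite[symmetric] gauss_int_def ..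

section \<open>The Bargmann kernel as generating function of the Hermite functions\<close>

text \<open>The series has even powers only; padding with zeros at odd indices prepares a Cauchy
  product over all powers of \<open>z\<close>.\<close>

lemma gauss_series:
  fixes z :: "'a::{real_normed_algebra_1,banach}"
  defines "e \<equiv> \<lambda>m. if even m then (- pi) ^ (m div 2) / fact (m div 2) else 0"
  shows "(\<lambda>m. e m *\<^sub>R z ^ m) sums exp (- (pi *\<^sub>R z\<^sup>2))" "summable (\<lambda>m. norm (e m *\<^sub>R z ^ m))"
proof -
  have mono: "strict_mono (\<lambda>i. 2 * i :: nat)" by (rule strict_monoI) simp
  have odd: "\<not> even m" if "m \<notin> range (\<lambda>i. 2 * i)" for m :: nat using that by (auto elim!: evenE)
  have eq: "((- (pi *\<^sub>R z\<^sup>2)) ^ i /\<^sub>R fact i) = e (2 * i) *\<^sub>R z ^ (2 * i)" for i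
  proof -
    have "(- (pi *\<^sub>R z\<^sup>2)) ^ i = ((- pi) *\<^sub>R z\<^sup>2) ^ i" by simp
    also have "\<dots> = (- pi) ^ i *\<^sub>R z ^ (2 * i)" by (simp only: scaleR_power power_mult)
    finally show ?thesis by (simp add: e_def divide_inverse mult.commute)
  qed
  have "(\<lambda>i. e (2 * i) *\<^sub>R z ^ (2 * i)) sums exp (- (pi *\<^sub>R z\<^sup>2))"
    using exp_converges[of "- (pi *\<^sub>R z\<^sup>2)"] unfolding eq .
  then show "(\<lambda>m. e m *\<^sub>R z ^ m) sums exp (- (pi *\<^sub>R z\<^sup>2))"
    by (subst (asm) sums_mono_reindex[OF mono]) (auto simp: e_def dest: odd)
  have "summable (\<lambda>i. norm (e (2 * i) *\<^sub>R z ^ (2 * i)))"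
    using summable_norm_exp[of "- (pi *\<^sub>R z\<^sup>2)"] unfolding eq .
  then show "summable (\<lambda>m. norm (e m *\<^sub>R z ^ m))"
    by (subst (asm) summable_mono_reindex[OF mono]) (auto simp: e_def dest: odd)
qed

text \<open>The coefficients satisfy the three-term recurrence of the Hermite polynomials because the
  product \<open>F\<close> of the two exponential series solves the differential equation
  \<open>F' = (2\<pi> \<surd>2 x - 2\<pi> X) F\<close>.\<close>

lemma gauss_cauchy_coeff:
  defines "e \<equiv> \<lambda>m. if even m then (- pi) ^ (m div 2) / fact (m div 2) else 0"
  shows "(\<Sum>i\<le>k. e i * ((2 * pi * sqrt 2 * x) ^ (k - i) / fact (k - i)))
    = poly (hermite_poly k) x / (sqrt 2 ^ k * fact k)"
proof -
  \<comment> \<open>As a formal power series, so that coefficients can be compared without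
    convergence arguments.\<close>
  define F where "F = Abs_fps e * fps_exp (2 * pi * sqrt 2 * x)"
  define v where "v k = poly (hermite_poly k) x / (sqrt 2 ^ k * fact k)" for k
  have de: "fps_deriv (Abs_fps e) = - (fps_const (2 * pi) * (fps_X * Abs_fps e))"
  proof (rule fps_ext)
    fix m
    show "fps_nth (fps_deriv (Abs_fps e)) m = fps_nth (- (fps_const (2 * pi) * (fps_X * Abs_fps e))) m"
    proof (cases m)
      case (Suc m')
      show ?thesis
      proof (cases "even m'")
        case True
        then obtain i where i: "m' = 2 * i" by (elim evenE)
        show ?thesis by (simp add: Suc e_def i field_simps del: of_nat_Suc) simp
      qed (simp add: Suc e_def)
    qed (simp add: e_def)
  qed
  have dF: "fps_deriv F = fps_const (2 * pi * sqrt 2 * x) * F - fps_const (2 * pi) * (fps_X * F)"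
    unfolding F_def fps_deriv_mult de by (simp add: algebra_simps)
  have F1: "fps_nth F 1 = 2 * pi * sqrt 2 * x * fps_nth F 0"
    using arg_cong[OF dF, of "\<lambda>F. fps_nth F 0"] by simp
  have F2: "real (Suc (Suc k)) * fps_nth F (Suc (Suc k)) = 2 * pi * sqrt 2 * x * fps_nth F (Suc k) - 2 * pi * fps_nth F k" for k
    using arg_cong[OF dF, of "\<lambda>F. fps_nth F (Suc k)"] by simp
  have F0: "fps_nth F 0 = 1" by (simp add: F_def e_def)
  have v2: "real (Suc (Suc k)) * v (Suc (Suc k)) = 2 * pi * sqrt 2 * x * v (Suc k) - 2 * pi * v k" for k
  proof -
    have "poly (hermite_poly (Suc (Suc k))) x = 4 * pi * x * poly (hermite_poly (Suc k)) x - 4 * pi * real (Suc k) * poly (hermite_poly k) x"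
      unfolding hermite_poly_simps(2)[of "Suc k"] pderiv_hermite_poly by (simp add: algebra_simps del: hermite_poly_simps)
    moreover have "sqrt 2 ^ Suc (Suc k) = 2 * sqrt 2 ^ k" "sqrt 2 ^ Suc k = sqrt 2 * sqrt 2 ^ k" by simp_all
    moreover have "fact (Suc (Suc k)) = real (Suc (Suc k)) * (real (Suc k) * fact k)" "fact (Suc k) = real (Suc k) * fact k"
      by simp_all
    \<comment> \<open>Here \<open>M\<close>, \<open>N\<close>, \<open>s\<close>, \<open>f\<close>
      stand for \<open>k + 2\<close>, \<open>k + 1\<close>, \<open>sqrt 2 ^ k\<close>,
      \<open>fact k\<close>; as free positive reals they leave a plain field identity.\<close>
    moreover have "M * ((4 * pi * x * B - 4 * pi * N * C) / (2 * s * (M * (N * f))))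
        = 2 * pi * sqrt 2 * x * (B / (sqrt 2 * s * (N * f))) - 2 * pi * (C / (s * f))"
      if "M > 0" "N > 0" "s > 0" "f > 0" for M N s f B C :: real
      using that by (simp add: field_simps)
    ultimately show ?thesis unfolding v_def by (simp only: of_nat_0_less_iff zero_less_Suc fact_gt_zero
          zero_less_power real_sqrt_gt_zero zero_less_numeral)
  qed
  have "fps_nth F k = v k \<and> fps_nth F (Suc k) = v (Suc k)" for k
  proof (induction k)
    case 0
    have "v 1 = 2 * pi * sqrt 2 * x" by (simp add: v_def field_simps)
    then show ?case using F0 F1 by (simp add: v_def)
  next
    case (Suc k)
    then have "real (Suc (Suc k)) * fps_nth F (Suc (Suc k)) = real (Suc (Suc k)) * v (Suc (Suc k))"
      unfolding F2 v2 by simp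
    then have "fps_nth F (Suc (Suc k)) = v (Suc (Suc k))"
      by (simp only: mult_cancel_left of_nat_eq_0_iff) simp
    then show ?case using Suc by simp
  qed
  then show ?thesis by (simp add: F_def v_def fps_mult_nth atLeast0AtMost)
qed

text \<open>The kernel factors into exponentials of \<open>- pi * x\<^sup>2\<close>, of a real
  multiple of \<open>q\<^sup>2\<close> and of a real multiple of \<open>q\<close>, which all
  commute. The type stays general because \<open>bargmann_kernel_abs_summable\<close> uses the
  expansion at a real point.\<close>

lemma bargmann_kernel_sums:
  fixes q :: "'a::{real_normed_algebra_1,banach}"
  shows "(\<lambda>k. (hermite_fun k x / (sqrt 2 ^ k * fact k)) *\<^sub>R q ^ k) sums
    exp (- (of_real pi * (q\<^sup>2 + of_real (x\<^sup>2))) + of_real (2 * pi * sqrt 2) * q * of_real x)"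
proof -
  define e where "e m = (if even m then (- pi) ^ (m div 2) / fact (m div 2) else 0)" for m
  define c where "c = 2 * pi * sqrt 2 * x"
  have g: "(\<lambda>m. e m *\<^sub>R q ^ m) sums exp (- (pi *\<^sub>R q\<^sup>2))" "summable (\<lambda>m. norm (e m *\<^sub>R q ^ m))"
    using gauss_series[of q] by (simp_all add: e_def)
  have eqd: "(c *\<^sub>R q) ^ k /\<^sub>R fact k = (c ^ k / fact k) *\<^sub>R q ^ k" for k
    by (simp add: scaleR_power divide_inverse mult.commute)
  have d: "(\<lambda>k. (c ^ k / fact k) *\<^sub>R q ^ k) sums exp (c *\<^sub>R q)" "summable (\<lambda>k. norm ((c ^ k / fact k) *\<^sub>R q ^ k))"
    using exp_converges[of "c *\<^sub>R q"] summable_norm_exp[of "c *\<^sub>R q"] unfolding eqd by simp_all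
  have "(\<lambda>k. \<Sum>i\<le>k. (e i *\<^sub>R q ^ i) * ((c ^ (k - i) / fact (k - i)) *\<^sub>R q ^ (k - i))) sums
      (exp (- (pi *\<^sub>R q\<^sup>2)) * exp (c *\<^sub>R q))"
    using Cauchy_product_sums[OF g(2) d(2)] g(1) d(1) by (simp add: sums_iff)
  moreover have "(\<Sum>i\<le>k. (e i *\<^sub>R q ^ i) * ((c ^ (k - i) / fact (k - i)) *\<^sub>R q ^ (k - i)))
      = (poly (hermite_poly k) x / (sqrt 2 ^ k * fact k)) *\<^sub>R q ^ k" for k
    unfolding gauss_cauchy_coeff[symmetric] scaleR_left.sum e_def[symmetric] c_def[symmetric]
    by (intro sum.cong refl) (simp add: power_add[symmetric])
  ultimately have "(\<lambda>k. exp (- (pi * x\<^sup>2)) *\<^sub>R ((poly (hermite_poly k) x / (sqrt 2 ^ k * fact k)) *\<^sub>R q ^ k)) sums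
      (exp (- (pi * x\<^sup>2)) *\<^sub>R (exp (- (pi *\<^sub>R q\<^sup>2)) * exp (c *\<^sub>R q)))"
    by (intro sums_scaleR_right) simp
  moreover have "exp (- (pi * x\<^sup>2)) *\<^sub>R (exp (- (pi *\<^sub>R q\<^sup>2)) * exp (c *\<^sub>R q))
     = exp (- (of_real pi * (q\<^sup>2 + of_real (x\<^sup>2))) + of_real (2 * pi * sqrt 2) * q * of_real x)"
  proof -
    have "exp (- (pi *\<^sub>R q\<^sup>2)) * exp (c *\<^sub>R q) = exp (- (pi *\<^sub>R q\<^sup>2) + c *\<^sub>R q)"
      by (rule exp_add_commuting[symmetric]) (simp add: power2_eq_square mult.assoc)
    moreover have "exp (- (pi * x\<^sup>2)) *\<^sub>R exp (- (pi *\<^sub>R q\<^sup>2) + c *\<^sub>R q)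
       = exp (of_real (- (pi * x\<^sup>2)) + (- (pi *\<^sub>R q\<^sup>2) + c *\<^sub>R q))"
      unfolding scaleR_conv_of_real exp_of_real[symmetric]
      by (rule exp_add_commuting[symmetric]) (simp add: of_real_def)
    ultimately show ?thesis
      by (simp add: c_def of_real_def algebra_simps)
  qed
  ultimately show ?thesis by (simp add: hermite_fun_eq mult_ac)
qed

text \<open>Convergence of the power series at the larger point \<open>r + 1\<close> forces absolute
  convergence at \<open>r\<close>.\<close>

lemma bargmann_kernel_abs_summable:
  "summable (\<lambda>k. \<bar>hermite_fun k x\<bar> / (sqrt 2 ^ k * fact k) * r ^ k)" if "r \<ge> 0"
proof -
  have "summable (\<lambda>k. (hermite_fun k x / (sqrt 2 ^ k * fact k)) * (r + 1) ^ k)"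
    using bargmann_kernel_sums[of x "r + 1"] by (simp add: sums_iff)
  then have "summable (\<lambda>k. norm ((hermite_fun k x / (sqrt 2 ^ k * fact k)) * r ^ k))"
    by (rule powser_insidea) (use that in auto)
  then show ?thesis using that by (simp add: abs_mult power_abs)
qed

section \<open>Hermite expansions in $L^2$ and the Bargmann transform\<close>

lemma hermite_fun_measurable [measurable]: "hermite_fun k \<in> borel_measurable borel"
proof -
  have "hermite_fun k = (\<lambda>x. poly (hermite_poly k) x * exp (- (pi * x\<^sup>2)))"
    by (simp add: fun_eq_iff hermite_fun_eq)
  then show ?thesis
    by (auto intro!: borel_measurable_continuous_onI continuous_intros)
qed

definition hermite_norm :: "nat \<Rightarrow> real" where
  "hermite_norm k = sqrt ((4 * pi) ^ k * fact k / sqrt 2)"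

lemma hermite_norm_pos: "hermite_norm k > 0"
  by (simp add: hermite_norm_def)

lemma L2_norm_hermite: "L2_norm (\<lambda>x. of_real (hermite_fun k x)) = hermite_norm k"
  using hermite_fun_orthogonal[of k k] by (simp add: L2_norm_def hermite_norm_def power2_eq_square)

lemma normalized_hermite_eq: "normalized_hermite k x = of_real (hermite_fun k x / hermite_norm k)"
  by (simp add: normalized_hermite_def L2_norm_hermite)

section \<open>Square-integrable functions and their inner product\<close>

lemma L2_D: "\<phi> \<in> L2 \<Longrightarrow> \<phi> \<in> borel_measurable borel" "\<phi> \<in> L2 \<Longrightarrow> integrable lborel (\<lambda>x. (norm (\<phi> x))\<^sup>2)"
  by (simp_all add: L2_def)

lemma L2_normalized_hermite: "normalized_hermite k \<in> L2"
proof -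
  have "(\<lambda>x. of_real (hermite_fun k x / hermite_norm k) :: quat) \<in> borel_measurable borel"
    by measurable
  moreover have "integrable lborel (\<lambda>x. (hermite_fun k x * hermite_fun k x) / (hermite_norm k)\<^sup>2)"
    using hermite_fun_mult_integrable[of k k] by (intro integrable_divide) auto
  ultimately show ?thesis
    by (simp add: L2_def normalized_hermite_eq[abs_def] power_divide power2_eq_square del: of_real_divide)
qed

lemma L2_bound:
  assumes "\<phi> \<in> borel_measurable borel" "integrable lborel g" "\<And>x. (norm (\<phi> x))\<^sup>2 \<le> g x"
  shows "\<phi> \<in> L2"
proof -
  have [measurable]: "\<phi> \<in> borel_measurable borel" by fact
  have "integrable lborel (\<lambda>x. (norm (\<phi> x))\<^sup>2)"
    by (rule Bochner_Integration.integrable_bound[OF assms(2)])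
      (auto intro!: AE_I2 order_trans[OF assms(3)])
  then show ?thesis by (simp add: L2_def)
qed

lemma L2_mult_right:
  assumes "\<phi> \<in> L2"
  shows "(\<lambda>x. \<phi> x * a) \<in> L2"
proof (rule L2_bound[where g = "\<lambda>x. (norm (\<phi> x))\<^sup>2 * (norm a)\<^sup>2"])
  note [measurable] = L2_D(1)[OF assms]
  show "(\<lambda>x. \<phi> x * a) \<in> borel_measurable borel" by measurable
qed (use assms in \<open>auto simp: L2_D norm_mult power_mult_distrib\<close>)

lemma L2_add:
  assumes "\<phi> \<in> L2" "\<psi> \<in> L2"
  shows "(\<lambda>x. \<phi> x + \<psi> x) \<in> L2"
proof (rule L2_bound[where g = "\<lambda>x. 2 * (norm (\<phi> x))\<^sup>2 + 2 * (norm (\<psi> x))\<^sup>2"])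
  fix x
  have "(norm (\<phi> x + \<psi> x))\<^sup>2 \<le> (norm (\<phi> x) + norm (\<psi> x))\<^sup>2"
    by (intro power_mono norm_triangle_ineq) simp
  also have "\<dots> \<le> 2 * (norm (\<phi> x))\<^sup>2 + 2 * (norm (\<psi> x))\<^sup>2"
    using sum_squares_bound[of "norm (\<phi> x)" "norm (\<psi> x)"] by (simp add: power2_sum)
  finally show "(norm (\<phi> x + \<psi> x))\<^sup>2 \<le> 2 * (norm (\<phi> x))\<^sup>2 + 2 * (norm (\<psi> x))\<^sup>2" .
next
  note [measurable] = L2_D(1)[OF assms(1)] L2_D(1)[OF assms(2)]
  show "(\<lambda>x. \<phi> x + \<psi> x) \<in> borel_measurable borel" by measurable
qed (use assms in \<open>auto simp: L2_D\<close>)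

lemma L2_zero: "(\<lambda>x. 0) \<in> L2"
  by (simp add: L2_def)

lemma L2_sum: "(\<And>i. i \<in> A \<Longrightarrow> f i \<in> L2) \<Longrightarrow> (\<lambda>x. \<Sum>i\<in>A. f i x) \<in> L2"
  by (induction A rule: infinite_finite_induct) (auto simp: L2_zero intro: L2_add)

lemma L2_diff: "\<phi> \<in> L2 \<Longrightarrow> \<psi> \<in> L2 \<Longrightarrow> (\<lambda>x. \<phi> x - \<psi> x) \<in> L2"
  using L2_add[of \<phi> "\<lambda>x. \<psi> x * (- 1)"] L2_mult_right[of \<psi> "- 1"] by simp

lemma L2_norm_square: "(L2_norm \<phi>)\<^sup>2 = (LINT x|lborel. (norm (\<phi> x))\<^sup>2)"
  by (simp add: L2_norm_def)

lemma L2_norm_nonneg: "L2_norm \<phi> \<ge> 0"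
  by (simp add: L2_norm_def)

lemma L2_norm_normalized_hermite: "L2_norm (normalized_hermite k) = 1"
proof -
  have "(LINT x|lborel. (norm (normalized_hermite k x))\<^sup>2)
      = (LINT x|lborel. hermite_fun k x * hermite_fun k x / (hermite_norm k)\<^sup>2)"
    by (simp add: normalized_hermite_eq power_divide power2_eq_square del: of_real_divide)
  also have "\<dots> = 1"
    using hermite_norm_pos[of k] unfolding integral_divide_zero hermite_fun_orthogonal
    by (simp add: hermite_norm_def)
  finally show ?thesis by (simp add: L2_norm_def)
qed

lemma L2_Cauchy_Schwarz:
  assumes "\<phi> \<in> L2" "\<psi> \<in> L2"
  shows "integrable lborel (\<lambda>x. norm (\<psi> x) * norm (\<phi> x))"
    and "(LINT x|lborel. norm (\<psi> x) * norm (\<phi> x)) \<le> L2_norm \<phi> * L2_norm \<psi>"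
proof -
  note [measurable] = L2_D(1)[OF assms(1)] L2_D(1)[OF assms(2)]
  show int: "integrable lborel (\<lambda>x. norm (\<psi> x) * norm (\<phi> x))"
  proof (rule Bochner_Integration.integrable_bound)
    show "integrable lborel (\<lambda>x. (norm (\<psi> x))\<^sup>2 + (norm (\<phi> x))\<^sup>2)"
      using assms by (simp add: L2_D)
    have "norm (\<psi> x) * norm (\<phi> x) \<le> (norm (\<psi> x))\<^sup>2 + (norm (\<phi> x))\<^sup>2" for x
    proof -
      have "2 * (norm (\<psi> x) * norm (\<phi> x)) \<le> (norm (\<psi> x))\<^sup>2 + (norm (\<phi> x))\<^sup>2"
        using sum_squares_bound[of "norm (\<psi> x)" "norm (\<phi> x)"] by (simp only: mult.assoc)
      moreover have "0 \<le> norm (\<psi> x) * norm (\<phi> x)" by simp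
      ultimately show ?thesis by linarith
    qed
    then show "AE x in lborel. norm (norm (\<psi> x) * norm (\<phi> x)) \<le> norm ((norm (\<psi> x))\<^sup>2 + (norm (\<phi> x))\<^sup>2)"
      by simp
  qed simp
  let ?I = "LINT x|lborel. norm (\<psi> x) * norm (\<phi> x)"
  have sq: "(\<integral>\<^sup>+x. ennreal (norm (\<phi> x)) ^ 2 \<partial>lborel) = ennreal ((L2_norm \<phi>)\<^sup>2)" if "\<phi> \<in> L2" for \<phi>
    unfolding L2_norm_square ennreal_power[OF norm_ge_zero]
    by (rule nn_integral_eq_integral) (use that in \<open>auto simp: L2_D\<close>)
  have "ennreal ?I = (\<integral>\<^sup>+x. ennreal (norm (\<psi> x)) * ennreal (norm (\<phi> x)) \<partial>lborel)"
    unfolding ennreal_mult'[OF norm_ge_zero, symmetric]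
    by (rule nn_integral_eq_integral[symmetric]) (use int in auto)
  then have "(ennreal ?I)\<^sup>2 \<le> ennreal ((L2_norm \<psi>)\<^sup>2) * ennreal ((L2_norm \<phi>)\<^sup>2)"
    using Cauchy_Schwarz_nn_integral[of "\<lambda>x. ennreal (norm (\<psi> x))" lborel "\<lambda>x. ennreal (norm (\<phi> x))"]
    by (simp add: sq assms)
  then have "?I\<^sup>2 \<le> (L2_norm \<psi>)\<^sup>2 * (L2_norm \<phi>)\<^sup>2"
    by (simp add: ennreal_power ennreal_mult'[symmetric])
  then have "?I\<^sup>2 \<le> (L2_norm \<phi> * L2_norm \<psi>)\<^sup>2" by (simp only: power_mult_distrib mult.commute)
  then show "?I \<le> L2_norm \<phi> * L2_norm \<psi>"
    by (rule power2_le_imp_le) (intro mult_nonneg_nonneg L2_norm_nonneg)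
qed

lemma L2_inner_integrable:
  assumes "\<phi> \<in> L2" "\<psi> \<in> L2"
  shows "integrable lborel (\<lambda>x. qcnj (\<psi> x) * \<phi> x)"
proof (rule Bochner_Integration.integrable_bound[OF L2_Cauchy_Schwarz(1)[OF assms]])
  have "qcnj \<in> borel_measurable borel"
    by (intro borel_measurable_continuous_onI linear_continuous_on bounded_linear_qcnj)
  from measurable_compose[OF L2_D(1)[OF assms(2)] this] L2_D(1)[OF assms(1)]
  show "(\<lambda>x. qcnj (\<psi> x) * \<phi> x) \<in> borel_measurable lborel" by measurable
qed (simp add: norm_mult)

lemma L2_inner_bound:
  assumes "\<phi> \<in> L2" "\<psi> \<in> L2"
  shows "norm (L2_inner \<phi> \<psi>) \<le> L2_norm \<phi> * L2_norm \<psi>"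
proof -
  have "norm (L2_inner \<phi> \<psi>) \<le> (LINT x|lborel. norm (qcnj (\<psi> x) * \<phi> x))"
    unfolding L2_inner_def by (rule integral_norm_bound)
  also have "\<dots> \<le> L2_norm \<phi> * L2_norm \<psi>"
    using L2_Cauchy_Schwarz(2)[OF assms] by (simp add: norm_mult)
  finally show ?thesis .
qed

lemma L2_inner_diff_left:
  "\<phi> \<in> L2 \<Longrightarrow> \<phi>' \<in> L2 \<Longrightarrow> \<psi> \<in> L2 \<Longrightarrow> L2_inner (\<lambda>x. \<phi> x - \<phi>' x) \<psi> = L2_inner \<phi> \<psi> - L2_inner \<phi>' \<psi>"
  unfolding L2_inner_def right_diff_distrib
  by (rule Bochner_Integration.integral_diff) (rule L2_inner_integrable; assumption)+

lemma L2_inner_diff_right: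
  "\<phi> \<in> L2 \<Longrightarrow> \<phi>' \<in> L2 \<Longrightarrow> \<psi> \<in> L2 \<Longrightarrow> L2_inner \<phi> (\<lambda>x. \<psi> x - \<phi>' x) = L2_inner \<phi> \<psi> - L2_inner \<phi> \<phi>'"
  unfolding L2_inner_def left_diff_distrib qcnj_simps
  by (rule Bochner_Integration.integral_diff) (rule L2_inner_integrable; assumption)+

lemma L2_inner_self: "\<phi> \<in> L2 \<Longrightarrow> L2_inner \<phi> \<phi> = of_real ((L2_norm \<phi>)\<^sup>2)"
  unfolding L2_inner_def qcnj_mult_self L2_norm_square of_real_def
  by (rule integral_scaleR_left) (rule L2_D(2))

section \<open>Hermite coefficients and Parseval's identity\<close>

definition hermite_coeff :: "(real \<Rightarrow> quat) \<Rightarrow> nat \<Rightarrow> quat" where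
  "hermite_coeff \<phi> k = L2_inner \<phi> (normalized_hermite k)"

lemma norm_hermite_coeff_le: "\<phi> \<in> L2 \<Longrightarrow> norm (hermite_coeff \<phi> k) \<le> L2_norm \<phi>"
  using L2_inner_bound[OF _ L2_normalized_hermite, of \<phi> k]
  by (simp add: hermite_coeff_def L2_norm_normalized_hermite)

lemma hermite_coeff_sum:
  assumes "finite A"
  shows "hermite_coeff (\<lambda>x. \<Sum>j\<in>A. normalized_hermite j x * a j) k = (if k \<in> A then a k else 0)"
proof -
  have "hermite_coeff (\<lambda>x. \<Sum>j\<in>A. normalized_hermite j x * a j) k
      = (LINT x|lborel. (\<Sum>j\<in>A. (hermite_fun j x * hermite_fun k x / (hermite_norm j * hermite_norm k)) *\<^sub>R a j))"
    unfolding hermite_coeff_def L2_inner_def normalized_hermite_eq sum_distrib_left qcnj_simps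
    by (simp only: scaleR_conv_of_real[symmetric] mult_scaleR_left scaleR_scaleR) (simp add: mult_ac)
  also have "\<dots> = (\<Sum>j\<in>A. (LINT x|lborel. hermite_fun j x * hermite_fun k x / (hermite_norm j * hermite_norm k)) *\<^sub>R a j)"
    using hermite_fun_mult_integrable
    by (subst Bochner_Integration.integral_sum) (auto intro!: integrable_scaleR_left integrable_divide)
  also have "\<dots> = (\<Sum>j\<in>A. if k = j then a j else 0)"
  proof (intro sum.cong refl)
    fix j
    have hn: "(4 * pi) ^ k * fact k / sqrt 2 = hermite_norm k * hermite_norm k"
      by (simp add: hermite_norm_def flip: power2_eq_square)
    show "(LINT x|lborel. hermite_fun j x * hermite_fun k x / (hermite_norm j * hermite_norm k)) *\<^sub>R a j
        = (if k = j then a j else 0)"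
      unfolding integral_divide_zero hermite_fun_orthogonal hn using hermite_norm_pos[of k] by auto
  qed
  finally show ?thesis using assms by (simp add: sum.delta)
qed

lemma L2_hermite_sum: "(\<lambda>x. \<Sum>j\<in>A. normalized_hermite j x * a j) \<in> L2"
  by (intro L2_sum L2_mult_right L2_normalized_hermite)

text \<open>Taking a Hermite coefficient is continuous for the \<open>L2\<close> norm and eventually
  constant along the partial sums, so the coefficients in the definition of the space are the
  Hermite coefficients. Those below \<open>n + 2\<close> vanish, and the sums may start at
  \<open>0\<close>.\<close>

lemma hermite_space_coeffs:
  assumes "\<phi> \<in> hermite_space n"
  shows "\<phi> \<in> L2" and "k < n + 2 \<Longrightarrow> hermite_coeff \<phi> k = 0"
    and "(\<lambda>N. L2_norm (\<lambda>x. \<phi> x - (\<Sum>k<N. normalized_hermite k x * hermite_coeff \<phi> k))) \<longlonglongrightarrow> 0"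
proof -
  show \<phi>: "\<phi> \<in> L2" using assms by (simp add: hermite_space_def)
  obtain a where a: "(\<lambda>N. L2_norm (\<lambda>x. \<phi> x - (\<Sum>k\<in>{n+2..<N}. normalized_hermite k x * a k))) \<longlonglongrightarrow> 0"
    using assms by (auto simp: hermite_space_def)
  have c: "hermite_coeff \<phi> k = (if n + 2 \<le> k then a k else 0)" for k
  proof -
    define S where "S N x = (\<Sum>j\<in>{n+2..<N}. normalized_hermite j x * a j)" for N x
    have S: "S N \<in> L2" for N unfolding S_def by (rule L2_hermite_sum)
    have "norm (hermite_coeff \<phi> k - hermite_coeff (S N) k) \<le> L2_norm (\<lambda>x. \<phi> x - S N x)" for N
      using L2_inner_bound[OF L2_diff[OF \<phi> S] L2_normalized_hermite, of N k]
      by (simp add: hermite_coeff_def L2_inner_diff_left[OF \<phi> S L2_normalized_hermite] L2_norm_normalized_hermite)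
    then have "(\<lambda>N. hermite_coeff \<phi> k - hermite_coeff (S N) k) \<longlonglongrightarrow> 0"
      by (intro Lim_null_comparison[OF always_eventually a[folded S_def]]) simp
    moreover have "\<forall>\<^sub>F N in sequentially. hermite_coeff \<phi> k - hermite_coeff (S N) k
        = hermite_coeff \<phi> k - (if n + 2 \<le> k then a k else 0)"
      using eventually_gt_at_top[of k]
      by eventually_elim (simp add: S_def[abs_def] hermite_coeff_sum)
    ultimately have "(\<lambda>N. hermite_coeff \<phi> k - (if n + 2 \<le> k then a k else 0)) \<longlonglongrightarrow> 0"
      by (rule Lim_transform_eventually)
    then show ?thesis by (simp add: tendsto_const_iff)
  qed
  then show "k < n + 2 \<Longrightarrow> hermite_coeff \<phi> k = 0" by simp
  have "(\<Sum>k<N. normalized_hermite k x * hermite_coeff \<phi> k) = (\<Sum>k\<in>{n+2..<N}. normalized_hermite k x * a k)" for N x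
    by (rule sum.mono_neutral_cong_right) (auto simp: c)
  then show "(\<lambda>N. L2_norm (\<lambda>x. \<phi> x - (\<Sum>k<N. normalized_hermite k x * hermite_coeff \<phi> k))) \<longlonglongrightarrow> 0"
    using a by simp
qed

text \<open>Membership of \<psi> provides norm convergence of its Hermite expansion, which
  Cauchy-Schwarz carries over to the inner product with \<phi>.\<close>

lemma hermite_space_Parseval:
  assumes "\<phi> \<in> L2" "\<psi> \<in> hermite_space n"
  shows "(\<lambda>k. qcnj (hermite_coeff \<psi> k) * hermite_coeff \<phi> k) sums L2_inner \<phi> \<psi>"
proof -
  note \<psi> = hermite_space_coeffs[OF assms(2)]
  define S where "S N x = (\<Sum>j<N. normalized_hermite j x * hermite_coeff \<psi> j)" for N x
  have S: "S N \<in> L2" for N unfolding S_def by (rule L2_hermite_sum)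
  have eq: "L2_inner \<phi> (S N) = (\<Sum>k<N. qcnj (hermite_coeff \<psi> k) * hermite_coeff \<phi> k)" for N
  proof -
    have q: "qcnj (S N x) * \<phi> x
        = (\<Sum>k<N. qcnj (hermite_coeff \<psi> k) * (qcnj (normalized_hermite k x) * \<phi> x))" for x
    proof -
      \<comment> \<open>Conjugation reverses products, so the coefficient moves to the left, where
        it can leave the integral.\<close>
      have "qcnj (S N x) = (\<Sum>k<N. qcnj (hermite_coeff \<psi> k) * qcnj (normalized_hermite k x))"
        unfolding S_def linear_sum[OF bounded_linear.linear[OF bounded_linear_qcnj]] qcnj_mult ..
      then show ?thesis by (simp add: sum_distrib_right mult.assoc)
    qed
    show ?thesis
      unfolding L2_inner_def q hermite_coeff_def[of \<phi>]
      by (subst Bochner_Integration.integral_sum)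
        (intro integrable_mult_right L2_inner_integrable assms L2_normalized_hermite
          Bochner_Integration.integral_mult_right sum.cong refl)+
  qed
  have bd: "norm (L2_inner \<phi> \<psi> - L2_inner \<phi> (S N)) \<le> L2_norm \<phi> * L2_norm (\<lambda>x. \<psi> x - S N x)" for N
    using L2_inner_bound[OF assms(1) L2_diff[OF \<psi>(1) S]]
    by (simp add: L2_inner_diff_right[OF assms(1) S \<psi>(1)])
  have "(\<lambda>N. L2_norm (\<lambda>x. \<psi> x - S N x)) \<longlonglongrightarrow> 0"
    using \<psi>(3) unfolding S_def .
  from tendsto_mult_left[OF this, of "L2_norm \<phi>"]
  have "(\<lambda>N. L2_norm \<phi> * L2_norm (\<lambda>x. \<psi> x - S N x)) \<longlonglongrightarrow> 0" by simp
  then have "(\<lambda>N. L2_inner \<phi> \<psi> - L2_inner \<phi> (S N)) \<longlonglongrightarrow> 0"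
    by (rule Lim_null_comparison[OF always_eventually[OF allI[OF bd]]])
  then have "(\<lambda>N. L2_inner \<phi> \<psi> - (L2_inner \<phi> \<psi> - L2_inner \<phi> (S N))) \<longlonglongrightarrow> L2_inner \<phi> \<psi> - 0"
    by (rule tendsto_diff[OF tendsto_const])
  then show ?thesis unfolding sums_def eq by simp
qed

section \<open>Power series of the Bargmann transform\<close>

definition bargmann_weight :: "nat \<Rightarrow> real" where
  "bargmann_weight k = sqrt 2 * sqrt (2 * pi) ^ k / sqrt (fact k)"

text \<open>The left side collects the prefactor of the transform, the norm of the Hermite function
  and the denominator of the generating function; \<open>2 powr (3/4)\<close> against
  \<open>sqrt (sqrt 2)\<close> leaves \<open>sqrt 2\<close>.\<close>

lemma bargmann_weight_eq:
  "2 powr (3/4) * (hermite_norm k / (sqrt 2 ^ k * fact k)) = bargmann_weight k"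
proof -
  have h: "hermite_norm k = sqrt (4 * pi) ^ k * sqrt (fact k) / sqrt (sqrt 2)"
    by (simp add: hermite_norm_def real_sqrt_divide real_sqrt_mult real_sqrt_power)
  have s4: "sqrt (4 * pi) ^ k = sqrt 2 ^ k * sqrt (2 * pi) ^ k"
  proof -
    have "sqrt (4 * pi) = sqrt 2 * sqrt (2 * pi)" by (simp only: real_sqrt_mult[symmetric]) simp
    then show ?thesis by (simp only: power_mult_distrib)
  qed
  have p: "2 powr (3/4) / sqrt (sqrt 2) = sqrt 2"
  proof -
    have "sqrt (sqrt 2) = 2 powr (1/4)" using powr_powr[of 2 "1/2" "1/2"] by (simp add: powr_half_sqrt)
    then have "2 powr (3/4) / sqrt (sqrt 2) = 2 powr (3/4 - 1/4)" by (simp only: powr_diff)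
    then show ?thesis by (simp add: powr_half_sqrt)
  qed
  have "2 powr (3/4) * (hermite_norm k / (sqrt 2 ^ k * fact k))
      = (2 powr (3/4) / sqrt (sqrt 2)) * ((sqrt 2 ^ k * sqrt (2 * pi) ^ k) * sqrt (fact k) / (sqrt 2 ^ k * fact k))"
    by (simp only: h s4) (simp only: times_divide_eq_right times_divide_eq_left divide_divide_eq_left mult_ac)
  also have "(sqrt 2 ^ k * sqrt (2 * pi) ^ k) * sqrt (fact k) / (sqrt 2 ^ k * fact k) = sqrt (2 * pi) ^ k / sqrt (fact k)"
  proof -
    have "(a * b) * s / (a * s\<^sup>2) = b / s" if "a > 0" "s > 0" for a b s :: real
      using that by (simp add: power2_eq_square)
    from this[of "sqrt 2 ^ k" "sqrt (fact k)" "sqrt (2 * pi) ^ k"] show ?thesis by simp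
  qed
  also note p
  finally show ?thesis by (simp add: bargmann_weight_def)
qed

text \<open>The square root of the factorial is removed by writing the term, up to
  \<open>sqrt 2\<close>, as \<open>u * (1/2) ^ k\<close> and bounding this product by the sum of the
  squares: \<open>u\<^sup>2\<close> gives an exponential series in \<open>y\<close>, the other
  square a geometric one.\<close>

lemma bargmann_weight_summable: "summable (\<lambda>k. bargmann_weight k * r ^ k)"
proof (rule summable_comparison_test')
  define y where "y = 4 * (2 * pi * r\<^sup>2)"
  show "summable (\<lambda>k. sqrt 2 * (y ^ k /\<^sub>R fact k + (1/4) ^ k))"
    by (intro summable_mult summable_add summable_exp_generic summable_geometric) simp
  fix k :: nat
  have u: "(sqrt (2 * pi) ^ k * \<bar>r\<bar> ^ k / sqrt (fact k) * 2 ^ k)\<^sup>2 = y ^ k / fact k"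
  proof -
    have "(sqrt (2 * pi) ^ k * \<bar>r\<bar> ^ k * 2 ^ k)\<^sup>2 = ((sqrt (2 * pi) * \<bar>r\<bar> * 2)\<^sup>2) ^ k"
      by (simp only: power_mult_distrib power_mult[symmetric] mult.commute)
    also have "(sqrt (2 * pi) * \<bar>r\<bar> * 2)\<^sup>2 = y" by (simp add: y_def power_mult_distrib)
    finally show ?thesis by (simp add: power_divide power_mult_distrib)
  qed
  have "norm (bargmann_weight k * r ^ k) = sqrt 2 * ((sqrt (2 * pi) ^ k * \<bar>r\<bar> ^ k / sqrt (fact k) * 2 ^ k) * (1/2) ^ k)"
    by (simp add: bargmann_weight_def abs_mult power_abs power_one_over)
  also have "\<dots> \<le> sqrt 2 * (y ^ k / fact k + ((1/2) ^ k)\<^sup>2)"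
  proof (rule mult_left_mono)
    let ?a = "sqrt (2 * pi) ^ k * \<bar>r\<bar> ^ k / sqrt (fact k) * 2 ^ k" and ?b = "(1/2 :: real) ^ k"
    have "?a * ?b \<ge> 0" by simp
    then show "?a * ?b \<le> y ^ k / fact k + ?b\<^sup>2"
      using sum_squares_bound[of ?a ?b] unfolding u by linarith
  qed simp
  also have "((1/2 :: real) ^ k)\<^sup>2 = (1/4) ^ k"
    by (simp add: power_one_over flip: power_mult) (simp add: power_mult mult.commute[of k])
  finally show "norm (bargmann_weight k * r ^ k) \<le> sqrt 2 * (y ^ k /\<^sub>R fact k + (1/4) ^ k)"
    by (simp only: real_scaleR_def divide_inverse mult.commute[of "y ^ k"])
qed

lemma bargmann_weight_pos: "bargmann_weight k > 0"
  by (simp add: bargmann_weight_def)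

lemma entire_bargmann_coeffs:
  assumes "\<phi> \<in> L2"
  shows "entire (\<lambda>k. bargmann_weight k *\<^sub>R hermite_coeff \<phi> k)"
  unfolding entire_def
proof
  fix R :: real
  show "summable (\<lambda>k. norm (bargmann_weight k *\<^sub>R hermite_coeff \<phi> k) * R ^ k)"
  proof (rule summable_comparison_test')
    show "summable (\<lambda>k. L2_norm \<phi> * (bargmann_weight k * \<bar>R\<bar> ^ k))"
      by (intro summable_mult bargmann_weight_summable)
    fix k :: nat
    show "norm (norm (bargmann_weight k *\<^sub>R hermite_coeff \<phi> k) * R ^ k) \<le> L2_norm \<phi> * (bargmann_weight k * \<bar>R\<bar> ^ k)"
    proof -
      have "norm (norm (bargmann_weight k *\<^sub>R hermite_coeff \<phi> k) * R ^ k)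
          = norm (hermite_coeff \<phi> k) * (bargmann_weight k * \<bar>R\<bar> ^ k)"
        using bargmann_weight_pos[of k] by (simp add: abs_mult power_abs)
      also have "\<dots> \<le> L2_norm \<phi> * (bargmann_weight k * \<bar>R\<bar> ^ k)"
        using bargmann_weight_pos[of k] by (intro mult_right_mono norm_hermite_coeff_le assms) auto
      finally show ?thesis .
    qed
  qed
qed

text \<open>The kernel series may be integrated termwise, since Cauchy-Schwarz bounds the integral
  of \<open>norm (f k x)\<close> by \<open>d k * norm q ^ k * L2_norm \<phi>\<close>, which is
  summable.\<close>

lemma bargmann_eq_qseries:
  assumes \<phi>: "\<phi> \<in> L2"
  shows "bargmann \<phi> q = qseries (\<lambda>k. bargmann_weight k *\<^sub>R hermite_coeff \<phi> k) q"
proof -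
  define d where "d k = hermite_norm k / (sqrt 2 ^ k * fact k)" for k
  define f where "f k x = (d k *\<^sub>R q ^ k) * (qcnj (normalized_hermite k x) * \<phi> x)" for k x
  have d: "d k > 0" for k by (simp add: d_def hermite_norm_pos)
  \<comment> \<open>One form of \<open>f\<close> is suited to integration, producing Hermite
    coefficients; this other form is suited to summation, producing the kernel.\<close>
  have f: "f k x = ((hermite_fun k x / (sqrt 2 ^ k * fact k)) *\<^sub>R q ^ k) * \<phi> x" for k x
    using hermite_norm_pos[of k]
    unfolding f_def normalized_hermite_eq qcnj_simps
    by (simp only: scaleR_conv_of_real[symmetric]) (simp add: d_def)
  have fi: "integrable lborel (f k)" for k
    unfolding f_def by (intro integrable_mult_right L2_inner_integrable \<phi> L2_normalized_hermite)
  have fn: "norm (f k x) = d k * norm q ^ k * (norm (normalized_hermite k x) * norm (\<phi> x))" for k x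
    using d[of k] by (simp add: f_def norm_mult norm_power)
  have fb: "(LINT x|lborel. norm (f k x)) \<le> (d k * norm q ^ k) * L2_norm \<phi>" for k
    unfolding fn integral_mult_right_zero
    using L2_Cauchy_Schwarz(2)[OF \<phi> L2_normalized_hermite[of k]] d[of k]
    by (intro mult_left_mono) (auto simp: L2_norm_normalized_hermite)
  have ds: "summable (\<lambda>k. d k * norm q ^ k)"
  proof -
    have "summable (\<lambda>k. inverse (2 powr (3/4)) * (bargmann_weight k * norm q ^ k))"
      by (intro summable_mult bargmann_weight_summable)
    moreover have "inverse (2 powr (3/4)) * (bargmann_weight k * norm q ^ k) = d k * norm q ^ k" for k
      unfolding bargmann_weight_eq[symmetric] d_def[symmetric] by simp
    ultimately show ?thesis by simp
  qed
  have sums: "(\<lambda>k. integral\<^sup>L lborel (f k)) sums (LINT x|lborel. (\<Sum>k. f k x))"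
  proof (rule sums_integral[OF fi])
    have "summable (\<lambda>k. norm (f k x))" for x
    proof -
      have "norm (f k x) = \<bar>hermite_fun k x\<bar> / (sqrt 2 ^ k * fact k) * norm q ^ k * norm (\<phi> x)" for k
        unfolding f by (simp add: norm_mult norm_power)
      then show ?thesis using summable_mult2[OF bargmann_kernel_abs_summable[of "norm q" x], of "norm (\<phi> x)"] by simp
    qed
    then show "AE x in lborel. summable (\<lambda>k. norm (f k x))" by simp
    show "summable (\<lambda>k. LINT x|lborel. norm (f k x))"
      by (rule summable_comparison_test'[OF summable_mult2[OF ds, of "L2_norm \<phi>"]])
        (use fb in simp)
  qed
  have I: "integral\<^sup>L lborel (f k) = q ^ k * (d k *\<^sub>R hermite_coeff \<phi> k)" for k
    unfolding f_def hermite_coeff_def L2_inner_def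
    by (subst Bochner_Integration.integral_mult_right)
      (auto intro!: L2_inner_integrable \<phi> L2_normalized_hermite)
  have "(\<Sum>k. f k x) = exp (- (of_real pi * (q\<^sup>2 + of_real (x\<^sup>2))) + of_real (2 * pi * sqrt 2) * q * of_real x) * \<phi> x" for x
    unfolding f by (rule sums_unique[symmetric]) (intro sums_mult2 bargmann_kernel_sums)
  then have "bargmann \<phi> q = 2 powr (3/4) *\<^sub>R (\<Sum>k. q ^ k * (d k *\<^sub>R hermite_coeff \<phi> k))"
    using sums_unique[OF sums] unfolding I bargmann_def by (simp add: scaleR_conv_of_real)
  also have "\<dots> = (\<Sum>k. 2 powr (3/4) *\<^sub>R (q ^ k * (d k *\<^sub>R hermite_coeff \<phi> k)))"
    using sums_summable[OF sums] unfolding I by (rule suminf_scaleR_right)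
  also have "\<dots> = qseries (\<lambda>k. bargmann_weight k *\<^sub>R hermite_coeff \<phi> k) q"
    unfolding qseries_def bargmann_weight_eq[symmetric] d_def by (simp add: mult.assoc)
  finally show ?thesis .
qed

section \<open>The Fueter--Bargmann transform\<close>

text \<open>Prefactor of the transform times the factor of term \<open>j\<close> in
  \<open>slice_deriv_gauss_pow\<close>. The binomial makes it vanish for \<open>j > n\<close>, as
  the convention in \<open>poly_components\<close> demands.\<close>

definition QTP_weight :: "nat \<Rightarrow> nat \<Rightarrow> real" where
  "QTP_weight n j = (-1) ^ n * sqrt (1 / ((2 * pi) ^ n * fact n)) * (real (n choose j) * (- 2 * pi) ^ j)"

definition bargmann_coeff :: "(real \<Rightarrow> quat) \<Rightarrow> nat \<Rightarrow> quat" where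
  "bargmann_coeff \<phi> k = bargmann_weight k *\<^sub>R hermite_coeff \<phi> k"

definition QTP_component :: "nat \<Rightarrow> (real \<Rightarrow> quat) \<Rightarrow> nat \<Rightarrow> quat \<Rightarrow> quat" where
  "QTP_component n \<phi> j = qseries (\<lambda>m. QTP_weight n j *\<^sub>R (dcoef ^^ (n - j)) (bargmann_coeff \<phi>) m)"

lemma entire_bargmann_coeff: "\<phi> \<in> L2 \<Longrightarrow> entire (bargmann_coeff \<phi>)"
  using entire_bargmann_coeffs by (simp add: bargmann_coeff_def[abs_def])

lemma QTP_bargmann_eq:
  assumes "\<phi> \<in> L2"
  shows "QTP_bargmann n \<phi> q = (\<Sum>j\<le>n. qcnj q ^ j * QTP_component n \<phi> j q)"
proof -
  note g = entire_bargmann_coeff[OF assms]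
  define K where "K = (-1) ^ n * sqrt (1 / ((2 * pi) ^ n * fact n))"
  have b: "bargmann \<phi> = qseries (bargmann_coeff \<phi>)"
    using bargmann_eq_qseries[OF assms] by (simp add: fun_eq_iff bargmann_coeff_def[abs_def])
  have e: "exp (2 * pi * (norm q)\<^sup>2) * exp (- 2 * pi * (norm q)\<^sup>2) = 1"
    unfolding exp_add[symmetric] by simp
  have "QTP_bargmann n \<phi> q = (K * exp (2 * pi * (norm q)\<^sup>2)) *\<^sub>R
     (\<partial>\<^sub>s ^^ n) (\<lambda>q. exp (- 2 * pi * (norm q)\<^sup>2) *\<^sub>R qseries (bargmann_coeff \<phi>) q) q"
    unfolding QTP_bargmann_def b K_def by (simp only: scaleR_conv_of_real)
  also have "\<dots> = (K * (exp (2 * pi * (norm q)\<^sup>2) * exp (- 2 * pi * (norm q)\<^sup>2))) *\<^sub>R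
     (\<Sum>j\<le>n. (real (n choose j) * (- 2 * pi) ^ j) *\<^sub>R
       (qcnj q ^ j * qseries ((dcoef ^^ (n - j)) (bargmann_coeff \<phi>)) q))"
    unfolding slice_deriv_gauss_pow[OF g] scaleR_scaleR by (simp only: mult.assoc)
  also have "\<dots> = (\<Sum>j\<le>n. qcnj q ^ j * QTP_component n \<phi> j q)"
    unfolding e QTP_component_def qseries_scaleR[OF entire_dcoef_pow[OF g]] scaleR_right.sum mult_1_right
    by (intro sum.cong refl) (simp add: QTP_weight_def K_def)
  finally show ?thesis .
qed

lemma entire_QTP_component:
  "\<phi> \<in> L2 \<Longrightarrow> entire (\<lambda>m. QTP_weight n j *\<^sub>R (dcoef ^^ (n - j)) (bargmann_coeff \<phi>) m)"
  by (intro entire_scaleR entire_dcoef_pow entire_bargmann_coeff)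

lemma poly_components_QTP_bargmann:
  assumes "\<phi> \<in> L2"
  shows "poly_components n (QTP_bargmann n \<phi>) = QTP_component n \<phi>"
proof (rule poly_components_eqI)
  show "slice_hyperholomorphic (QTP_component n \<phi> k)" for k
    unfolding QTP_component_def by (intro slice_hyperholomorphic_qseries entire_QTP_component assms)
  show "QTP_component n \<phi> k = (\<lambda>_. 0)" if "k > n" for k
    using that by (simp add: QTP_component_def QTP_weight_def qseries_def[abs_def] binomial_eq_0)
qed (rule QTP_bargmann_eq[OF assms])

text \<open>The \<open>s\<close> derivatives and the Laplacian lower the index from
  \<open>h + n + 2\<close> to \<open>h + n - s\<close>, which accounts for the quotient of
  factorials; the factor \<open>- 2\<close> is that of the Laplacian of a power.\<close>

definition fueter_weight :: "nat \<Rightarrow> nat \<Rightarrow> nat \<Rightarrow> real" where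
  "fueter_weight n h s = - (2 * QTP_weight n (n - s) * fact (h + n + 2) / fact (h + n - s)) * bargmann_weight (h + n + 2)"

lemma laplacian_QTP_component:
  assumes \<phi>: "\<phi> \<in> L2" and z: "\<And>k. k < n + 2 \<Longrightarrow> hermite_coeff \<phi> k = 0" and s: "s \<le> n"
  shows "(\<lambda>h. Q_poly (h + n - s) q * (fueter_weight n h s *\<^sub>R hermite_coeff \<phi> (h + n + 2))) sums
    laplacian (QTP_component n \<phi> (n - s)) q"
proof -
  define F where "F m = - (2 * real (Suc m) * real (Suc (Suc m))) *\<^sub>R (Q_poly m q *
     (QTP_weight n (n - s) *\<^sub>R (dcoef ^^ s) (bargmann_coeff \<phi>) (Suc (Suc m))))" for m
  have "F sums laplacian (QTP_component n \<phi> (n - s)) q"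
    using laplacian_qseries[OF entire_QTP_component[OF \<phi>, of n "n - s"], of q] s
    unfolding QTP_component_def F_def by simp
  \<comment> \<open>\<open>F m\<close> involves the Hermite coefficient of index
    \<open>m + 2 + s\<close>, which is below \<open>n + 2\<close> exactly when
    \<open>m < n - s\<close>; so the series begins at the index that the expansion requires.\<close>
  moreover have "F m = 0" if "m < n - s" for m
    using that by (simp add: F_def dcoef_pow bargmann_coeff_def z)
  ultimately have "(\<lambda>h. F (h + (n - s))) sums laplacian (QTP_component n \<phi> (n - s)) q"
    by (subst sums_zero_iff_shift)
  moreover have "F (h + (n - s)) = Q_poly (h + n - s) q * (fueter_weight n h s *\<^sub>R hermite_coeff \<phi> (h + n + 2))" for h
  proof -
    define m where "m = h + n - s"
    have m: "h + (n - s) = m" "Suc (Suc m) + s = h + n + 2" using s by (auto simp: m_def)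
    have "fact (Suc (Suc m)) = real (Suc m) * real (Suc (Suc m)) * (fact m :: real)"
      by (simp add: algebra_simps)
    then have "- (2 * real (Suc m) * real (Suc (Suc m))) * QTP_weight n (n - s)
        * (fact (h + n + 2) / fact (Suc (Suc m))) * bargmann_weight (h + n + 2) = fueter_weight n h s"
      by (simp add: fueter_weight_def m_def[symmetric] del: of_nat_Suc)
    then show ?thesis
      unfolding F_def m dcoef_pow bargmann_coeff_def m_def[symmetric] mult_scaleR_right scaleR_scaleR
      by (simp only: mult.assoc)
  qed
  ultimately show ?thesis by simp
qed

lemma A_coeffs_fueter_bargmann:
  assumes \<phi>: "\<phi> \<in> L2" and z: "\<And>k. k < n + 2 \<Longrightarrow> hermite_coeff \<phi> k = 0"
  shows "A_coeffs n (fueter_bargmann n \<phi>) =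
    (\<lambda>h s. if s \<le> n then fueter_weight n h s *\<^sub>R hermite_coeff \<phi> (h + n + 2) else 0)"
proof (rule A_coeffs_eqI)
  fix q
  have "(\<lambda>h. \<Sum>s\<le>n. of_real (qre q ^ (n - s)) *
       (Q_poly (h + n - s) q * (fueter_weight n h s *\<^sub>R hermite_coeff \<phi> (h + n + 2))))
     sums (\<Sum>s\<le>n. of_real (qre q ^ (n - s)) * laplacian (QTP_component n \<phi> (n - s)) q)"
    by (intro sums_sum sums_mult laplacian_QTP_component \<phi> z) auto
  also have "(\<Sum>s\<le>n. of_real (qre q ^ (n - s)) * laplacian (QTP_component n \<phi> (n - s)) q) = fueter_bargmann n \<phi> q"
    unfolding fueter_bargmann_def fueter_map_def poly_components_QTP_bargmann[OF \<phi>]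
    by (rule sum.reindex_bij_witness[of _ "\<lambda>s. n - s" "\<lambda>s. n - s"]) auto
  finally show "(\<lambda>h. \<Sum>s\<le>n. M_poly (n - s) (h + n - s) q *
      (if s \<le> n then fueter_weight n h s *\<^sub>R hermite_coeff \<phi> (h + n + 2) else 0)) sums fueter_bargmann n \<phi> q"
    by (simp add: M_poly_def mult.assoc del: of_real_power)
qed simp

section \<open>Cancellation of the weights and the inner product\<close>

lemma A_weight_fueter_weight:
  assumes "s \<le> n"
  shows "A_weight n h s * (fueter_weight n h s)\<^sup>2 = 8 * fact n * (2 * pi) ^ n"
proof -
  define N where "N = h + n + 2"
  define p where "p = 2 * pi"
  have p: "p > 0" by (simp add: p_def)
  have A: "A_weight n h s = (fact (h + n - s))\<^sup>2 * (fact s)\<^sup>2 * (fact (n - s))\<^sup>2 * p ^ (2 * s) / (p ^ N * fact N)"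
  proof -
    have "int h + int n + 2 - 2 * int s = int N - int (2 * s)" by (simp add: N_def)
    then have "p powi (int h + int n + 2 - 2 * int s) = p powi (int N - int (2 * s))" by (rule arg_cong)
    also have "\<dots> = p ^ N / p ^ (2 * s)" using p by (simp add: power_int_diff del: of_nat_mult)
    finally show ?thesis unfolding A_weight_def p_def[symmetric] N_def[symmetric] by simp
  qed
  have B: "(bargmann_weight N)\<^sup>2 = 2 * p ^ N / fact N"
    by (simp add: bargmann_weight_def p_def power_divide power_mult_distrib flip: power_mult)
      (simp add: power_mult mult.commute[of N] power_mult_distrib)
  have Q: "(QTP_weight n (n - s))\<^sup>2 = (fact n)\<^sup>2 / ((fact s)\<^sup>2 * (fact (n - s))\<^sup>2) * (p ^ (2 * n) / p ^ (2 * s)) / (p ^ n * fact n)"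
  proof -
    have "real (n choose (n - s)) = fact n / (fact s * fact (n - s))"
      using assms by (simp add: binomial_fact mult.commute)
    moreover have "((- 2 * pi) ^ (n - s))\<^sup>2 = p ^ (2 * n) / p ^ (2 * s)"
    proof -
      have "((- 2 * pi) ^ (n - s))\<^sup>2 = ((- 2 * pi)\<^sup>2) ^ (n - s)"
        by (simp only: power_mult[symmetric] mult.commute)
      also have "(- 2 * pi)\<^sup>2 = p\<^sup>2" by (simp add: p_def)
      finally show ?thesis using p assms by (simp add: power_mult power_diff)
    qed
    moreover have "(((-1) ^ n :: real))\<^sup>2 = 1" by (simp flip: power_mult)
    moreover have "(sqrt (1 / (p ^ n * fact n)))\<^sup>2 = 1 / (p ^ n * fact n)" using p by simp
    ultimately show ?thesis unfolding QTP_weight_def p_def[symmetric] power_mult_distrib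
      by (simp add: power_divide power_mult_distrib)
  qed
  have f: "(fueter_weight n h s)\<^sup>2 = 4 * (QTP_weight n (n - s))\<^sup>2 * (fact N)\<^sup>2 / (fact (h + n - s))\<^sup>2 * (bargmann_weight N)\<^sup>2"
    unfolding fueter_weight_def N_def[symmetric] by (simp add: power_mult_distrib power_divide)
  \<comment> \<open>With factorials and powers of \<open>2 * pi\<close> as independent variables
    everything depending on \<open>h\<close> and \<open>s\<close> cancels. The \<open>8\<close> is
    the squared factor of the Laplacian times the squared \<open>sqrt 2\<close> of
    \<open>bargmann_weight\<close>.\<close>
  have gen: "(a\<^sup>2 * b\<^sup>2 * c\<^sup>2 * r / (P * N)) * (4 * (f\<^sup>2 / (b\<^sup>2 * c\<^sup>2) * (w\<^sup>2 / r) / (w * f)) * N\<^sup>2 / a\<^sup>2 * (2 * P / N))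
      = 8 * f * w" if "a > 0" "b > 0" "c > 0" "r > 0" "P > 0" "N > 0" "f > 0" "w > 0"
    for a b c r P N f w :: real
    using that by (simp add: field_simps power2_eq_square)
  have "p ^ (2 * n) = (p ^ n)\<^sup>2" by (simp add: power_mult[symmetric] mult.commute)
  then show ?thesis
    unfolding A f Q B p_def[symmetric] using p by (simp only:) (rule gen; simp)
qed

theorem proposition4p20:
  fixes n :: nat and \<phi> \<psi> :: "real \<Rightarrow> quat"
  assumes "\<phi> \<in> hermite_space n" and "\<psi> \<in> hermite_space n"
  shows "A_inner n (fueter_bargmann n \<phi>) (fueter_bargmann n \<psi>)
           = of_real (8 * fact (n + 1) * (2 * pi) ^ n) * L2_inner \<phi> \<psi>
       \<and> A_norm n (fueter_bargmann n \<phi>)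
           = 2 * sqrt 2 * sqrt (fact (n + 1)) * (2 * pi) powr (real n / 2) * L2_norm \<phi>"
proof -
  define C where "C = 8 * fact (n + 1) * (2 * pi) ^ n"
  have inner: "A_inner n (fueter_bargmann n \<phi>) (fueter_bargmann n \<psi>) = C *\<^sub>R L2_inner \<phi> \<psi>"
    if "\<phi> \<in> hermite_space n" "\<psi> \<in> hermite_space n" for \<phi> \<psi>
  proof -
    note \<phi> = hermite_space_coeffs(1,2)[OF that(1)] and \<psi> = hermite_space_coeffs(1,2)[OF that(2)]
    have A\<phi>: "A_coeffs n (fueter_bargmann n \<phi>) =
        (\<lambda>h s. if s \<le> n then fueter_weight n h s *\<^sub>R hermite_coeff \<phi> (h + n + 2) else 0)"
      by (rule A_coeffs_fueter_bargmann) (use \<phi> in auto)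
    have A\<psi>: "A_coeffs n (fueter_bargmann n \<psi>) =
        (\<lambda>h s. if s \<le> n then fueter_weight n h s *\<^sub>R hermite_coeff \<psi> (h + n + 2) else 0)"
      by (rule A_coeffs_fueter_bargmann) (use \<psi> in auto)
    let ?P = "\<lambda>k. qcnj (hermite_coeff \<psi> k) * hermite_coeff \<phi> k"
    have "(\<Sum>s\<le>n. of_real (A_weight n h s) *
        (qcnj (A_coeffs n (fueter_bargmann n \<psi>) h s) * A_coeffs n (fueter_bargmann n \<phi>) h s))
      = C *\<^sub>R ?P (h + (n + 2))" for h
    proof -
      have "(\<Sum>s\<le>n. of_real (A_weight n h s) *
          (qcnj (A_coeffs n (fueter_bargmann n \<psi>) h s) * A_coeffs n (fueter_bargmann n \<phi>) h s))
        = (\<Sum>s\<le>n. (A_weight n h s * (fueter_weight n h s)\<^sup>2) *\<^sub>R ?P (h + n + 2))"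
        unfolding A\<phi> A\<psi>
        by (intro sum.cong refl) (simp add: scaleR_conv_of_real[symmetric] power2_eq_square)
      also have "\<dots> = (\<Sum>s\<le>n. (8 * fact n * (2 * pi) ^ n) *\<^sub>R ?P (h + n + 2))"
        by (intro sum.cong refl) (simp add: A_weight_fueter_weight)
      also have "\<dots> = C *\<^sub>R ?P (h + (n + 2))"
      proof -
        \<comment> \<open>All \<open>n + 1\<close> summands are equal, which raises
          \<open>fact n\<close> to \<open>fact (n + 1)\<close>.\<close>
        have "real (card {..n}) * (8 * fact n * (2 * pi) ^ n) = C" by (simp add: C_def algebra_simps)
        then show ?thesis by (simp only: sum_constant_scaleR scaleR_scaleR add.assoc)
      qed
      finally show ?thesis .
    qed
    \<comment> \<open>The coefficients of index below \<open>n + 2\<close> vanish, so the shifted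
      Parseval series has the same sum.\<close>
    moreover have "(\<lambda>h. C *\<^sub>R ?P (h + (n + 2))) sums (C *\<^sub>R L2_inner \<phi> \<psi>)"
      using hermite_space_Parseval[OF \<phi>(1) that(2)] \<phi>(2)
      by (intro sums_scaleR_right) (subst sums_zero_iff_shift, auto)
    ultimately show ?thesis unfolding A_inner_def by (simp add: sums_iff)
  qed
  have "A_norm n (fueter_bargmann n \<phi>) = sqrt (C * (L2_norm \<phi>)\<^sup>2)"
    unfolding A_norm_def inner[OF assms(1,1)] L2_inner_self[OF hermite_space_coeffs(1)[OF assms(1)]]
    by (simp del: of_real_power)
  also have "\<dots> = sqrt (2\<^sup>2 * 2) * sqrt (fact (n + 1)) * sqrt ((2 * pi) ^ n) * L2_norm \<phi>"
    by (simp add: C_def real_sqrt_mult L2_norm_nonneg del: fact_Suc)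
  also have "sqrt (2\<^sup>2 * 2) = 2 * sqrt 2" by (simp only: real_sqrt_mult real_sqrt_abs abs_numeral)
  also have "sqrt ((2 * pi) ^ n) = (2 * pi) powr (real n / 2)"
    by (simp add: powr_half_sqrt_powr powr_realpow)
  finally show ?thesis using inner[OF assms] by (simp add: C_def scaleR_conv_of_real)
qed

end
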